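(* Let $\Lambda$ be a lattice spanning the $s$-dimensional real vector space $V$ and $X$ a finite list of nonzero vectors in $\Lambda$ spanning $V$. For every $e^\phi\in P(X)$, under the logarithm isomorphism the localization $\mathbb C[\Lambda]/J_X(\phi)$ of $\mathbb C[\Lambda]/J_X$ at $e^\phi$ becomes isomorphic to the ring $A_{X_\phi}=S[V]/I_{X_\phi}$. Thus $$\mathbb C[\Lambda]/J_X\cong\bigoplus_{e^\phi\in P(X)}A_{X_\phi}.$$ In particular $\dim(\mathbb C[\Lambda]/J_X)=\delta(X)$.
   Context: $\mathbb C[\Lambda]$ is the group algebra with basis $e^a$, $a\in\Lambda$; it is the coordinate ring of the torus $T=\mathrm{Hom}(\Lambda,\mathbb C^* )$. With $U_{\mathbb C}=\mathrm{Hom}_{\mathbb R}(V,\mathbb C)$, each $\phi\in U_{\mathbb C}$ gives a point $e^\phi\in T$ at which $e^a$ takes the value $e^{\langle\phi\mid a\rangle}$. $S[V]$ denotes the symmetric algebra of $V\otimes\mathbb C$. Sublists of $X$ are identified with index sets. A sublist $Y$ of a list $Z$ of vectors spanning $V$ is a cocircuit of $Z$ if $Z-Y$ does not span $V$. $J_X\subset\mathbb C[\Lambda]$ is the ideal generated by $\prod_{v\in Y}(1-e^{-v})$, $Y$ running over the cocircuits of $X$. For a list $Z$ spanning $V$, $I_Z\subset S[V]$ is the ideal generated by $\prod_{v\in Y}v$, $Y$ running over the cocircuits of $Z$, and $A_Z=S[V]/I_Z$. For a basis $\underline b$ of $V$ extracted from $X$ (a sublist which is a basis), $T(\underline b)\subset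 T$ is the finite set of points where $e^a=1$ for all $a\in\underline b$, and $|\det(\underline b)|=[\Lambda:\Lambda_{\underline b}]$, where $\Lambda_{\underline b}$ is the lattice generated by $\underline b$. $\mathcal B(X)$ is the set of bases extracted from $X$ (counted by index sets), $P(X):=\bigcup_{\underline b\in\mathcal B(X)}T(\underline b)$, $\delta(X):=\sum_{\underline b\in\mathcal B(X)}|\det(\underline b)|$, and $X_\phi:=\{a\in X\mid e^{\langle\phi\mid a\rangle}=1\}$ (a sublist). The zero set of $J_X$ in $T$ is $P(X)$ and $\mathbb C[\Lambda]/J_X=\bigoplus_{e^\phi\in P(X)}\mathbb C[\Lambda]/J_X(\phi)$. Logarithm isomorphism: in a finite-dimensional quotient $S$ of $\mathbb C[\Lambda]$ supported at the single point $e^\phi$, the class of $e^{-\langle\phi\mid a\rangle}e^a-1$ is nilpotent; put $\tilde a:=\log\big(1+(e^{-\langle\phi\mid a\rangle}e^a-1)\big)\in S$. The map $a\mapsto\tilde a$ is additive and extends to a surjective algebra homomorphism $S[V]\to S$, identifying $S$ with a quotient of $S[V]$ supported at $0$. *)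

theory Defs
  imports
    Complex_Main
    "HOL-Algebra.Module"
    "HOL-Algebra.QuotRing"
    "HOL-Algebra.Embedded_Algebras"
    "HOL-Library.FuncSet"
    "HOL-Library.Poly_Mapping"
    "HOL-Computational_Algebra.Group_Closure"
begin

section \<open>Complex algebras\<close>

text \<open>
  A complex algebra is a record of type \<open>(complex, 'a) module\<close> from HOL-Algebra, i.e. a ring
  together with a scalar multiplication by complex numbers.
\<close>

definition monoid_alg :: "'m::comm_monoid_add set \<Rightarrow> (complex, 'm \<Rightarrow>\<^sub>0 complex) module" where
  "monoid_alg M =
    \<lparr> carrier = {f. Poly_Mapping.keys f \<subseteq> M}, monoid.mult = (*), one = 1, zero = 0, add = (+),
      smult = (\<lambda>c f. Poly_Mapping.single 0 c * f) \<rparr>"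

text \<open>The library quotient ring, enriched by the induced scalar multiplication on cosets.\<close>

definition quot_alg ::
  "(complex, 'a) module \<Rightarrow> 'a set \<Rightarrow> (complex, 'a set) module" where
  "quot_alg A I =
    ring.extend (A Quot I) (module.fields (\<lambda>c C. \<Union>x\<in>C. I +>\<^bsub>A\<^esub> (c \<odot>\<^bsub>A\<^esub> x)))"

text \<open>The fraction \<open>x / m\<close> with denominator in the multiplicative set \<open>M\<close>, as an equivalence class
  of pairs, and the ring of fractions.\<close>

definition frac_cls ::
  "(complex, 'a) module \<Rightarrow> 'a set \<Rightarrow> 'a \<Rightarrow> 'a \<Rightarrow> ('a \<times> 'a) set" where
  "frac_cls A M x m =
    {(y, n). y \<in> carrier A \<and> n \<in> M \<and>
       (\<exists>u\<in>M. u \<otimes>\<^bsub>A\<^esub> (n \<otimes>\<^bsub>A\<^esub> x) = u \<otimes>\<^bsub>A\<^esub> (m \<otimes>\<^bsub>A\<^esub> y))}"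

definition localization ::
  "(complex, 'a) module \<Rightarrow> 'a set \<Rightarrow> (complex, ('a \<times> 'a) set) module" where
  "localization A M =
    \<lparr> carrier = {frac_cls A M x m | x m. x \<in> carrier A \<and> m \<in> M},
      monoid.mult = (\<lambda>P Q. \<Union>(x, m)\<in>P. \<Union>(y, n)\<in>Q. frac_cls A M (x \<otimes>\<^bsub>A\<^esub> y) (m \<otimes>\<^bsub>A\<^esub> n)),
      one = frac_cls A M \<one>\<^bsub>A\<^esub> \<one>\<^bsub>A\<^esub>,
      zero = frac_cls A M \<zero>\<^bsub>A\<^esub> \<one>\<^bsub>A\<^esub>,
      add = (\<lambda>P Q. \<Union>(x, m)\<in>P. \<Union>(y, n)\<in>Q.
               frac_cls A M (n \<otimes>\<^bsub>A\<^esub> x \<oplus>\<^bsub>A\<^esub> m \<otimes>\<^bsub>A\<^esub> y) (m \<otimes>\<^bsub>A\<^esub> n)),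
      smult = (\<lambda>c P. \<Union>(x, m)\<in>P. frac_cls A M (c \<odot>\<^bsub>A\<^esub> x) m) \<rparr>"

text \<open>Direct sum of a finite family of algebras: the product with componentwise operations.\<close>

definition direct_sum_alg ::
  "'i set \<Rightarrow> ('i \<Rightarrow> (complex, 'a) module) \<Rightarrow> (complex, 'i \<Rightarrow> 'a) module" where
  "direct_sum_alg I F =
    \<lparr> carrier = (\<Pi>\<^sub>E i\<in>I. carrier (F i)),
      monoid.mult = (\<lambda>f g. \<lambda>i\<in>I. f i \<otimes>\<^bsub>F i\<^esub> g i),
      one = (\<lambda>i\<in>I. \<one>\<^bsub>F i\<^esub>),
      zero = (\<lambda>i\<in>I. \<zero>\<^bsub>F i\<^esub>),
      add = (\<lambda>f g. \<lambda>i\<in>I. f i \<oplus>\<^bsub>F i\<^esub> g i),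
      smult = (\<lambda>c f. \<lambda>i\<in>I. c \<odot>\<^bsub>F i\<^esub> f i) \<rparr>"

definition alg_iso ::
  "(complex, 'a) module \<Rightarrow> (complex, 'b) module \<Rightarrow> ('a \<Rightarrow> 'b) set" where
  "alg_iso A B =
    {h \<in> ring_iso A B. \<forall>c. \<forall>x\<in>carrier A. h (c \<odot>\<^bsub>A\<^esub> x) = c \<odot>\<^bsub>B\<^esub> h x}"

text \<open>The dimension of a complex algebra, via the library's dimension over the subring
  \<open>\<complex> \<cdot> 1\<close> of the algebra.  For a nonzero algebra this subring is a copy of the field of complex
  numbers.\<close>

definition has_complex_dim :: "(complex, 'a) module \<Rightarrow> nat \<Rightarrow> bool" where
  "has_complex_dim A n \<longleftrightarrow> ring.dimension A n (range (\<lambda>c. c \<odot>\<^bsub>A\<^esub> \<one>\<^bsub>A\<^esub>)) (carrier A)"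

definition nilpotent_elem :: "(complex, 'a) module \<Rightarrow> 'a \<Rightarrow> bool" where
  "nilpotent_elem A n \<longleftrightarrow> (\<exists>N::nat. n [^]\<^bsub>A\<^esub> N = \<zero>\<^bsub>A\<^esub>)"

text \<open>\<open>log (1 + n)\<close> for a nilpotent element \<open>n\<close>: the logarithm series, cut off where the powers
  of \<open>n\<close> vanish.\<close>

definition log1p_alg :: "(complex, 'a) module \<Rightarrow> 'a \<Rightarrow> 'a" where
  "log1p_alg A n =
    (\<Oplus>\<^bsub>A\<^esub>k\<in>{1..<(LEAST N::nat. n [^]\<^bsub>A\<^esub> N = \<zero>\<^bsub>A\<^esub>)}.
       ((- 1) ^ (k + 1) / of_nat k) \<odot>\<^bsub>A\<^esub> (n [^]\<^bsub>A\<^esub> k))"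

section \<open>Lattices, the torus and the points of the arrangement\<close>

text \<open>The real vector space \<open>V\<close> is the type \<open>'v\<close>; a spanning lattice is the additive group
  generated by a (finite) basis of \<open>V\<close>.\<close>

definition spanning_lattice :: "'v::real_vector set \<Rightarrow> bool" where
  "spanning_lattice \<Lambda> \<longleftrightarrow>
    (\<exists>B. finite B \<and> independent B \<and> span B = UNIV \<and> \<Lambda> = group_closure B)"

definition torus :: "'v::real_vector set \<Rightarrow> ('v \<Rightarrow> complex) set" where
  "torus \<Lambda> = {t \<in> \<Lambda> \<rightarrow>\<^sub>E (UNIV - {0}). \<forall>a\<in>\<Lambda>. \<forall>b\<in>\<Lambda>. t (a + b) = t a * t b}"

definition exp_point :: "'v::real_vector set \<Rightarrow> ('v \<Rightarrow> complex) \<Rightarrow> ('v \<Rightarrow> complex)" where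
  "exp_point \<Lambda> \<phi> = (\<lambda>a\<in>\<Lambda>. exp (\<phi> a))"

text \<open>Sublists of a list are given by sets of positions.\<close>

definition bases :: "'v::real_vector list \<Rightarrow> nat set set" where
  "bases X = {b. b \<subseteq> {..<length X} \<and> inj_on (nth X) b \<and>
                 independent (nth X ` b) \<and> span (nth X ` b) = UNIV}"

definition cocircuits :: "'v::real_vector list \<Rightarrow> nat set set" where
  "cocircuits Z = {Y. Y \<subseteq> {..<length Z} \<and> span (nth Z ` ({..<length Z} - Y)) \<noteq> UNIV}"

definition torus_points :: "'v::real_vector set \<Rightarrow> 'v list \<Rightarrow> nat set \<Rightarrow> ('v \<Rightarrow> complex) set" where
  "torus_points \<Lambda> X b = {t \<in> torus \<Lambda>. \<forall>i\<in>b. t (X ! i) = 1}"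

definition P_points :: "'v::real_vector set \<Rightarrow> 'v list \<Rightarrow> ('v \<Rightarrow> complex) set" where
  "P_points \<Lambda> X = (\<Union>b\<in>bases X. torus_points \<Lambda> X b)"

text \<open>\<open>|det b| = [\<Lambda> : \<Lambda>\<^sub>b]\<close>, the number of cosets of \<open>\<Lambda>\<^sub>b\<close> in \<open>\<Lambda>\<close>.\<close>

definition abs_det :: "'v::real_vector set \<Rightarrow> 'v list \<Rightarrow> nat set \<Rightarrow> nat" where
  "abs_det \<Lambda> X b = card ((\<lambda>a. (+) a ` group_closure (nth X ` b)) ` \<Lambda>)"

definition delta :: "'v::real_vector set \<Rightarrow> 'v list \<Rightarrow> nat" where
  "delta \<Lambda> X = (\<Sum>b\<in>bases X. abs_det \<Lambda> X b)"

text \<open>\<open>X\<^sub>\<phi>\<close>, as a function of the point \<open>t = e\<^sup>\<phi>\<close> of the torus.\<close>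

definition sublist_at :: "'v list \<Rightarrow> ('v \<Rightarrow> complex) \<Rightarrow> 'v list" where
  "sublist_at X t = filter (\<lambda>a. t a = 1) X"

section \<open>The group algebra and its quotient\<close>

abbreviation group_alg :: "'v::real_vector set \<Rightarrow> (complex, 'v \<Rightarrow>\<^sub>0 complex) module" where
  "group_alg \<Lambda> \<equiv> monoid_alg \<Lambda>"

definition expo :: "'v::real_vector \<Rightarrow> ('v \<Rightarrow>\<^sub>0 complex)" where
  "expo a = Poly_Mapping.single a 1"

definition eval_at :: "('v::real_vector \<Rightarrow> complex) \<Rightarrow> ('v \<Rightarrow>\<^sub>0 complex) \<Rightarrow> complex" where
  "eval_at t f = (\<Sum>a\<in>Poly_Mapping.keys f. Poly_Mapping.lookup f a * t a)"

definition J_ideal :: "'v::real_vector set \<Rightarrow> 'v list \<Rightarrow> ('v \<Rightarrow>\<^sub>0 complex) set" where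
  "J_ideal \<Lambda> X = genideal (group_alg \<Lambda>) {\<Prod>i\<in>Y. 1 - expo (- (X ! i)) | Y. Y \<in> cocircuits X}"

definition J_quot :: "'v::real_vector set \<Rightarrow> 'v list \<Rightarrow> (complex, ('v \<Rightarrow>\<^sub>0 complex) set) module" where
  "J_quot \<Lambda> X = quot_alg (group_alg \<Lambda>) (J_ideal \<Lambda> X)"

definition J_cls :: "'v::real_vector set \<Rightarrow> 'v list \<Rightarrow> ('v \<Rightarrow>\<^sub>0 complex) \<Rightarrow> ('v \<Rightarrow>\<^sub>0 complex) set" where
  "J_cls \<Lambda> X f = J_ideal \<Lambda> X +>\<^bsub>group_alg \<Lambda>\<^esub> f"

text \<open>Localization of \<open>\<complex>[\<Lambda>]/J\<^sub>X\<close> at the point \<open>t\<close>: the denominators are the classes of the functions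
  in \<open>\<complex>[\<Lambda>]\<close> that do not vanish at \<open>t\<close>.\<close>

definition denominators :: "'v::real_vector set \<Rightarrow> 'v list \<Rightarrow> ('v \<Rightarrow> complex) \<Rightarrow> ('v \<Rightarrow>\<^sub>0 complex) set set" where
  "denominators \<Lambda> X t = {J_cls \<Lambda> X g | g. g \<in> carrier (group_alg \<Lambda>) \<and> eval_at t g \<noteq> 0}"

definition J_loc :: "'v::real_vector set \<Rightarrow> 'v list \<Rightarrow> ('v \<Rightarrow> complex) \<Rightarrow>
    (complex, (('v \<Rightarrow>\<^sub>0 complex) set \<times> ('v \<Rightarrow>\<^sub>0 complex) set) set) module" where
  "J_loc \<Lambda> X t = localization (J_quot \<Lambda> X) (denominators \<Lambda> X t)"

definition J_loc_cls :: "'v::real_vector set \<Rightarrow> 'v list \<Rightarrow> ('v \<Rightarrow> complex) \<Rightarrow> ('v \<Rightarrow>\<^sub>0 complex) \<Rightarrow>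
    (('v \<Rightarrow>\<^sub>0 complex) set \<times> ('v \<Rightarrow>\<^sub>0 complex) set) set" where
  "J_loc_cls \<Lambda> X t f = frac_cls (J_quot \<Lambda> X) (denominators \<Lambda> X t) (J_cls \<Lambda> X f) \<one>\<^bsub>J_quot \<Lambda> X\<^esub>"

text \<open>The class of \<open>exp (- \<phi> a) e\<^sup>a - 1\<close> in the localization at \<open>e\<^sup>\<phi>\<close>.\<close>

definition unip :: "'v::real_vector set \<Rightarrow> 'v list \<Rightarrow> ('v \<Rightarrow> complex) \<Rightarrow> 'v \<Rightarrow>
    (('v \<Rightarrow>\<^sub>0 complex) set \<times> ('v \<Rightarrow>\<^sub>0 complex) set) set" where
  "unip \<Lambda> X \<phi> a =
    J_loc_cls \<Lambda> X (exp_point \<Lambda> \<phi>) (exp (- \<phi> a) \<odot>\<^bsub>group_alg \<Lambda>\<^esub> expo a - 1)"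

section \<open>The symmetric algebra and the algebras \<open>A\<^sub>Z\<close>\<close>

text \<open>The symmetric algebra of \<open>V \<otimes> \<complex>\<close> is the universal commutative complex algebra receiving a
  real-linear map from \<open>V\<close>.  It is presented by one generator \<open>x\<^sub>v\<close> for each vector \<open>v\<close>, with the
  relations of real linearity.\<close>

definition gen_var :: "'v::real_vector \<Rightarrow> (('v \<Rightarrow>\<^sub>0 nat) \<Rightarrow>\<^sub>0 complex)" where
  "gen_var v = Poly_Mapping.single (Poly_Mapping.single v 1) 1"

abbreviation free_alg :: "(complex, ('v::real_vector \<Rightarrow>\<^sub>0 nat) \<Rightarrow>\<^sub>0 complex) module" where
  "free_alg \<equiv> monoid_alg UNIV"

definition linear_relations :: "(('v::real_vector \<Rightarrow>\<^sub>0 nat) \<Rightarrow>\<^sub>0 complex) set" where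
  "linear_relations =
    genideal free_alg
      ({gen_var (u + v) - gen_var u - gen_var v | u v. True} \<union>
       {gen_var (r *\<^sub>R v) - complex_of_real r \<odot>\<^bsub>free_alg\<^esub> gen_var v | r v. True})"

definition sym_alg :: "(complex, (('v::real_vector \<Rightarrow>\<^sub>0 nat) \<Rightarrow>\<^sub>0 complex) set) module" where
  "sym_alg = quot_alg free_alg linear_relations"

definition sym_vec :: "'v::real_vector \<Rightarrow> (('v \<Rightarrow>\<^sub>0 nat) \<Rightarrow>\<^sub>0 complex) set" where
  "sym_vec v = linear_relations +>\<^bsub>free_alg\<^esub> gen_var v"

definition I_ideal :: "'v::real_vector list \<Rightarrow> (('v \<Rightarrow>\<^sub>0 nat) \<Rightarrow>\<^sub>0 complex) set set" where
  "I_ideal Z =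
    genideal sym_alg {\<Otimes>\<^bsub>sym_alg\<^esub>i\<in>Y. sym_vec (Z ! i) | Y. Y \<in> cocircuits Z}"

definition A_alg :: "'v::real_vector list \<Rightarrow>
    (complex, (('v \<Rightarrow>\<^sub>0 nat) \<Rightarrow>\<^sub>0 complex) set set) module" where
  "A_alg Z = quot_alg sym_alg (I_ideal Z)"

definition A_vec :: "'v::real_vector list \<Rightarrow> 'v \<Rightarrow> (('v \<Rightarrow>\<^sub>0 nat) \<Rightarrow>\<^sub>0 complex) set set" where
  "A_vec Z v = I_ideal Z +>\<^bsub>sym_alg\<^esub> sym_vec v"

end

theory Submission
  imports
    Defs
    "HOL-Computational_Algebra.Formal_Power_Series"
    "HOL-Computational_Algebra.Polynomial"
begin

text \<open>
  Put \<open>R = \<complex>[\<Lambda>]\<close>. At a point \<open>t\<close> the map \<open>e\<^sup>a \<mapsto> t(a) exp(a)\<close>, with the exponential series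
  truncated, is a homomorphism from \<open>R\<close> to the algebra \<open>A\<close> of the sublist \<open>X\<^sub>t\<close>, in which all vectors
  are nilpotent. It kills \<open>J\<^sub>X\<close>, because \<open>1 - exp(-v)\<close> is a multiple of \<open>v\<close>, and it is onto, because the
  logarithm recovers \<open>a\<close>. By the Chinese remainder theorem \<open>R / J\<^sub>X\<close> maps onto the direct sum of these
  algebras, and this map is shown to be injective by counting dimensions.

  Contracting and deleting the vectors of \<open>X\<close> one at a time shows that \<open>\<delta>(X)\<close> elements span \<open>R / J\<^sub>X\<close>.
  Conversely, the algebra of a list \<open>Z\<close> has dimension at least the number of bases of \<open>Z\<close>: moving the
  hyperplanes \<open>z\<^sub>i = 0\<close> generically, the bases cut out distinct points, and a homogeneous set spanning the
  algebra also spans the functions on these points. Summing over all \<open>t\<close> and exchanging the sums gives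
  \<open>\<delta>(X)\<close>, since \<open>T(b)\<close> is the character group of \<open>\<Lambda> / \<Lambda>\<^sub>b\<close> and has \<open>|det b|\<close> elements. Finally
  the localization at \<open>t\<close> is identified with the corresponding summand, since its kernel is annihilated by
  a function which does not vanish at \<open>t\<close>.
\<close>

text \<open>The kernel \<open>J'\<close> of the map to the direct sum is not computed directly; it
  is squeezed. A family of at most \<open>delta \<Lambda> X\<close> elements spans modulo
  \<open>J_ideal\<close>, hence modulo the larger \<open>J'\<close>, while lifted bases of the local
  algebras show that no smaller family spans modulo \<open>J'\<close>. So the family is independent
  modulo \<open>J'\<close>, which forces \<open>J' = J_ideal\<close>. One-sided estimates therefore
  suffice at every stage. Calculations are made on representatives: the iterated quotient
  \<open>A_alg Z\<close> is replaced by polynomials modulo a single ideal \<open>K_ideal Z\<close>,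
  and the local maps are polynomial-valued and multiplicative only modulo that ideal. All points of
  the torus then share one target type and one truncation order, which comes from the vanishing of
  \<open>A_alg Z\<close> in degrees above \<open>length Z\<close>. In the lower bound the ideal of
  the moved points is not homogeneous, so it cannot be compared with \<open>K_ideal Z\<close>
  directly. Each generator of \<open>K_ideal Z\<close> does agree with a polynomial vanishing on the
  points up to terms of lower degree, which permits an induction on the degree.\<close>

abbreviation lookup :: "('a \<Rightarrow>\<^sub>0 'b::zero) \<Rightarrow> 'a \<Rightarrow> 'b" where "lookup \<equiv> Poly_Mapping.lookup"
abbreviation keys :: "('a \<Rightarrow>\<^sub>0 'b::zero) \<Rightarrow> 'a set" where "keys \<equiv> Poly_Mapping.keys"
abbreviation single :: "'a \<Rightarrow> 'b \<Rightarrow> ('a \<Rightarrow>\<^sub>0 'b::zero)" where "single \<equiv> Poly_Mapping.single"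

section \<open>Congruences modulo an ideal\<close>

text \<open>The ideal lives in a type-class ring, so congruences chain by ordinary arithmetic
  without carrier conditions. The polynomial ideals \<open>K_ideal\<close> are used in this
  form.\<close>

locale ideal_congruence =
  fixes K :: "'a::comm_ring_1 set"
  assumes zero_mem: "0 \<in> K"
    and add_mem: "x \<in> K \<Longrightarrow> y \<in> K \<Longrightarrow> x + y \<in> K"
    and mult_mem: "x \<in> K \<Longrightarrow> a * x \<in> K"
begin

definition equiv_mod :: "'a \<Rightarrow> 'a \<Rightarrow> bool" (infix "\<approx>" 50)
  where "x \<approx> y \<longleftrightarrow> x - y \<in> K"

lemma mult_mem_right: "x \<in> K \<Longrightarrow> x * a \<in> K"
  using mult_mem[of x a] by (simp add: mult.commute)

lemma uminus_mem: "x \<in> K \<Longrightarrow> - x \<in> K"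
  using mult_mem[of x "-1"] by simp

lemma diff_mem: "x \<in> K \<Longrightarrow> y \<in> K \<Longrightarrow> x - y \<in> K"
  using add_mem[of x "- y"] uminus_mem[of y] by simp

lemma sum_mem: "(\<And>i. i \<in> A \<Longrightarrow> f i \<in> K) \<Longrightarrow> sum f A \<in> K"
  by (induction A rule: infinite_finite_induct) (auto simp: zero_mem add_mem)

lemma equiv_refl [simp]: "x \<approx> x"
  by (simp add: equiv_mod_def zero_mem)

lemma equiv_sym: "x \<approx> y \<Longrightarrow> y \<approx> x"
  using uminus_mem[of "x - y"] by (simp add: equiv_mod_def)

lemma equiv_trans [trans]: "x \<approx> y \<Longrightarrow> y \<approx> z \<Longrightarrow> x \<approx> z"
  using add_mem[of "x - y" "y - z"] by (simp add: equiv_mod_def)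

lemma equiv_zero_iff: "x \<approx> 0 \<longleftrightarrow> x \<in> K"
  by (simp add: equiv_mod_def)

lemma equiv_mem_iff: "x \<approx> y \<Longrightarrow> x \<in> K \<longleftrightarrow> y \<in> K"
  using equiv_trans equiv_sym equiv_zero_iff by metis

lemma equiv_add: "x \<approx> y \<Longrightarrow> x' \<approx> y' \<Longrightarrow> x + x' \<approx> y + y'"
  using add_mem[of "x - y" "x' - y'"] by (simp add: equiv_mod_def algebra_simps)

lemma equiv_diff: "x \<approx> y \<Longrightarrow> x' \<approx> y' \<Longrightarrow> x - x' \<approx> y - y'"
  using diff_mem[of "x - y" "x' - y'"] by (simp add: equiv_mod_def algebra_simps)

lemma equiv_mult:
  assumes "x \<approx> y" "x' \<approx> y'"
  shows "x * x' \<approx> y * y'"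
proof -
  have "x' * (x - y) + y * (x' - y') \<in> K"
    using assms by (intro add_mem mult_mem) (auto simp: equiv_mod_def)
  then show ?thesis by (simp add: equiv_mod_def algebra_simps)
qed

lemma equiv_sum: "(\<And>i. i \<in> A \<Longrightarrow> f i \<approx> g i) \<Longrightarrow> sum f A \<approx> sum g A"
  by (induction A rule: infinite_finite_induct) (auto intro: equiv_add)

lemma equiv_prod: "(\<And>i. i \<in> A \<Longrightarrow> f i \<approx> g i) \<Longrightarrow> prod f A \<approx> prod g A"
  by (induction A rule: infinite_finite_induct) (auto intro: equiv_mult)

lemma equiv_power: "x \<approx> y \<Longrightarrow> x ^ n \<approx> y ^ n"
  by (induction n) (auto intro: equiv_mult)

lemma power_mem_mono: "x ^ m \<in> K \<Longrightarrow> m \<le> n \<Longrightarrow> x ^ n \<in> K"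
  using mult_mem[of "x ^ m" "x ^ (n - m)"] by (simp flip: power_add)

text \<open>The Cauchy product modulo \<open>K\<close>: the part of the square with
  \<open>i + j \<ge> N\<close> lies in \<open>K\<close>, and the remaining triangle is summed along
  its antidiagonals.\<close>

lemma sum_square_equiv_triangle:
  fixes N :: nat
  assumes "\<And>i j. N \<le> i + j \<Longrightarrow> h i j \<in> K"
  shows "(\<Sum>i<N. \<Sum>j<N. h i j) \<approx> (\<Sum>k<N. \<Sum>i\<le>k. h i (k - i))"
proof -
  let ?T = "{(i, j). i + j < N}"
  have "(\<Sum>i<N. \<Sum>j<N. h i j) = (\<Sum>(i, j)\<in>{..<N} \<times> {..<N}. h i j)"
    by (simp add: sum.cartesian_product)
  also have "\<dots> = (\<Sum>(i, j)\<in>?T. h i j) + (\<Sum>(i, j)\<in>{..<N} \<times> {..<N} - ?T. h i j)"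
    by (subst sum.subset_diff[of ?T]) (auto simp: add.commute)
  also have "\<dots> \<approx> (\<Sum>(i, j)\<in>?T. h i j) + 0"
  proof (rule equiv_add[OF equiv_refl])
    show "(\<Sum>(i, j)\<in>{..<N} \<times> {..<N} - ?T. h i j) \<approx> 0"
      unfolding equiv_zero_iff by (rule sum_mem) (auto intro: assms)
  qed
  also have "(\<Sum>(i, j)\<in>?T. h i j) + 0 = (\<Sum>k<N. \<Sum>i\<le>k. h i (k - i))"
    by (simp add: sum.triangle_reindex)
  finally show ?thesis .
qed

text \<open>The inverse is a geometric series in \<open>- (c' * n)\<close>, multiplied by
  \<open>c'\<close>; nilpotency of \<open>n\<close> modulo \<open>K\<close> makes it finite.\<close>

lemma unit_plus_nilpotent:
  assumes "c * c' = 1" "n ^ N \<in> K"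
  shows "\<exists>u. u * (c + n) \<approx> 1"
proof -
  let ?m = "- (c' * n)"
  have "c' * (c + n) = 1 - ?m"
    using assms(1) by (simp add: algebra_simps)
  then have "(\<Sum>k<N. ?m ^ k) * c' * (c + n) = (1 - ?m) * (\<Sum>k<N. ?m ^ k)"
    by (simp add: mult.assoc mult.commute[of "1 - ?m"])
  also have "\<dots> = 1 - ?m ^ N"
    by (rule one_diff_power_eq[symmetric])
  also have "\<dots> \<approx> 1"
  proof -
    have "?m ^ N = ((-1) ^ N * c' ^ N) * n ^ N"
      by (simp add: power_minus[of "c' * n"] power_mult_distrib mult.assoc)
    then have "?m ^ N \<in> K"
      using mult_mem[OF assms(2)] by simp
    then show ?thesis
      using uminus_mem by (simp add: equiv_mod_def)
  qed
  finally show ?thesis by blast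
qed

end

section \<open>Functions on a monoid with finite support\<close>

definition const :: "'b \<Rightarrow> ('m::zero \<Rightarrow>\<^sub>0 'b::zero)" where
  "const c = single 0 c"

lemma const_0 [simp]: "const 0 = 0"
  by (simp add: const_def)

lemma const_1 [simp]: "const (1::'b::zero_neq_one) = 1"
  by (simp add: const_def)

lemma const_add: "const (a + b) = const a + const (b :: 'b::comm_monoid_add)"
  by (simp add: const_def single_add)

lemma const_uminus: "const (- b) = - const (b :: 'b::ab_group_add)"
  by (simp add: const_def single_uminus)

lemma const_diff: "const (a - b) = const a - const (b :: 'b::ab_group_add)"
  by (simp add: const_def single_diff)

lemma const_mult:
  "(const (a * b) :: 'm::comm_monoid_add \<Rightarrow>\<^sub>0 'b::comm_semiring_1) = const a * const b"
  by (simp add: const_def mult_single)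

lemma const_sum: "const (sum f A) = (\<Sum>i\<in>A. const (f i :: 'b::comm_monoid_add))"
  by (induction A rule: infinite_finite_induct) (simp_all add: const_add)

lemma const_mult_single:
  "const c * single (m :: 'm::comm_monoid_add) d = single m (c * (d :: 'b::comm_semiring_1))"
  by (simp add: const_def mult_single)

lemma lookup_const_mult:
  "lookup (const c * f) (m :: 'm::comm_monoid_add) = c * lookup f m"
  for c :: "'b::comm_semiring_1"
  unfolding const_def mult_map_scale_conv_mult[symmetric]
  by (simp add: Poly_Mapping.map.rep_eq when_def)

lemma sum_single_keys:
  "f = (\<Sum>a\<in>keys f. single a (lookup f a))"
  for f :: "'m \<Rightarrow>\<^sub>0 'b::comm_monoid_add"
  by (rule poly_mapping_eqI) (auto simp: lookup_sum lookup_single when_def in_keys_iff)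

lemma poly_mapping_additive_induct:
  fixes f :: "'m \<Rightarrow>\<^sub>0 'b::comm_monoid_add"
  assumes "keys f \<subseteq> M" and "P 0" and "\<And>f g. P f \<Longrightarrow> P g \<Longrightarrow> P (f + g)"
    and "\<And>a c. a \<in> M \<Longrightarrow> P (single a c)"
  shows "P f"
proof -
  have "P (\<Sum>a\<in>A. single a (lookup f a))" if "finite A" "A \<subseteq> keys f" for A
    using that by (induction rule: finite_induct) (use assms in auto)
  from this[of "keys f"] show ?thesis
    using sum_single_keys[of f] by simp
qed

text \<open>The linear extension of \<open>\<chi>\<close> from monoid elements to the monoid
  algebra. Taking \<open>\<iota>\<close> to be the identity gives evaluations, taking it to be
  \<open>const\<close> gives maps into another monoid algebra.\<close>

definition lift :: "('b::zero \<Rightarrow> 'c) \<Rightarrow> ('m \<Rightarrow> 'c) \<Rightarrow> ('m \<Rightarrow>\<^sub>0 'b) \<Rightarrow> 'c::comm_ring_1" where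
  "lift \<iota> \<chi> f = (\<Sum>a\<in>keys f. \<iota> (lookup f a) * \<chi> a)"

locale semiring_embedding =
  fixes \<iota> :: "'b::comm_ring_1 \<Rightarrow> 'c::comm_ring_1"
  assumes \<iota>_add: "\<iota> (a + b) = \<iota> a + \<iota> b"
    and \<iota>_mult: "\<iota> (a * b) = \<iota> a * \<iota> b"
    and \<iota>_1: "\<iota> 1 = 1"
begin

lemma \<iota>_0: "\<iota> 0 = 0"
  using \<iota>_add[of 0 0] by simp

lemma lift_superset:
  assumes "finite S" "keys f \<subseteq> S"
  shows "lift \<iota> \<chi> f = (\<Sum>a\<in>S. \<iota> (lookup f a) * \<chi> a)"
  unfolding lift_def by (rule sum.mono_neutral_left) (use assms in \<open>auto simp: in_keys_iff \<iota>_0\<close>)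

lemma lift_add: "lift \<iota> \<chi> (f + g) = lift \<iota> \<chi> f + lift \<iota> \<chi> g"
proof -
  have "lift \<iota> \<chi> h = (\<Sum>a\<in>keys f \<union> keys g. \<iota> (lookup h a) * \<chi> a)" if "h \<in> {f, g, f + g}" for h
    by (rule lift_superset) (use that keys_add[of f g] in auto)
  then show ?thesis
    by (simp add: lookup_add \<iota>_add distrib_right sum.distrib)
qed

lemma lift_0: "lift \<iota> \<chi> 0 = 0"
  by (simp add: lift_def)

lemma lift_single: "lift \<iota> \<chi> (single a c) = \<iota> c * \<chi> a"
  by (subst lift_superset[of "{a}"]) auto

lemma lift_uminus: "lift \<iota> \<chi> (- f) = - lift \<iota> \<chi> f"
  using lift_add[of \<chi> f "- f"] by (simp add: lift_0 eq_neg_iff_add_eq_0 add.commute)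

lemma lift_diff: "lift \<iota> \<chi> (f - g) = lift \<iota> \<chi> f - lift \<iota> \<chi> g"
  using lift_add[of \<chi> f "- g"] by (simp add: lift_uminus)

lemma lift_sum: "lift \<iota> \<chi> (sum f A) = (\<Sum>i\<in>A. lift \<iota> \<chi> (f i))"
  by (induction A rule: infinite_finite_induct) (simp_all add: lift_0 lift_add)

lemma lift_1: "\<chi> 0 = 1 \<Longrightarrow> lift \<iota> \<chi> 1 = 1"
  using lift_single[of \<chi> 0 1] by (simp add: \<iota>_1)

lemma lift_const: "\<chi> 0 = 1 \<Longrightarrow> lift \<iota> \<chi> (const c) = \<iota> c"
  using lift_single[of \<chi> 0 c] by (simp add: const_def)

text \<open>Multiplicativity of \<open>\<chi>\<close> is required only modulo \<open>K\<close>,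
  since truncated exponentials satisfy the functional equation only there.\<close>

lemma lift_mult_mod:
  assumes "ideal_congruence K"
    and \<chi>: "\<And>a b. a \<in> M \<Longrightarrow> b \<in> M \<Longrightarrow> ideal_congruence.equiv_mod K (\<chi> (a + b)) (\<chi> a * \<chi> b)"
    and "keys f \<subseteq> M" "keys g \<subseteq> M"
  shows "ideal_congruence.equiv_mod K (lift \<iota> \<chi> (f * g)) (lift \<iota> \<chi> f * lift \<iota> \<chi> g)"
proof -
  interpret ideal_congruence K by fact
  have fg: "f * g = (\<Sum>a\<in>keys f. \<Sum>b\<in>keys g. single (a + b) (lookup f a * lookup g b))"
    using arg_cong2[where f = "(*)", OF sum_single_keys[of f] sum_single_keys[of g]]
    by (simp only: sum_product mult_single)
  have "lift \<iota> \<chi> (f * g) = (\<Sum>a\<in>keys f. \<Sum>b\<in>keys g. \<iota> (lookup f a) * \<iota> (lookup g b) * \<chi> (a + b))"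
    unfolding fg by (simp add: lift_sum lift_single \<iota>_mult)
  also have "\<dots> \<approx> (\<Sum>a\<in>keys f. \<Sum>b\<in>keys g. \<iota> (lookup f a) * \<iota> (lookup g b) * (\<chi> a * \<chi> b))"
    by (intro equiv_sum equiv_mult equiv_refl \<chi>) (use assms in auto)
  also have "\<dots> = lift \<iota> \<chi> f * lift \<iota> \<chi> g"
    by (simp add: lift_def sum_product mult_ac)
  finally show ?thesis .
qed

lemma lift_mult:
  assumes "\<And>a b. a \<in> M \<Longrightarrow> b \<in> M \<Longrightarrow> \<chi> (a + b) = \<chi> a * \<chi> b"
    and "keys f \<subseteq> M" "keys g \<subseteq> M"
  shows "lift \<iota> \<chi> (f * g) = lift \<iota> \<chi> f * lift \<iota> \<chi> g"
proof -
  interpret ideal_congruence "{0 :: 'c}" by unfold_locales auto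
  from lift_mult_mod[OF ideal_congruence_axioms _ assms(2,3), of \<chi>] assms(1)
  show ?thesis by (simp add: equiv_mod_def)
qed

end

global_interpretation id: semiring_embedding "\<lambda>c :: 'b::comm_ring_1. c"
  by unfold_locales auto

global_interpretation const: semiring_embedding
  "const :: 'b::comm_ring_1 \<Rightarrow> ('m::comm_monoid_add \<Rightarrow>\<^sub>0 'b)"
  by unfold_locales (auto simp: const_add const_mult)

section \<open>Truncated power series\<close>

unbundle fps_syntax

text \<open>The series is cut below degree \<open>N\<close>. For \<open>x ^ N \<in> K\<close> this
  amounts to substitution into the full series modulo \<open>K\<close>, so formal identities carry
  over to the quotient.\<close>

definition fps_at :: "nat \<Rightarrow> complex fps \<Rightarrow> ('m::comm_monoid_add \<Rightarrow>\<^sub>0 complex) \<Rightarrow> ('m \<Rightarrow>\<^sub>0 complex)" where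
  "fps_at N F x = (\<Sum>k<N. const (F $ k) * x ^ k)"

lemma fps_at_diff: "fps_at N (F - G) x = fps_at N F x - fps_at N G x"
  by (simp add: fps_at_def const_diff left_diff_distrib sum_subtractf)

lemma fps_at_1: "N > 0 \<Longrightarrow> fps_at N 1 x = 1"
  unfolding fps_at_def by (subst sum.remove[of _ 0]) (auto intro: sum.neutral)

lemma fps_at_X: "N > 1 \<Longrightarrow> fps_at N fps_X x = x"
  unfolding fps_at_def by (subst sum.remove[of _ 1]) (auto intro: sum.neutral)

lemma fps_at_multiple:
  assumes "F $ 0 = 0"
  shows "\<exists>u. fps_at N F x = x * u"
proof -
  have "x dvd fps_at N F x"
    unfolding fps_at_def
  proof (rule dvd_sum)
    fix k
    show "x dvd const (F $ k) * x ^ k"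
      using assms by (cases k) auto
  qed
  then show ?thesis by (auto simp: dvd_def)
qed

locale pm_ideal = ideal_congruence K for K :: "('m::comm_monoid_add \<Rightarrow>\<^sub>0 complex) set"
begin

lemma fps_at_cong: "x \<approx> y \<Longrightarrow> fps_at N F x \<approx> fps_at N F y"
  unfolding fps_at_def by (intro equiv_sum equiv_mult equiv_power equiv_refl)

lemma fps_at_mult:
  assumes "x ^ N \<in> K"
  shows "fps_at N (F * G) x \<approx> fps_at N F x * fps_at N G x"
proof -
  let ?h = "\<lambda>i j. const (F $ i) * const (G $ j) * x ^ (i + j)"
  have "fps_at N F x * fps_at N G x = (\<Sum>i<N. \<Sum>j<N. ?h i j)"
    by (simp add: fps_at_def sum_product power_add mult_ac)
  also have "\<dots> \<approx> (\<Sum>k<N. \<Sum>i\<le>k. ?h i (k - i))"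
    by (intro sum_square_equiv_triangle mult_mem power_mem_mono[OF assms])
  also have "\<dots> = fps_at N (F * G) x"
    by (simp add: fps_at_def fps_mult_nth const_sum const_mult sum_distrib_right atLeast0AtMost)
  finally show ?thesis
    by (rule equiv_sym)
qed

lemma fps_at_power:
  assumes "x ^ N \<in> K" "N > 0"
  shows "fps_at N (F ^ n) x \<approx> fps_at N F x ^ n"
proof (induction n)
  case (Suc n)
  have "fps_at N (F ^ Suc n) x \<approx> fps_at N F x * fps_at N (F ^ n) x"
    using fps_at_mult[OF assms(1)] by simp
  also have "\<dots> \<approx> fps_at N F x * fps_at N F x ^ n"
    by (intro equiv_mult Suc.IH equiv_refl)
  finally show ?case by simp
qed (simp add: fps_at_1 assms)

lemma fps_at_compose:
  assumes "x ^ N \<in> K" "N > 0" "G $ 0 = 0"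
  shows "fps_at N (F oo G) x \<approx> fps_at N F (fps_at N G x)"
proof -
  \<comment> \<open>Since \<open>G\<close> starts in degree at least 1, \<open>G ^ i\<close> has no
    term below degree \<open>i\<close>; the inner sum may therefore run up to \<open>N\<close> for
    all \<open>n\<close> at once.\<close>
  have coeff: "(F oo G) $ n = (\<Sum>i<N. F $ i * (G ^ i) $ n)" if "n < N" for n
  proof -
    have "(F oo G) $ n = (\<Sum>i\<in>{0..n}. F $ i * (G ^ i) $ n)"
      by (simp add: fps_compose_nth)
    also have "\<dots> = (\<Sum>i<N. F $ i * (G ^ i) $ n)"
      using that startsby_zero_power_prefix[OF assms(3)]
      by (intro sum.mono_neutral_left) auto
    finally show ?thesis .
  qed
  have "fps_at N (F oo G) x = (\<Sum>n<N. \<Sum>i<N. const (F $ i) * (const ((G ^ i) $ n) * x ^ n))"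
    unfolding fps_at_def
    by (intro sum.cong refl) (simp add: coeff const_sum const_mult sum_distrib_right mult.assoc)
  also have "\<dots> = (\<Sum>i<N. const (F $ i) * fps_at N (G ^ i) x)"
    by (subst sum.swap) (simp add: fps_at_def sum_distrib_left)
  also have "\<dots> \<approx> (\<Sum>i<N. const (F $ i) * fps_at N G x ^ i)"
    by (intro equiv_sum equiv_mult equiv_refl fps_at_power assms)
  finally show ?thesis by (simp add: fps_at_def)
qed

text \<open>Formally \<open>fps_ln 1\<close> is the compositional inverse of
  \<open>fps_exp 1 - 1\<close>, and \<open>fps_at_compose\<close> transfers this to nilpotent
  elements.\<close>

lemma log_exp:
  assumes "x ^ N \<in> K" "N > 0"
  shows "fps_at N (fps_ln 1) (fps_at N (fps_exp 1) x - 1) \<approx> x"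
\<comment> \<open>With \<open>N = 1\<close> the series \<open>fps_X\<close> is truncated to
  \<open>0\<close>; in that case \<open>x\<close> itself lies in \<open>K\<close>.\<close>
proof (cases "N = 1")
  case True
  then show ?thesis
    using assms uminus_mem[of x] by (simp add: fps_at_def fps_ln_def equiv_mod_def)
next
  case False
  have G: "(fps_exp 1 - 1 :: complex fps) $ 0 = 0" "(fps_exp 1 - 1 :: complex fps) $ 1 \<noteq> 0"
    by simp_all
  have "fps_at N (fps_ln 1) (fps_at N (fps_exp 1) x - 1) = fps_at N (fps_ln 1) (fps_at N (fps_exp 1 - 1) x)"
    using assms by (simp add: fps_at_diff fps_at_1)
  also have "\<dots> \<approx> fps_at N (fps_ln 1 oo (fps_exp 1 - 1)) x"
    by (rule equiv_sym, rule fps_at_compose[OF assms]) (rule G)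
  also have "fps_ln 1 oo (fps_exp 1 - 1) = (fps_X :: complex fps)"
    using fps_inv[OF G] by (simp add: fps_ln_fps_exp_inv)
  also have "fps_at N fps_X x = x"
    using False assms by (simp add: fps_at_X)
  finally show ?thesis .
qed

text \<open>The binomial theorem. The hypothesis bounds mixed monomials, because nilpotency of order
  \<open>N\<close> for \<open>x\<close> and \<open>y\<close> separately would not suffice to discard
  all terms with \<open>i + j \<ge> N\<close>.\<close>

lemma exp_add:
  assumes "\<And>i j. i + j \<ge> N \<Longrightarrow> x ^ i * y ^ j \<in> K"
  shows "fps_at N (fps_exp 1) (x + y) \<approx> fps_at N (fps_exp 1) x * fps_at N (fps_exp 1) y"
proof -
  let ?c = "\<lambda>i. 1 / fact i :: complex"
  let ?h = "\<lambda>i j. const (?c i) * const (?c j) * (x ^ i * y ^ j)"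
  have "fps_at N (fps_exp 1) x * fps_at N (fps_exp 1) y = (\<Sum>i<N. \<Sum>j<N. ?h i j)"
    by (simp add: fps_at_def sum_product mult_ac)
  also have "\<dots> \<approx> (\<Sum>k<N. \<Sum>i\<le>k. ?h i (k - i))"
    by (intro sum_square_equiv_triangle mult_mem assms)
  also have "\<dots> = (\<Sum>k<N. const (?c k) * (\<Sum>i\<le>k. of_nat (k choose i) * x ^ i * y ^ (k - i)))"
  proof (intro sum.cong refl)
    fix k
    have "const (?c i) * const (?c (k - i)) = const (?c k) * (of_nat (k choose i) :: 'm \<Rightarrow>\<^sub>0 complex)"
      if "i \<le> k" for i
    proof -
      have "?c i * ?c (k - i) = ?c k * of_nat (k choose i)"
        using that by (simp add: binomial_fact)
      then have "const (?c i) * const (?c (k - i)) = const (?c k) * (const (of_nat (k choose i)) :: 'm \<Rightarrow>\<^sub>0 complex)"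
        by (simp only: const_mult[symmetric])
      also have "const (of_nat (k choose i)) = (of_nat (k choose i) :: 'm \<Rightarrow>\<^sub>0 complex)"
        by (simp add: const_def)
      finally show ?thesis .
    qed
    then have "?h i (k - i) = const (?c k) * (of_nat (k choose i) * x ^ i * y ^ (k - i))" if "i \<le> k" for i
      using that by (simp only: mult.assoc[symmetric])
    then show "(\<Sum>i\<le>k. ?h i (k - i)) = const (?c k) * (\<Sum>i\<le>k. of_nat (k choose i) * x ^ i * y ^ (k - i))"
      by (simp add: sum_distrib_left)
  qed
  also have "\<dots> = fps_at N (fps_exp 1) (x + y)"
    by (simp add: fps_at_def binomial_ring)
  finally show ?thesis
    by (rule equiv_sym)
qed

end

section \<open>Complex algebras, quotients and localizations\<close>

text \<open>Expressing scalar multiplication through \<open>c \<odot> \<one>\<close> reduces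
  compatibility with scalars in quotients and localizations to statements about ring
  multiplication.\<close>

locale complex_algebra = cring A for A :: "(complex, 'a) module" (structure) +
  assumes smult_closed [simp]: "x \<in> carrier A \<Longrightarrow> c \<odot> x \<in> carrier A"
    and smult_eq_mult: "x \<in> carrier A \<Longrightarrow> c \<odot> x = (c \<odot> \<one>) \<otimes> x"

definition alg_hom :: "(complex, 'a) module \<Rightarrow> (complex, 'b) module \<Rightarrow> ('a \<Rightarrow> 'b) set" where
  "alg_hom A B =
    {h \<in> ring_hom A B. \<forall>c. \<forall>x\<in>carrier A. h (c \<odot>\<^bsub>A\<^esub> x) = c \<odot>\<^bsub>B\<^esub> h x}"

lemma alg_hom_ring_hom: "h \<in> alg_hom A B \<Longrightarrow> h \<in> ring_hom A B"
  by (simp add: alg_hom_def)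

lemma alg_hom_smult: "h \<in> alg_hom A B \<Longrightarrow> x \<in> carrier A \<Longrightarrow> h (c \<odot>\<^bsub>A\<^esub> x) = c \<odot>\<^bsub>B\<^esub> h x"
  by (simp add: alg_hom_def)

lemma alg_hom_compose:
  "g \<in> alg_hom A B \<Longrightarrow> h \<in> alg_hom B C \<Longrightarrow> h \<circ> g \<in> alg_hom A C"
  using ring_hom_trans[of g A B h C] by (auto simp: alg_hom_def dest: ring_hom_closed)

lemma alg_isoI:
  "h \<in> alg_hom A B \<Longrightarrow> bij_betw h (carrier A) (carrier B) \<Longrightarrow> h \<in> alg_iso A B"
  by (simp add: alg_iso_def alg_hom_def ring_iso_def)

text \<open>This carries a ring structure across changes in the extension fields of the record, as
  they occur in \<open>quot_alg\<close>.\<close>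

lemma cring_update:
  fixes R :: "('a, 'b) ring_scheme" and S :: "('a, 'c) ring_scheme"
  assumes "cring R" and "carrier S = carrier R" "monoid.mult S = monoid.mult R" "one S = one R"
    "zero S = zero R" "add S = add R"
  shows "cring S"
proof -
  interpret cring R by fact
  show ?thesis
  proof (intro cringI abelian_groupI comm_monoidI)
    fix x assume "x \<in> carrier S"
    then show "\<exists>y\<in>carrier S. y \<oplus>\<^bsub>S\<^esub> x = \<zero>\<^bsub>S\<^esub>"
      using assms l_neg a_inv_closed by metis
  qed (auto simp: assms a_ac m_ac l_distr r_distr)
qed

lemma quot_alg_simps [simp]:
  "carrier (quot_alg A I) = carrier (A Quot I)"
  "monoid.mult (quot_alg A I) = monoid.mult (A Quot I)"
  "one (quot_alg A I) = one (A Quot I)"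
  "zero (quot_alg A I) = zero (A Quot I)"
  "add (quot_alg A I) = add (A Quot I)"
  "module.smult (quot_alg A I) = (\<lambda>c C. \<Union>x\<in>C. I +>\<^bsub>A\<^esub> (c \<odot>\<^bsub>A\<^esub> x))"
  by (simp_all add: quot_alg_def ring.extend_def module.fields_def)

context complex_algebra
begin

lemma smult_diff:
  "x \<in> carrier A \<Longrightarrow> y \<in> carrier A \<Longrightarrow> c \<odot> (x \<ominus> y) = c \<odot> x \<ominus> c \<odot> y"
  unfolding minus_eq
  by (simp add: smult_eq_mult[of "x \<oplus> \<ominus> y"] smult_eq_mult[of x] smult_eq_mult[of y] r_distr r_minus)

text \<open>All cosets in the union defining the scalar action coincide: for \<open>y\<close> in the
  coset of \<open>x\<close>, the difference \<open>c \<odot> y \<ominus> c \<odot> x\<close> is a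
  multiple of \<open>y \<ominus> x \<in> I\<close>.\<close>

lemma quot_alg_smult:
  assumes "ideal I A" "x \<in> carrier A"
  shows "c \<odot>\<^bsub>quot_alg A I\<^esub> (I +> x) = I +> (c \<odot> x)"
proof -
  interpret ideal I A by fact
  have "I +> (c \<odot> y) = I +> (c \<odot> x)" if "y \<in> I +> x" for y
  proof -
    have y: "y \<in> carrier A"
      using that assms a_r_coset_subset_G[of I x] a_subset by auto
    have "I +> y = I +> x"
      using a_repr_independence'[OF that assms(2)] by simp
    then have "y \<ominus> x \<in> I"
      using quotient_eq_iff_same_a_r_cos[OF is_ideal y assms(2)] by simp
    then have "(c \<odot> \<one>) \<otimes> (y \<ominus> x) \<in> I"
      by (rule I_l_closed) simp
    then have "c \<odot> y \<ominus> c \<odot> x \<in> I"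
      using y assms by (simp add: smult_diff[symmetric] smult_eq_mult[of "y \<ominus> x"])
    then show ?thesis
      using y assms quotient_eq_iff_same_a_r_cos[OF is_ideal] by simp
  qed
  then have "(\<Union>y\<in>I +> x. I +> (c \<odot> y)) = (\<Union>y\<in>I +> x. I +> (c \<odot> x))"
    by (rule SUP_cong[OF refl])
  moreover have "I +> x \<noteq> {}"
    using a_rcos_self[OF assms(2)] by blast
  ultimately show ?thesis by simp
qed

lemma quot_alg_hom: "ideal I A \<Longrightarrow> (+>) I \<in> alg_hom A (quot_alg A I)"
  using ideal.rcos_ring_hom[of I A] quot_alg_smult
  by (auto simp: alg_hom_def ring_hom_def)

lemma quot_alg_carrier: "carrier (quot_alg A I) = (+>) I ` carrier A"
  by (auto simp: FactRing_def A_RCOSETS_def')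

lemma quot_alg_zero_iff:
  assumes "ideal I A" "x \<in> carrier A"
  shows "I +> x = \<zero>\<^bsub>quot_alg A I\<^esub> \<longleftrightarrow> x \<in> I"
proof -
  interpret ideal I A by fact
  have "I +> \<zero> = I"
    using a_subset by (rule a_coset_add_zero)
  then show ?thesis
    using quotient_eq_iff_same_a_r_cos[OF assms(1) assms(2), of \<zero>] assms(2)
    by (simp add: FactRing_def minus_eq)
qed

lemma quot_alg_complex_algebra:
  assumes "ideal I A"
  shows "complex_algebra (quot_alg A I)"
proof -
  interpret ideal I A by fact
  have "cring (A Quot I)"
    by (rule quotient_is_cring) (rule cring_axioms)
  then have cr: "cring (quot_alg A I)"
    by (rule cring_update) simp_all
  show ?thesis
  proof (intro complex_algebra.intro complex_algebra_axioms.intro cr)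
    fix C and c :: complex assume "C \<in> carrier (quot_alg A I)"
    then obtain x where x: "x \<in> carrier A" "C = I +> x"
      unfolding quot_alg_carrier by auto
    then have eq: "c \<odot>\<^bsub>quot_alg A I\<^esub> C = I +> (c \<odot> x)"
      using quot_alg_smult[OF assms] by blast
    then show "c \<odot>\<^bsub>quot_alg A I\<^esub> C \<in> carrier (quot_alg A I)"
      unfolding quot_alg_carrier using x by simp
    note h = quot_alg_hom[OF assms]
    have "I +> (c \<odot> x) = I +> ((c \<odot> \<one>) \<otimes> x)"
      using x by (simp add: smult_eq_mult[of x])
    also have "\<dots> = (I +> (c \<odot> \<one>)) \<otimes>\<^bsub>quot_alg A I\<^esub> C"
      unfolding x by (rule ring_hom_mult[OF alg_hom_ring_hom[OF h]]) (use x in auto)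
    also have "I +> (c \<odot> \<one>) = c \<odot>\<^bsub>quot_alg A I\<^esub> (I +> \<one>)"
      using quot_alg_smult[OF assms, of \<one>] by simp
    also have "I +> \<one> = \<one>\<^bsub>quot_alg A I\<^esub>"
      by (simp add: FactRing_def)
    finally show "c \<odot>\<^bsub>quot_alg A I\<^esub> C = (c \<odot>\<^bsub>quot_alg A I\<^esub> \<one>\<^bsub>quot_alg A I\<^esub>) \<otimes>\<^bsub>quot_alg A I\<^esub> C"
      using eq by simp
  qed
qed

end

text \<open>If \<open>h\<close> is onto, inverts \<open>M\<close>, and every element of its kernel is annihilated by an element of
  \<open>M\<close>, then the fraction \<open>y / n\<close> can be identified with \<open>h y / h n\<close>; a fraction is thus a fibre of
  this map.\<close>

locale localization_hom =
  A: complex_algebra A + B: complex_algebra B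
  for A :: "(complex, 'a) module" (structure) and B :: "(complex, 'b) module" +
  fixes h M
  assumes h: "h \<in> alg_hom A B" and onto: "h ` carrier A = carrier B"
    and M_sub: "M \<subseteq> carrier A" and M_one: "\<one> \<in> M"
    and M_mult: "m \<in> M \<Longrightarrow> n \<in> M \<Longrightarrow> m \<otimes> n \<in> M"
    and M_units: "m \<in> M \<Longrightarrow> h m \<in> Units B"
    and ker: "x \<in> carrier A \<Longrightarrow> h x = \<zero>\<^bsub>B\<^esub> \<Longrightarrow> \<exists>u\<in>M. u \<otimes> x = \<zero>"
begin

definition fibre :: "'b \<Rightarrow> ('a \<times> 'a) set" where
  "fibre b = {(y, n). y \<in> carrier A \<and> n \<in> M \<and> h y = h n \<otimes>\<^bsub>B\<^esub> b}"

lemmas h_ring = alg_hom_ring_hom[OF h]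
lemmas h_closed = ring_hom_closed[OF h_ring]
lemmas h_simps = ring_hom_mult[OF h_ring] ring_hom_add[OF h_ring] ring_hom_one[OF h_ring]
  ring_hom_zero[OF h_ring A.ring_axioms B.ring_axioms] alg_hom_smult[OF h]

lemma M_carrier: "m \<in> M \<Longrightarrow> m \<in> carrier A"
  using M_sub by auto

lemma unit_cancel:
  "m \<in> M \<Longrightarrow> b \<in> carrier B \<Longrightarrow> c \<in> carrier B \<Longrightarrow> h m \<otimes>\<^bsub>B\<^esub> b = h m \<otimes>\<^bsub>B\<^esub> c \<Longrightarrow> b = c"
  using M_units by (meson B.Units_l_cancel)

text \<open>Elements of \<open>M\<close> become units in \<open>B\<close> and can be cancelled
  there; conversely \<open>x \<ominus> y\<close> lies in the kernel and is annihilated by an element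
  of \<open>M\<close>. Equality of fractions thus becomes an equation in \<open>B\<close>.\<close>

lemma annihilator_iff:
  assumes "x \<in> carrier A" "y \<in> carrier A"
  shows "(\<exists>u\<in>M. u \<otimes> x = u \<otimes> y) \<longleftrightarrow> h x = h y"
proof
  assume "\<exists>u\<in>M. u \<otimes> x = u \<otimes> y"
  then obtain u where u: "u \<in> M" "u \<otimes> x = u \<otimes> y" by auto
  then have "h u \<otimes>\<^bsub>B\<^esub> h x = h u \<otimes>\<^bsub>B\<^esub> h y"
    using assms M_carrier by (metis h_simps(1))
  then show "h x = h y"
    using unit_cancel[OF u(1)] assms h_closed by auto
next
  assume eq: "h x = h y"
  interpret h: ring_hom_cring A B h by unfold_locales (rule h_ring)
  have "h (x \<ominus> y) = h x \<ominus>\<^bsub>B\<^esub> h y"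
    using assms by (simp add: A.minus_eq B.minus_eq h_simps h.hom_a_inv)
  then have "h (x \<ominus> y) = \<zero>\<^bsub>B\<^esub>"
    using assms eq h_closed by (simp add: B.r_right_minus_eq)
  then obtain u where u: "u \<in> M" "u \<otimes> (x \<ominus> y) = \<zero>"
    using ker assms by blast
  then have "u \<otimes> x \<ominus> u \<otimes> y = \<zero>"
    using M_carrier assms by (simp add: A.minus_eq A.r_distr A.r_minus)
  then show "\<exists>u\<in>M. u \<otimes> x = u \<otimes> y"
    using u M_carrier assms by (intro bexI[of _ u]) simp_all
qed

lemma frac_cls_eq_fibre:
  assumes "(x, m) \<in> fibre b" "b \<in> carrier B"
  shows "frac_cls A M x m = fibre b"
proof -
  have x: "x \<in> carrier A" and m: "m \<in> M" and hx: "h x = h m \<otimes>\<^bsub>B\<^esub> b"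
    using assms by (auto simp: fibre_def)
  have "(\<exists>u\<in>M. u \<otimes> (n \<otimes> x) = u \<otimes> (m \<otimes> y)) \<longleftrightarrow> h y = h n \<otimes>\<^bsub>B\<^esub> b"
    if y: "y \<in> carrier A" and n: "n \<in> M" for y n
  proof -
    note hc = h_closed[OF M_carrier[OF m]] h_closed[OF M_carrier[OF n]] h_closed[OF y] assms(2)
    have "(\<exists>u\<in>M. u \<otimes> (n \<otimes> x) = u \<otimes> (m \<otimes> y)) \<longleftrightarrow> h (n \<otimes> x) = h (m \<otimes> y)"
      by (rule annihilator_iff) (simp_all add: x y M_carrier[OF m] M_carrier[OF n])
    also have "\<dots> \<longleftrightarrow> h m \<otimes>\<^bsub>B\<^esub> (h n \<otimes>\<^bsub>B\<^esub> b) = h m \<otimes>\<^bsub>B\<^esub> h y"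
      using x y m n M_carrier hc by (simp add: h_simps hx B.m_lcomm)
    also have "\<dots> \<longleftrightarrow> h n \<otimes>\<^bsub>B\<^esub> b = h y"
      using unit_cancel[OF m] hc by auto
    finally show ?thesis by auto
  qed
  then show ?thesis
    by (auto simp: frac_cls_def fibre_def)
qed

lemma fibre_nonempty:
  assumes "b \<in> carrier B"
  obtains x where "x \<in> carrier A" "h x = b" "(x, \<one>) \<in> fibre b"
proof -
  obtain x where "x \<in> carrier A" "h x = b" using assms unfolding onto[symmetric] by auto
  then show ?thesis using that assms M_one by (auto simp: fibre_def h_simps)
qed

lemma fraction_in_fibre:
  assumes "x \<in> carrier A" "m \<in> M"
  shows "\<exists>b\<in>carrier B. (x, m) \<in> fibre b"
proof
  let ?b = "inv\<^bsub>B\<^esub> (h m) \<otimes>\<^bsub>B\<^esub> h x"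
  show "?b \<in> carrier B"
    using assms M_units h_closed by auto
  have "h m \<otimes>\<^bsub>B\<^esub> ?b = (h m \<otimes>\<^bsub>B\<^esub> inv\<^bsub>B\<^esub> (h m)) \<otimes>\<^bsub>B\<^esub> h x"
    using assms M_units[of m] h_closed M_carrier by (simp add: B.m_assoc[symmetric])
  then show "(x, m) \<in> fibre ?b"
    using assms M_units[of m] h_closed by (simp add: fibre_def)
qed

lemma frac_cls_image: "x \<in> carrier A \<Longrightarrow> frac_cls A M x \<one> = fibre (h x)"
  by (rule frac_cls_eq_fibre) (auto simp: fibre_def M_one h_simps h_closed)

lemma fibre_inj: "inj_on fibre (carrier B)"
proof
  fix b c assume bc: "b \<in> carrier B" "c \<in> carrier B" "fibre b = fibre c"
  obtain x where "x \<in> carrier A" "h x = b" "(x, \<one>) \<in> fibre b"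
    by (rule fibre_nonempty[OF bc(1)])
  moreover from this have "(x, \<one>) \<in> fibre c"
    using bc by simp
  ultimately show "b = c"
    using bc by (simp add: fibre_def h_simps)
qed

lemma carrier_localization: "carrier (localization A M) = fibre ` carrier B"
proof
  show "carrier (localization A M) \<subseteq> fibre ` carrier B"
  proof
    fix P assume "P \<in> carrier (localization A M)"
    then obtain x m where P: "P = frac_cls A M x m" "x \<in> carrier A" "m \<in> M"
      by (auto simp: localization_def)
    then obtain b where "b \<in> carrier B" "(x, m) \<in> fibre b"
      using fraction_in_fibre by blast
    then show "P \<in> fibre ` carrier B"
      using P frac_cls_eq_fibre by blast
  qed
  show "fibre ` carrier B \<subseteq> carrier (localization A M)"
  proof
    fix P assume "P \<in> fibre ` carrier B"
    then obtain b where b: "b \<in> carrier B" "P = fibre b" by blast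
    obtain x where "x \<in> carrier A" "(x, \<one>) \<in> fibre b"
      by (rule fibre_nonempty[OF b(1)])
    then have "P = frac_cls A M x \<one>" "x \<in> carrier A"
      using frac_cls_eq_fibre b by simp_all
    then show "P \<in> carrier (localization A M)"
      using M_one by (auto simp: localization_def)
  qed
qed

text \<open>The operations of \<open>localization\<close> are unions over all representatives. They
  collapse when every representative yields the same class, because a fibre is never empty.\<close>

lemma Union_fibre:
  assumes "b \<in> carrier B" and "\<And>x m. (x, m) \<in> fibre b \<Longrightarrow> f x m = S"
  shows "(\<Union>(x, m)\<in>fibre b. f x m) = S"
proof -
  obtain x where "(x, \<one>) \<in> fibre b" by (rule fibre_nonempty[OF assms(1)])
  then show ?thesis using assms(2) by fast
qed

lemma fibre_hom: "fibre \<in> alg_hom B (localization A M)"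
  unfolding alg_hom_def
proof (intro CollectI conjI allI ballI ring_hom_memI)
  fix b assume b: "b \<in> carrier B"
  then show "fibre b \<in> carrier (localization A M)"
    using carrier_localization by blast
  fix c :: complex
  have "c \<odot>\<^bsub>localization A M\<^esub> fibre b = (\<Union>(x, m)\<in>fibre b. frac_cls A M (c \<odot> x) m)"
    by (simp add: localization_def)
  also have "\<dots> = fibre (c \<odot>\<^bsub>B\<^esub> b)"
  proof (rule Union_fibre[OF b], rule frac_cls_eq_fibre)
    fix x m assume "(x, m) \<in> fibre b"
    then have x: "x \<in> carrier A" and m: "m \<in> M" and hx: "h x = h m \<otimes>\<^bsub>B\<^esub> b"
      by (auto simp: fibre_def)
    have "h (c \<odot> x) = (c \<odot>\<^bsub>B\<^esub> \<one>\<^bsub>B\<^esub>) \<otimes>\<^bsub>B\<^esub> (h m \<otimes>\<^bsub>B\<^esub> b)"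
      using x b m h_closed by (simp add: h_simps hx B.smult_eq_mult[of "h x"] flip: hx)
    also have "\<dots> = h m \<otimes>\<^bsub>B\<^esub> (c \<odot>\<^bsub>B\<^esub> b)"
      using b m h_closed M_carrier by (simp add: B.smult_eq_mult[of b] B.m_lcomm)
    finally show "(c \<odot> x, m) \<in> fibre (c \<odot>\<^bsub>B\<^esub> b)"
      using x m by (simp add: fibre_def)
  qed (use b in simp)
  finally show "fibre (c \<odot>\<^bsub>B\<^esub> b) = c \<odot>\<^bsub>localization A M\<^esub> fibre b" ..
next
  fix b b' assume b: "b \<in> carrier B" and b': "b' \<in> carrier B"
  note hc = M_carrier h_closed b b'
  have mem: "(x \<otimes> y, m \<otimes> n) \<in> fibre (b \<otimes>\<^bsub>B\<^esub> b')"
    "(n \<otimes> x \<oplus> m \<otimes> y, m \<otimes> n) \<in> fibre (b \<oplus>\<^bsub>B\<^esub> b')"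
    if "(x, m) \<in> fibre b" "(y, n) \<in> fibre b'" for x m y n
  proof -
    have x: "x \<in> carrier A" "m \<in> M" "h x = h m \<otimes>\<^bsub>B\<^esub> b"
      and y: "y \<in> carrier A" "n \<in> M" "h y = h n \<otimes>\<^bsub>B\<^esub> b'"
      using that by (auto simp: fibre_def)
    show "(x \<otimes> y, m \<otimes> n) \<in> fibre (b \<otimes>\<^bsub>B\<^esub> b')"
      "(n \<otimes> x \<oplus> m \<otimes> y, m \<otimes> n) \<in> fibre (b \<oplus>\<^bsub>B\<^esub> b')"
      using x y hc M_mult by (simp_all add: fibre_def h_simps B.m_ac B.r_distr)
  qed
  have "fibre b \<otimes>\<^bsub>localization A M\<^esub> fibre b' =
      (\<Union>(x, m)\<in>fibre b. \<Union>(y, n)\<in>fibre b'. frac_cls A M (x \<otimes> y) (m \<otimes> n))"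
    by (simp add: localization_def)
  also have "\<dots> = fibre (b \<otimes>\<^bsub>B\<^esub> b')"
    by (intro Union_fibre b b' frac_cls_eq_fibre mem B.m_closed)
  finally show "fibre (b \<otimes>\<^bsub>B\<^esub> b') = fibre b \<otimes>\<^bsub>localization A M\<^esub> fibre b'" ..
  have "fibre b \<oplus>\<^bsub>localization A M\<^esub> fibre b' =
      (\<Union>(x, m)\<in>fibre b. \<Union>(y, n)\<in>fibre b'. frac_cls A M (n \<otimes> x \<oplus> m \<otimes> y) (m \<otimes> n))"
    by (simp add: localization_def)
  also have "\<dots> = fibre (b \<oplus>\<^bsub>B\<^esub> b')"
    by (intro Union_fibre b b' frac_cls_eq_fibre mem B.a_closed)
  finally show "fibre (b \<oplus>\<^bsub>B\<^esub> b') = fibre b \<oplus>\<^bsub>localization A M\<^esub> fibre b'" ..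
next
  show "fibre \<one>\<^bsub>B\<^esub> = \<one>\<^bsub>localization A M\<^esub>"
    using frac_cls_image[of \<one>] by (simp add: localization_def h_simps)
qed

lemma fibre_iso: "fibre \<in> alg_iso B (localization A M)"
  using fibre_hom fibre_inj carrier_localization by (intro alg_isoI) (auto simp: bij_betw_def)

lemma fibre_zero: "fibre \<zero>\<^bsub>B\<^esub> = \<zero>\<^bsub>localization A M\<^esub>"
  using frac_cls_image[of \<zero>] by (simp add: localization_def h_simps)

end

section \<open>Nilpotent elements and logarithms\<close>

text \<open>\<open>ring_iso\<close> says nothing about the zero field of its target, and
  \<open>C\<close> is not yet known to be a ring; once the zeros correspond, the ring structure
  transfers. The powers of \<open>b\<close> and \<open>h b\<close> then vanish simultaneously, so
  both logarithms are cut off at the same place.\<close>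

lemma
  assumes h: "h \<in> alg_iso B C" and B: "complex_algebra B" and zero: "h \<zero>\<^bsub>B\<^esub> = \<zero>\<^bsub>C\<^esub>"
    and b: "b \<in> carrier B"
  shows alg_iso_nilpotent: "nilpotent_elem B b \<Longrightarrow> nilpotent_elem C (h b)"
    and alg_iso_log1p: "log1p_alg C (h b) = h (log1p_alg B b)"
proof -
  interpret B: complex_algebra B by fact
  have h': "h \<in> ring_hom B C" "inj_on h (carrier B)" "h \<in> ring_iso B C"
    and smult: "\<And>c x. x \<in> carrier B \<Longrightarrow> h (c \<odot>\<^bsub>B\<^esub> x) = c \<odot>\<^bsub>C\<^esub> h x"
    using h by (auto simp: alg_iso_def ring_iso_def bij_betw_def)
  have "cring C"
    using B.ring_iso_imp_img_cring[OF h'(3)] by (rule cring_update) (simp_all add: zero)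
  then interpret C: cring C .
  interpret ring_hom_cring B C h
    by unfold_locales (rule h')
  have pow: "h b [^]\<^bsub>C\<^esub> n = h (b [^]\<^bsub>B\<^esub> n)" for n :: nat
    using b by simp
  have pow0: "h b [^]\<^bsub>C\<^esub> n = \<zero>\<^bsub>C\<^esub> \<longleftrightarrow> b [^]\<^bsub>B\<^esub> n = \<zero>\<^bsub>B\<^esub>" for n :: nat
    unfolding pow zero[symmetric] by (rule inj_on_eq_iff[OF h'(2)]) (use b in simp_all)
  show "nilpotent_elem B b \<Longrightarrow> nilpotent_elem C (h b)"
    by (simp add: nilpotent_elem_def pow0)
  show "log1p_alg C (h b) = h (log1p_alg B b)"
  proof -
    have t: "c \<odot>\<^bsub>C\<^esub> (h b [^]\<^bsub>C\<^esub> k) = h (c \<odot>\<^bsub>B\<^esub> (b [^]\<^bsub>B\<^esub> k))" for c and k :: nat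
      by (simp only: pow smult B.nat_pow_closed[OF b])
    show ?thesis
      unfolding log1p_alg_def pow0 t using b by (subst hom_finsum) (auto simp: o_def)
  qed
qed

section \<open>The algebras of a monoid\<close>

lemma monoid_alg_simps [simp]:
  "carrier (monoid_alg M) = {f. keys f \<subseteq> M}"
  "monoid.mult (monoid_alg M) = (*)"
  "one (monoid_alg M) = 1"
  "zero (monoid_alg M) = 0"
  "add (monoid_alg M) = (+)"
  "c \<odot>\<^bsub>monoid_alg M\<^esub> f = const c * f"
  by (simp_all add: monoid_alg_def const_def)

locale add_submonoid =
  fixes M :: "'m::comm_monoid_add set"
  assumes zero_closed: "0 \<in> M" and add_closed: "a \<in> M \<Longrightarrow> b \<in> M \<Longrightarrow> a + b \<in> M"
begin

lemma keys_mult_closed: "keys f \<subseteq> M \<Longrightarrow> keys g \<subseteq> M \<Longrightarrow> keys (f * g) \<subseteq> M"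
  for f g :: "'m \<Rightarrow>\<^sub>0 'b::comm_semiring_1"
  using keys_mult[of f g] add_closed by fastforce

lemma keys_const_closed: "keys (const c :: 'm \<Rightarrow>\<^sub>0 'b::zero) \<subseteq> M"
  using zero_closed by (auto simp: const_def split: if_splits)

lemma keys_1_closed: "keys (1 :: 'm \<Rightarrow>\<^sub>0 'b::zero_neq_one) \<subseteq> M"
  using zero_closed by auto

lemma keys_add_closed: "keys f \<subseteq> M \<Longrightarrow> keys g \<subseteq> M \<Longrightarrow> keys (f + g) \<subseteq> M"
  for f g :: "'m \<Rightarrow>\<^sub>0 'b::comm_monoid_add"
  using keys_add[of f g] by blast

lemma keys_uminus_closed: "keys f \<subseteq> M \<Longrightarrow> keys (- f) \<subseteq> M"
  for f :: "'m \<Rightarrow>\<^sub>0 'b::ab_group_add"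
  by (auto simp: in_keys_iff)

lemma keys_diff_closed: "keys f \<subseteq> M \<Longrightarrow> keys g \<subseteq> M \<Longrightarrow> keys (f - g) \<subseteq> M"
  for f g :: "'m \<Rightarrow>\<^sub>0 'b::ab_group_add"
  using keys_add_closed[of f "- g"] keys_uminus_closed[of g] by simp

lemma keys_sum_closed: "(\<And>i. i \<in> A \<Longrightarrow> keys (f i) \<subseteq> M) \<Longrightarrow> keys (sum f A) \<subseteq> M"
  for f :: "'i \<Rightarrow> 'm \<Rightarrow>\<^sub>0 'b::comm_monoid_add"
  by (induction A rule: infinite_finite_induct) (simp_all add: keys_add_closed)

lemma keys_prod_closed: "(\<And>i. i \<in> A \<Longrightarrow> keys (f i) \<subseteq> M) \<Longrightarrow> keys (prod f A) \<subseteq> M"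
  for f :: "'i \<Rightarrow> 'm \<Rightarrow>\<^sub>0 'b::comm_semiring_1"
  by (induction A rule: infinite_finite_induct) (simp_all add: keys_mult_closed zero_closed)

lemma keys_power_closed: "keys f \<subseteq> M \<Longrightarrow> keys (f ^ n) \<subseteq> M"
  for f :: "'m \<Rightarrow>\<^sub>0 'b::comm_semiring_1"
  by (induction n) (simp_all add: keys_mult_closed zero_closed)

lemmas keys_closed = keys_mult_closed keys_const_closed keys_1_closed keys_add_closed
  keys_uminus_closed keys_diff_closed keys_sum_closed keys_prod_closed keys_power_closed

lemma monoid_alg_complex_algebra: "complex_algebra (monoid_alg M)"
proof (intro complex_algebra.intro complex_algebra_axioms.intro cringI abelian_groupI comm_monoidI)
  fix x :: "'m \<Rightarrow>\<^sub>0 complex" assume "x \<in> carrier (monoid_alg M)"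
  then show "\<exists>y\<in>carrier (monoid_alg M). y \<oplus>\<^bsub>monoid_alg M\<^esub> x = \<zero>\<^bsub>monoid_alg M\<^esub>"
    by (intro bexI[of _ "- x"]) (auto intro!: keys_uminus_closed)
qed (simp_all add: keys_closed zero_closed algebra_simps)

sublocale alg: complex_algebra "monoid_alg M"
  by (rule monoid_alg_complex_algebra)

lemma a_inv_monoid_alg: "keys f \<subseteq> M \<Longrightarrow> \<ominus>\<^bsub>monoid_alg M\<^esub> f = - f"
  using alg.minus_equality[of "- f" f] by (simp add: keys_closed)

lemma pow_monoid_alg: "f [^]\<^bsub>monoid_alg M\<^esub> (n::nat) = f ^ n"
  by (induction n) (simp_all add: nat_pow_def mult.commute)

text \<open>Closure under negation comes for free, since \<open>-1\<close> is an element of the algebra.\<close>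

lemma ideal_monoid_alg_iff:
  "ideal J (monoid_alg M) \<longleftrightarrow>
     (\<forall>f\<in>J. keys f \<subseteq> M) \<and> 0 \<in> J \<and> (\<forall>f\<in>J. \<forall>g\<in>J. f + g \<in> J) \<and>
     (\<forall>f. keys f \<subseteq> M \<longrightarrow> (\<forall>g\<in>J. f * g \<in> J))" (is "?L \<longleftrightarrow> ?R")
proof
  assume ?L
  then interpret ideal J "monoid_alg M" .
  show ?R
    using a_subset additive_subgroup.zero_closed[OF is_additive_subgroup]
      additive_subgroup.a_closed[OF is_additive_subgroup] I_l_closed
    by auto
next
  assume R: ?R
  have neg: "- f \<in> J" if "f \<in> J" for f
  proof -
    have "keys (- 1 :: 'm \<Rightarrow>\<^sub>0 complex) \<subseteq> M" by (intro keys_closed)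
    then show ?thesis using R that by (metis mult_minus1)
  qed
  have mult_right: "g * f \<in> J" if "g \<in> J" "keys f \<subseteq> M" for f g
    using R that by (simp add: mult.commute[of g f])
  show ?L
  proof (rule idealI)
    show "subgroup J (add_monoid (monoid_alg M))"
    proof (rule subgroup.intro)
      fix f assume "f \<in> J"
      then show "inv\<^bsub>add_monoid (monoid_alg M)\<^esub> f \<in> J"
        using R neg a_inv_monoid_alg[of f] by (simp add: a_inv_def)
    qed (use R in auto)
  qed (use R mult_right in \<open>auto simp: alg.ring_axioms\<close>)
qed

end

text \<open>\<open>log1p_alg\<close> stops at the least vanishing power, whereas
  \<open>fps_at\<close> stops at any \<open>N\<close> with \<open>f ^ N\<close> mapped to zero; the
  terms in between map to zero as well.\<close>

lemma monoid_alg_log1p: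
  assumes M: "add_submonoid M" and q: "q \<in> alg_hom (monoid_alg M) B" and B: "complex_algebra B"
    and f: "keys f \<subseteq> M" and nil: "q (f ^ N) = \<zero>\<^bsub>B\<^esub>"
  shows "nilpotent_elem B (q f)" "log1p_alg B (q f) = q (fps_at N (fps_ln 1) f)"
proof -
  interpret add_submonoid M by fact
  interpret B: complex_algebra B by fact
  interpret ring_hom_cring "monoid_alg M" B q
    by unfold_locales (rule alg_hom_ring_hom[OF q])
  have pow: "q f [^]\<^bsub>B\<^esub> n = q (f ^ n)" for n :: nat
    using f by (simp flip: pow_monoid_alg)
  then show "nilpotent_elem B (q f)"
    using nil by (auto simp: nilpotent_elem_def)
  define N' where "N' = (LEAST N::nat. q f [^]\<^bsub>B\<^esub> N = \<zero>\<^bsub>B\<^esub>)"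
  have N': "q (f ^ N') = \<zero>\<^bsub>B\<^esub>" "N' \<le> N"
    using LeastI[of "\<lambda>N. q f [^]\<^bsub>B\<^esub> (N::nat) = \<zero>\<^bsub>B\<^esub>" N] Least_le[of "\<lambda>N. q f [^]\<^bsub>B\<^esub> (N::nat) = \<zero>\<^bsub>B\<^esub>" N]
      nil unfolding N'_def pow by auto
  let ?c = "\<lambda>k. (- 1) ^ (k + 1) / of_nat k :: complex"
  let ?t = "\<lambda>k. const (?c k) * f ^ k"
  have tM: "keys (const c * f ^ k) \<subseteq> M" for c :: complex and k
    by (intro keys_closed f)
  have zero: "q (const c * f ^ k) = \<zero>\<^bsub>B\<^esub>" if "k \<ge> N'" for k and c :: complex
  proof -
    have "const c * f ^ k = (const c * f ^ (k - N')) * f ^ N'"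
      using that by (simp add: mult.assoc flip: power_add)
    then show ?thesis
      using hom_mult[of "const c * f ^ (k - N')" "f ^ N'"] N'(1) hom_closed[of "const c * f ^ (k - N')"]
      by (simp add: tM keys_closed f)
  qed
  have finsum: "q (\<Sum>k\<in>S. u k) = (\<Oplus>\<^bsub>B\<^esub>k\<in>S. q (u k))" if "finite S" "\<And>k. k \<in> S \<Longrightarrow> keys (u k) \<subseteq> M"
    for S :: "nat set" and u
    using that
  proof (induction S rule: finite_induct)
    case empty
    then show ?case using hom_zero by simp
  next
    case (insert k S)
    have "q (\<Sum>k\<in>insert k S. u k) = q (u k) \<oplus>\<^bsub>B\<^esub> q (\<Sum>k\<in>S. u k)"
      using insert hom_add[of "u k" "\<Sum>k\<in>S. u k"] keys_sum_closed[of S u] by simp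
    also have "\<dots> = q (u k) \<oplus>\<^bsub>B\<^esub> (\<Oplus>\<^bsub>B\<^esub>k\<in>S. q (u k))"
      using insert by simp
    also have "\<dots> = (\<Oplus>\<^bsub>B\<^esub>k\<in>insert k S. q (u k))"
      using insert hom_closed by (subst B.finsum_insert) auto
    finally show ?case .
  qed
  have "log1p_alg B (q f) = (\<Oplus>\<^bsub>B\<^esub>k\<in>{1..<N'}. q (?t k))"
    unfolding log1p_alg_def N'_def[symmetric]
    using hom_closed[of "?t _"] hom_closed[of "f ^ _"] alg_hom_smult[OF q, of "f ^ _"]
    by (intro B.finsum_cong') (auto simp: pow keys_closed f tM)
  also have "\<dots> = q (\<Sum>k\<in>{1..<N'}. ?t k)"
    by (rule finsum[symmetric]) (use tM in auto)
  also have "\<dots> = q (\<Sum>k\<in>{1..<N'}. ?t k) \<oplus>\<^bsub>B\<^esub> q (\<Sum>k\<in>{1..<N} - {1..<N'}. ?t k)"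
  proof -
    have "q (\<Sum>k\<in>{1..<N} - {1..<N'}. ?t k) = (\<Oplus>\<^bsub>B\<^esub>k\<in>{1..<N} - {1..<N'}. q (?t k))"
      by (rule finsum) (use tM in auto)
    also have "\<dots> = (\<Oplus>\<^bsub>B\<^esub>k\<in>{1..<N} - {1..<N'}. \<zero>\<^bsub>B\<^esub>)"
      by (rule B.finsum_cong') (auto simp: zero)
    finally have "q (\<Sum>k\<in>{1..<N} - {1..<N'}. ?t k) = \<zero>\<^bsub>B\<^esub>"
      by simp
    then show ?thesis
      using hom_closed[of "\<Sum>k\<in>{1..<N'}. ?t k"] keys_sum_closed[of "{1..<N'}" ?t] tM by simp
  qed
  also have "\<dots> = q ((\<Sum>k\<in>{1..<N'}. ?t k) + (\<Sum>k\<in>{1..<N} - {1..<N'}. ?t k))"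
    using hom_add keys_sum_closed[of "{1..<N'}" ?t] keys_sum_closed[of "{1..<N} - {1..<N'}" ?t] tM by simp
  also have "(\<Sum>k\<in>{1..<N'}. ?t k) + (\<Sum>k\<in>{1..<N} - {1..<N'}. ?t k) = (\<Sum>k\<in>{1..<N}. ?t k)"
    using N'(2) by (subst add.commute, subst sum.subset_diff[symmetric]) auto
  also have "\<dots> = fps_at N (fps_ln 1) f"
  proof -
    have "(\<Sum>k\<in>{1..<N}. ?t k) = (\<Sum>k\<in>{1..<N}. const (fps_ln 1 $ k) * f ^ k)"
    proof (intro sum.cong refl)
      fix k :: nat assume "k \<in> {1..<N}"
      then have "(- 1 :: complex) ^ (k + 1) = (- 1) ^ (k - 1)"
        by (cases k) auto
      then show "?t k = const (fps_ln 1 $ k) * f ^ k"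
        using \<open>k \<in> {1..<N}\<close> by (simp add: fps_ln_nth)
    qed
    \<comment> \<open>The constant coefficient of \<open>fps_ln 1\<close> is zero, so starting at
      \<open>k = 1\<close> loses nothing.\<close>
    also have "\<dots> = fps_at N (fps_ln 1) f"
      unfolding fps_at_def by (rule sum.mono_neutral_left) (auto simp: Suc_le_eq)
    finally show ?thesis .
  qed
  finally show "log1p_alg B (q f) = q (fps_at N (fps_ln 1) f)" .
qed

section \<open>Dimension\<close>

definition comb :: "('i \<Rightarrow> complex) \<Rightarrow> ('i \<Rightarrow> 'm::comm_monoid_add \<Rightarrow>\<^sub>0 complex) \<Rightarrow> 'i set \<Rightarrow> ('m \<Rightarrow>\<^sub>0 complex)" where
  "comb c u F = (\<Sum>i\<in>F. const (c i) * u i)"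

text \<open>The library builds \<open>dimension\<close> by successive line extensions, so the
  elements of \<open>F\<close> are adjoined one at a time; independence keeps each new one out of
  the span of its predecessors.\<close>

lemma has_complex_dim_basis:
  assumes M: "add_submonoid M" and q: "q \<in> alg_hom (monoid_alg M) B" and B: "complex_algebra B"
    and onto: "q ` carrier (monoid_alg M) = carrier B"
    and F: "finite F" "\<And>i. i \<in> F \<Longrightarrow> keys (u i) \<subseteq> M"
    and indep: "\<And>c i. q (comb c u F) = \<zero>\<^bsub>B\<^esub> \<Longrightarrow> i \<in> F \<Longrightarrow> c i = 0"
    and span: "\<And>f. keys f \<subseteq> M \<Longrightarrow> \<exists>c. q f = q (comb c u F)"
  shows "has_complex_dim B (card F)"
proof -
  interpret add_submonoid M by fact
  interpret B: complex_algebra B by fact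
  interpret ring_hom_cring "monoid_alg M" B q
    by unfold_locales (rule alg_hom_ring_hom[OF q])
  define k where "k = range (\<lambda>c. c \<odot>\<^bsub>B\<^esub> \<one>\<^bsub>B\<^esub>)"
  have qconst: "c \<odot>\<^bsub>B\<^esub> \<one>\<^bsub>B\<^esub> = q (const c)" for c
    using alg_hom_smult[OF q, of 1 c] ring_hom_one[OF alg_hom_ring_hom[OF q], simplified]
    by (simp add: zero_closed del: hom_one)
  have combM: "keys (comb c u S) \<subseteq> M" if "S \<subseteq> F" for c S
    unfolding comb_def using that F by (intro keys_closed) auto
  have dim: "B.dimension (card S) k {q (comb c u S) | c. True}" if "S \<subseteq> F" for S
    using finite_subset[OF that F(1)] that
  proof (induction S rule: finite_induct)
    case empty
    have "{q (comb c u {}) | c. True} = {\<zero>\<^bsub>B\<^esub>}"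
      using hom_zero by (simp add: comb_def)
    then show ?case by simp
  next
    case (insert i S)
    have iF: "i \<in> F" and SF: "S \<subseteq> F" using insert by auto
    have "q (u i) \<notin> {q (comb c u S) | c. True}"
    proof
      assume "q (u i) \<in> {q (comb c u S) | c. True}"
      then obtain c where c: "q (u i) = q (comb c u S)" by auto
      \<comment> \<open>A dependence of \<open>u i\<close> on \<open>S\<close>, rewritten as a
        relation on all of \<open>F\<close>; indices outside \<open>insert i S\<close> get
        coefficient zero.\<close>
      let ?c = "\<lambda>j. if j = i then 1 else if j \<in> S then - c j else 0"
      have "comb ?c u F = comb ?c u (insert i S)"
        unfolding comb_def using insert F by (intro sum.mono_neutral_right) auto
      also have "\<dots> = u i + (\<Sum>j\<in>S. const (- c j) * u j)"
        unfolding comb_def using insert by (subst sum.insert) (auto intro!: sum.cong)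
      also have "\<dots> = u i - comb c u S"
        by (simp add: comb_def const_uminus sum_negf)
      finally have "q (comb ?c u F) = q (u i) \<oplus>\<^bsub>B\<^esub> q (- comb c u S)"
        using hom_add[of "u i" "- comb c u S"] F(2)[OF iF] combM[OF SF] by (simp add: keys_closed)
      also have "q (- comb c u S) = \<ominus>\<^bsub>B\<^esub> q (comb c u S)"
        using hom_a_inv[of "comb c u S"] combM[OF SF] by (simp add: a_inv_monoid_alg)
      finally have "q (comb ?c u F) = \<zero>\<^bsub>B\<^esub>"
        using c hom_closed[of "comb c u S"] combM[OF SF] by (simp add: B.r_neg)
      from indep[OF this iF] show False by simp
    qed
    then have "B.dimension (Suc (card S)) k (B.line_extension k (q (u i)) {q (comb c u S) | c. True})"
      using insert.IH[OF SF] hom_closed[of "u i"] F(2)[OF iF] by (intro B.Suc_dim) auto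
    also have "B.line_extension k (q (u i)) {q (comb c u S) | c. True} = {q (comb c u (insert i S)) | c. True}"
    proof -
      have eq: "q (const a) \<otimes>\<^bsub>B\<^esub> q (u i) \<oplus>\<^bsub>B\<^esub> q (comb c u S) = q (comb (c(i := a)) u (insert i S))" for a c
      proof -
        have "comb (c(i := a)) u (insert i S) = const a * u i + comb c u S"
          unfolding comb_def using insert by (subst sum.insert) (auto intro!: sum.cong)
        moreover have "keys (const a * u i) \<subseteq> M"
          by (intro keys_closed F(2) iF)
        ultimately show ?thesis
          using hom_add[of "const a * u i" "comb c u S"] hom_mult[of "const a" "u i"] combM[OF SF]
            F(2)[OF iF] keys_const_closed[of a] by simp
      qed
      have "B.line_extension k (q (u i)) {q (comb c u S) | c. True} =
          {q (const a) \<otimes>\<^bsub>B\<^esub> q (u i) \<oplus>\<^bsub>B\<^esub> q (comb c u S) | a c. True}"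
        by (auto simp: B.line_extension_def set_add_def set_mult_def r_coset_def k_def qconst)
      also have "\<dots> = {q (comb c u (insert i S)) | c. True}"
        unfolding eq by (auto intro: exI[of _ "_ i"]) (metis fun_upd_triv)
      finally show ?thesis .
    qed
    finally show ?case using insert by simp
  qed
  have "{q (comb c u F) | c. True} = carrier B"
  proof (intro equalityI subsetI)
    fix b assume "b \<in> carrier B"
    then obtain f where "keys f \<subseteq> M" "b = q f"
      unfolding onto[symmetric] by auto
    then show "b \<in> {q (comb c u F) | c. True}"
      using span[of f] by auto
  qed (use combM[of F] hom_closed in auto)
  then show ?thesis
    using dim[of F] by (simp add: has_complex_dim_def k_def)
qed

section \<open>Linear algebra modulo a subspace\<close>

text \<open>The preimage of a linear span in the quotient by \<open>K\<close>, so that spanning and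
  independence can be handled on representatives.\<close>

definition span_mod ::
  "('m::comm_monoid_add \<Rightarrow>\<^sub>0 complex) set \<Rightarrow> ('i \<Rightarrow> 'm \<Rightarrow>\<^sub>0 complex) \<Rightarrow> 'i set \<Rightarrow> ('m \<Rightarrow>\<^sub>0 complex) set" where
  "span_mod K u F = {f. \<exists>c. f - comb c u F \<in> K}"

locale pm_subspace =
  fixes K :: "('m::comm_monoid_add \<Rightarrow>\<^sub>0 complex) set"
  assumes zero_in: "0 \<in> K" and add_in: "x \<in> K \<Longrightarrow> y \<in> K \<Longrightarrow> x + y \<in> K"
    and scale_in: "x \<in> K \<Longrightarrow> const c * x \<in> K"
begin

lemma diff_in: "x \<in> K \<Longrightarrow> y \<in> K \<Longrightarrow> x - y \<in> K"
  using add_in[of x "const (- 1) * y"] scale_in[of y "- 1"] by (simp add: const_uminus)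

lemma span_mod_K: "f \<in> K \<Longrightarrow> f \<in> span_mod K u F"
  unfolding span_mod_def by (auto intro!: exI[of _ "\<lambda>_. 0"] simp: comb_def)

lemma span_mod_add:
  assumes "f \<in> span_mod K u F" "g \<in> span_mod K u F"
  shows "f + g \<in> span_mod K u F"
proof -
  obtain c d where cd: "f - comb c u F \<in> K" "g - comb d u F \<in> K"
    using assms by (auto simp: span_mod_def)
  have "f + g - comb (\<lambda>i. c i + d i) u F \<in> K"
    using add_in[OF cd] by (simp add: comb_def const_add distrib_right sum.distrib algebra_simps)
  then show ?thesis by (auto simp: span_mod_def)
qed

lemma span_mod_const:
  assumes "f \<in> span_mod K u F"
  shows "const a * f \<in> span_mod K u F"
proof -
  obtain c where c: "f - comb c u F \<in> K" using assms by (auto simp: span_mod_def)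
  have "const a * f - comb (\<lambda>i. a * c i) u F \<in> K"
    using scale_in[OF c, of a]
    by (simp add: comb_def const_mult right_diff_distrib sum_distrib_left mult.assoc)
  then show ?thesis by (auto simp: span_mod_def)
qed

lemma span_mod_sum: "(\<And>i. i \<in> A \<Longrightarrow> f i \<in> span_mod K u F) \<Longrightarrow> sum f A \<in> span_mod K u F"
  by (induction A rule: infinite_finite_induct) (auto simp: span_mod_add span_mod_K zero_in)

lemma span_mod_base:
  assumes "finite F" "i \<in> F"
  shows "u i \<in> span_mod K u F"
proof -
  have "comb (\<lambda>j. if j = i then 1 else 0) u F = (\<Sum>j\<in>F. if j = i then u j else 0)"
    unfolding comb_def by (intro sum.cong) auto
  also have "\<dots> = u i" using assms by simp
  finally show ?thesis
    unfolding span_mod_def using zero_in by (auto intro!: exI[of _ "\<lambda>j. if j = i then 1 else 0"])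
qed

lemma span_mod_mono:
  assumes "F \<subseteq> F'" "finite F'"
  shows "span_mod K u F \<subseteq> span_mod K u F'"
proof
  fix f assume "f \<in> span_mod K u F"
  then obtain c where c: "f - comb c u F \<in> K" by (auto simp: span_mod_def)
  have "comb c u F \<in> span_mod K u F'"
    unfolding comb_def using assms by (intro span_mod_sum span_mod_const span_mod_base) auto
  from span_mod_add[OF span_mod_K[OF c] this] show "f \<in> span_mod K u F'" by simp
qed

definition spans :: "'m set \<Rightarrow> ('i \<Rightarrow> 'm \<Rightarrow>\<^sub>0 complex) \<Rightarrow> 'i set \<Rightarrow> bool" where
  "spans M u F \<longleftrightarrow> (\<forall>f. keys f \<subseteq> M \<longrightarrow> f \<in> span_mod K u F)"

definition indep :: "('i \<Rightarrow> 'm \<Rightarrow>\<^sub>0 complex) \<Rightarrow> 'i set \<Rightarrow> bool" where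
  "indep u F \<longleftrightarrow> (\<forall>c. comb c u F \<in> K \<longrightarrow> (\<forall>i\<in>F. c i = 0))"

lemma spans_remove:
  assumes "spans M u F" "finite F" "i \<in> F" and c: "comb c u F \<in> K" "c i \<noteq> 0"
  shows "spans M u (F - {i})"
  unfolding spans_def
proof (intro allI impI)
  fix f :: "'m \<Rightarrow>\<^sub>0 complex" assume "keys f \<subseteq> M"
  then obtain d where d: "f - comb d u F \<in> K" using assms(1) by (auto simp: spans_def span_mod_def)
  \<comment> \<open>Subtracting \<open>d i / c i\<close> times the relation \<open>c\<close> cancels
    the coefficient at \<open>i\<close>.\<close>
  define e where "e j = d j - d i / c i * c j" for j
  have "comb e u F = comb d u F - const (d i / c i) * comb c u F"
    by (simp add: comb_def e_def const_diff left_diff_distrib sum_subtractf sum_distrib_left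
        mult.assoc[symmetric] const_mult[symmetric])
  moreover have "comb e u F = comb e u (F - {i})"
    unfolding comb_def using assms by (intro sum.mono_neutral_right) (auto simp: e_def)
  ultimately have eq: "comb e u (F - {i}) = comb d u F - const (d i / c i) * comb c u F"
    by simp
  have "f - comb e u (F - {i}) = (f - comb d u F) + const (d i / c i) * comb c u F"
    unfolding eq by simp
  then have "f - comb e u (F - {i}) \<in> K"
    using add_in[OF d scale_in[OF c(1)]] by (simp only:)
  then show "f \<in> span_mod K u (F - {i})"
    unfolding span_mod_def by blast
qed

lemma spans_minimal:
  assumes "finite F" "spans M u F"
  shows "\<exists>F'\<subseteq>F. spans M u F' \<and> indep u F'"
  using assms
proof (induction "card F" arbitrary: F rule: less_induct)
  case less
  show ?case
  proof (cases "indep u F")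
    case False
    then obtain c i where "comb c u F \<in> K" "i \<in> F" "c i \<noteq> 0" by (auto simp: indep_def)
    then have "spans M u (F - {i})" "card (F - {i}) < card F"
      using spans_remove[OF less.prems(2,1)] card_Diff1_less[OF less.prems(1)] by auto
    then show ?thesis
      using less.hyps[of "F - {i}"] less.prems by blast
  qed (use less.prems in auto)
qed

end

text \<open>Gaussian elimination with the unknowns indexed by \<open>D\<close> and the equations by
  \<open>F\<close>: an equation with a nonzero coefficient is used up to eliminate one
  unknown.\<close>

lemma homogeneous_system:
  fixes A :: "'i \<Rightarrow> 'j \<Rightarrow> 'f::field"
  assumes "finite F" "finite D" "card F < card D"
  shows "\<exists>d. (\<exists>i\<in>D. d i \<noteq> 0) \<and> (\<forall>f\<in>F. (\<Sum>i\<in>D. d i * A i f) = 0)"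
  using assms
proof (induction F arbitrary: D A rule: finite_induct)
  case empty
  then show ?case by (intro exI[of _ "\<lambda>_. 1"]) (auto simp: card_gt_0_iff)
next
  case (insert f F)
  show ?case
  proof (cases "\<forall>i\<in>D. A i f = 0")
    case True
    then show ?thesis
      using insert.IH[of D A] insert.prems insert.hyps by (simp add: sum.neutral)
  next
    case False
    then obtain j where j: "j \<in> D" "A j f \<noteq> 0" by auto
    define r where "r i = A i f / A j f" for i
    define A' where "A' i g = A i g - r i * A j g" for i g
    have "card F < card (D - {j})"
      using insert.prems insert.hyps j by simp
    then obtain d where d: "\<exists>i\<in>D - {j}. d i \<noteq> 0" "\<forall>g\<in>F. (\<Sum>i\<in>D - {j}. d i * A' i g) = 0"
      using insert.IH[of "D - {j}" A'] insert.prems by auto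
    \<comment> \<open>The value at the pivot \<open>j\<close> is dictated by the equation
      \<open>f\<close>; the other equations then reduce to the system with matrix
      \<open>A'\<close>.\<close>
    define e where "e = d(j := - (\<Sum>i\<in>D - {j}. d i * r i))"
    have e: "(\<Sum>i\<in>D. e i * A i g) = (\<Sum>i\<in>D - {j}. d i * A' i g)" for g
    proof -
      have "(\<Sum>i\<in>D. e i * A i g) = e j * A j g + (\<Sum>i\<in>D - {j}. e i * A i g)"
        using insert.prems(1) j(1) by (rule sum.remove)
      moreover have "(\<Sum>i\<in>D - {j}. e i * A i g) = (\<Sum>i\<in>D - {j}. d i * A i g)"
        by (rule sum.cong) (simp_all add: e_def)
      moreover have "e j * A j g = - (\<Sum>i\<in>D - {j}. d i * (r i * A j g))"
        by (simp add: e_def sum_distrib_right mult.assoc)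
      moreover have "(\<Sum>i\<in>D - {j}. d i * A' i g) =
          (\<Sum>i\<in>D - {j}. d i * A i g) - (\<Sum>i\<in>D - {j}. d i * (r i * A j g))"
        by (simp only: A'_def right_diff_distrib sum_subtractf)
      ultimately show ?thesis by simp
    qed
    have "(\<Sum>i\<in>D. e i * A i g) = 0" if "g \<in> insert f F" for g
    proof (cases "g = f")
      case True
      then show ?thesis unfolding e using j by (simp add: A'_def r_def)
    next
      case False
      then show ?thesis unfolding e using d that by auto
    qed
    moreover have "\<exists>i\<in>D. e i \<noteq> 0" using d(1) by (auto simp: e_def)
    ultimately show ?thesis by blast
  qed
qed

section \<open>Polynomials in vectors: degrees and evaluation\<close>

definition tdeg :: "('v \<Rightarrow>\<^sub>0 nat) \<Rightarrow> nat" where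
  "tdeg m = (\<Sum>v\<in>keys m. lookup m v)"

lemma tdeg_superset: "finite S \<Longrightarrow> keys m \<subseteq> S \<Longrightarrow> tdeg m = (\<Sum>v\<in>S. lookup m v)"
  unfolding tdeg_def by (rule sum.mono_neutral_left) (auto simp: in_keys_iff)

lemma tdeg_add: "tdeg (a + b) = tdeg a + tdeg b"
proof -
  have "tdeg m = (\<Sum>v\<in>keys a \<union> keys b. lookup m v)" if "m \<in> {a, b, a + b}" for m
    by (rule tdeg_superset) (use that keys_add[of a b] in auto)
  then show ?thesis by (simp add: lookup_add sum.distrib)
qed

lemma tdeg_0 [simp]: "tdeg 0 = 0"
  by (simp add: tdeg_def)

lemma tdeg_single [simp]: "tdeg (single v n) = n"
  by (subst tdeg_superset[of "{v}"]) auto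

lemma tdeg_sum: "tdeg (sum f A) = (\<Sum>i\<in>A. tdeg (f i))"
  by (induction A rule: infinite_finite_induct) (simp_all add: tdeg_add)

definition homogeneous_part :: "nat \<Rightarrow> (('v \<Rightarrow>\<^sub>0 nat) \<Rightarrow>\<^sub>0 complex) \<Rightarrow> (('v \<Rightarrow>\<^sub>0 nat) \<Rightarrow>\<^sub>0 complex)" where
  "homogeneous_part n p = Poly_Mapping.mapp (\<lambda>m c. if tdeg m = n then c else 0) p"

abbreviation "hp \<equiv> homogeneous_part"

lemma lookup_hp: "lookup (hp n p) m = (if tdeg m = n then lookup p m else 0)"
  by (auto simp: homogeneous_part_def lookup_mapp when_def in_keys_iff)

lemma hp_add: "hp n (p + q) = hp n p + hp n q"
  by (rule poly_mapping_eqI) (simp add: lookup_hp lookup_add)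

lemma hp_0 [simp]: "hp n 0 = 0"
  by (rule poly_mapping_eqI) (simp add: lookup_hp)

lemma hp_diff: "hp n (p - q) = hp n p - hp n q"
  by (rule poly_mapping_eqI) (simp add: lookup_hp lookup_minus)

lemma hp_const_mult: "hp n (const c * p) = const c * hp n p"
  by (rule poly_mapping_eqI) (simp add: lookup_hp lookup_const_mult)

lemma hp_sum: "hp n (sum f A) = (\<Sum>i\<in>A. hp n (f i))"
  by (induction A rule: infinite_finite_induct) (simp_all add: hp_add)

lemma hp_single: "hp n (single m c) = (if tdeg m = n then single m c else 0)"
  by (rule poly_mapping_eqI) (auto simp: lookup_hp lookup_single when_def)

lemma hp_hp: "hp n (hp k p) = (if n = k then hp k p else 0)"
  by (rule poly_mapping_eqI) (auto simp: lookup_hp)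

lemma hp_single_mult:
  "hp n (single m c * p) = (if tdeg m \<le> n then single m c * hp (n - tdeg m) p else 0)"
proof (induction p rule: poly_mapping_additive_induct[where M = UNIV])
  case 2
  show ?case by simp
next
  case (3 p q)
  then show ?case by (simp add: distrib_left hp_add)
next
  case (4 m' c')
  then show ?case by (auto simp: mult_single hp_single tdeg_add)
qed simp

text \<open>The bound is strict, so that \<open>low 0\<close> means zero and can start inductions on
  the degree.\<close>

definition low :: "nat \<Rightarrow> (('v \<Rightarrow>\<^sub>0 nat) \<Rightarrow>\<^sub>0 complex) \<Rightarrow> bool" where
  "low n p \<longleftrightarrow> (\<forall>m\<in>keys p. tdeg m < n)"

lemma low_0 [simp]: "low n 0"
  by (simp add: low_def)

lemma low_add: "low n p \<Longrightarrow> low n q \<Longrightarrow> low n (p + q)"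
  using keys_add[of p q] by (auto simp: low_def)

lemma low_single_mult: "low n p \<Longrightarrow> low (tdeg m + n) (single m c * p)"
  using keys_mult[of "single m c" p] by (fastforce simp: low_def tdeg_add split: if_splits)

lemma low_mono: "low n p \<Longrightarrow> n \<le> k \<Longrightarrow> low k p"
  by (auto simp: low_def)

lemma low_exists: "\<exists>n. low n p"
proof -
  have "tdeg m \<le> (\<Sum>m\<in>keys p. tdeg m)" if "m \<in> keys p" for m
    using that by (intro member_le_sum) auto
  then show ?thesis
    unfolding low_def by (intro exI[of _ "Suc (\<Sum>m\<in>keys p. tdeg m)"]) (auto simp: less_Suc_eq_le)
qed

lemma low_0_iff: "low 0 p \<longleftrightarrow> p = 0"
  by (auto simp: low_def)

lemma low_diff_hp: "low (Suc n) p \<Longrightarrow> low n (p - hp n p)"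
  by (auto simp: low_def in_keys_iff lookup_minus lookup_hp less_Suc_eq split: if_splits)

definition mon_eval :: "('v \<Rightarrow> complex) \<Rightarrow> ('v \<Rightarrow>\<^sub>0 nat) \<Rightarrow> complex" where
  "mon_eval x m = (\<Prod>v\<in>keys m. x v ^ lookup m v)"

lemma mon_eval_superset:
  "finite S \<Longrightarrow> keys m \<subseteq> S \<Longrightarrow> mon_eval x m = (\<Prod>v\<in>S. x v ^ lookup m v)"
  unfolding mon_eval_def by (rule prod.mono_neutral_left) (auto simp: in_keys_iff)

lemma mon_eval_add: "mon_eval x (a + b) = mon_eval x a * mon_eval x b"
proof -
  have "mon_eval x m = (\<Prod>v\<in>keys a \<union> keys b. x v ^ lookup m v)" if "m \<in> {a, b, a + b}" for m
    by (rule mon_eval_superset) (use that keys_add[of a b] in auto)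
  then show ?thesis by (simp add: lookup_add power_add prod.distrib)
qed

definition poly_eval :: "('v \<Rightarrow> complex) \<Rightarrow> (('v \<Rightarrow>\<^sub>0 nat) \<Rightarrow>\<^sub>0 complex) \<Rightarrow> complex" where
  "poly_eval x = lift (\<lambda>c. c) (mon_eval x)"

lemma poly_eval_mult: "poly_eval x (p * q) = poly_eval x p * poly_eval x q"
  unfolding poly_eval_def by (rule id.lift_mult[where M = UNIV]) (auto simp: mon_eval_add)

lemma poly_eval_const [simp]: "poly_eval x (const c) = c"
  unfolding poly_eval_def by (rule id.lift_const) (simp add: mon_eval_def)

lemma poly_eval_1 [simp]: "poly_eval x 1 = 1"
  using poly_eval_const[of x 1] by simp

lemma poly_eval_add: "poly_eval x (p + q) = poly_eval x p + poly_eval x q"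
  by (simp add: poly_eval_def id.lift_add)

lemma poly_eval_diff: "poly_eval x (p - q) = poly_eval x p - poly_eval x q"
  by (simp add: poly_eval_def id.lift_diff)

lemma poly_eval_0 [simp]: "poly_eval x 0 = 0"
  by (simp add: poly_eval_def id.lift_0)

lemma poly_eval_sum: "poly_eval x (sum f A) = (\<Sum>i\<in>A. poly_eval x (f i))"
  by (simp add: poly_eval_def id.lift_sum)

lemma poly_eval_prod: "poly_eval x (prod f A) = (\<Prod>i\<in>A. poly_eval x (f i))"
  by (induction A rule: infinite_finite_induct) (simp_all add: poly_eval_mult)

lemma poly_eval_gen_var [simp]: "poly_eval x (gen_var v) = x v"
  by (simp add: poly_eval_def gen_var_def id.lift_single mon_eval_def)

lemmas poly_eval_simps = poly_eval_add poly_eval_diff poly_eval_mult poly_eval_sum poly_eval_prod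

section \<open>The algebra \<open>A\<^sub>Z\<close> as a quotient of polynomials\<close>

definition zprod :: "'v::real_vector list \<Rightarrow> nat set \<Rightarrow> (('v \<Rightarrow>\<^sub>0 nat) \<Rightarrow>\<^sub>0 complex)" where
  "zprod Z Y = (\<Prod>i\<in>Y. gen_var (Z ! i))"

lemma zprod_eq_single: "zprod Z Y = single (\<Sum>i\<in>Y. single (Z ! i) 1) 1"
  unfolding zprod_def gen_var_def
  by (induction Y rule: infinite_finite_induct) (simp_all add: mult_single)

lemma hp_zprod: "hp n (zprod Z Y) = (if n = card Y then zprod Z Y else 0)"
  by (simp add: zprod_eq_single hp_single tdeg_sum)

definition linear_gens :: "(('v::real_vector \<Rightarrow>\<^sub>0 nat) \<Rightarrow>\<^sub>0 complex) set" where
  "linear_gens = {gen_var (u + v) - gen_var u - gen_var v | u v. True} \<union>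
     {gen_var (r *\<^sub>R v) - const (complex_of_real r) * gen_var v | r v. True}"

text \<open>The preimage of \<open>I_ideal Z\<close> in the polynomial ring: the relations of real
  linearity and the cocircuit products are imposed together, which replaces the iterated quotient in
  \<open>A_alg\<close> by one congruence.\<close>

definition K_ideal :: "'v::real_vector list \<Rightarrow> (('v \<Rightarrow>\<^sub>0 nat) \<Rightarrow>\<^sub>0 complex) set" where
  "K_ideal Z = genideal free_alg (linear_gens \<union> {zprod Z Y | Y. Y \<in> cocircuits Z})"

definition A_cls :: "'v::real_vector list \<Rightarrow> (('v \<Rightarrow>\<^sub>0 nat) \<Rightarrow>\<^sub>0 complex) \<Rightarrow>
    (('v \<Rightarrow>\<^sub>0 nat) \<Rightarrow>\<^sub>0 complex) set set" where
  "A_cls Z p = I_ideal Z +>\<^bsub>sym_alg\<^esub> (linear_relations +>\<^bsub>free_alg\<^esub> p)"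

global_interpretation univ: add_submonoid "UNIV :: 'm::comm_monoid_add set"
  by unfold_locales auto

lemma A_vec_eq: "A_vec Z v = A_cls Z (gen_var v)"
  by (simp add: A_vec_def A_cls_def sym_vec_def)

lemma ideal_update:
  fixes R :: "('a, 'b) ring_scheme" and S :: "('a, 'c) ring_scheme"
  assumes "ideal I R" "ring S" and "carrier S = carrier R" "monoid.mult S = monoid.mult R"
    "zero S = zero R" "add S = add R"
  shows "ideal I S"
proof -
  interpret ideal I R by fact
  have inv: "inv\<^bsub>add_monoid S\<^esub> x = inv\<^bsub>add_monoid R\<^esub> x" for x
    by (simp add: m_inv_def assms)
  have "subgroup I (add_monoid S)"
    using a_subgroup unfolding subgroup_def inv by (simp add: assms)
  then show ?thesis
    using I_l_closed I_r_closed assms by (intro idealI) auto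
qed

lemma pm_ideal_K: "pm_ideal (K_ideal Z)"
proof -
  have "ideal (K_ideal Z) free_alg"
    unfolding K_ideal_def by (rule univ.alg.genideal_ideal) simp
  then show ?thesis
    unfolding univ.ideal_monoid_alg_iff by unfold_locales auto
qed

lemma K_gens: "linear_gens \<subseteq> K_ideal Z" "Y \<in> cocircuits Z \<Longrightarrow> zprod Z Y \<in> K_ideal Z"
  using univ.alg.genideal_self[of "linear_gens \<union> {zprod Z Y | Y. Y \<in> cocircuits Z}"]
  unfolding K_ideal_def by auto

lemma K_minimal:
  assumes "pm_ideal K" "linear_gens \<subseteq> K" "\<And>Y. Y \<in> cocircuits Z \<Longrightarrow> zprod Z Y \<in> K"
  shows "K_ideal Z \<subseteq> K"
proof -
  interpret pm_ideal K by fact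
  have "ideal K free_alg"
    unfolding univ.ideal_monoid_alg_iff using zero_mem add_mem mult_mem by auto
  then show ?thesis
    unfolding K_ideal_def by (rule univ.alg.genideal_minimal) (use assms in auto)
qed

lemma linear_relations_eq: "linear_relations = genideal free_alg linear_gens"
  by (simp add: linear_relations_def linear_gens_def)

lemma linear_relations_ideal: "ideal linear_relations free_alg"
  unfolding linear_relations_eq by (rule univ.alg.genideal_ideal) simp

lemma sym_alg_complex_algebra: "complex_algebra sym_alg"
  unfolding sym_alg_def by (rule univ.alg.quot_alg_complex_algebra[OF linear_relations_ideal])

lemma sym_cls_hom: "(+>\<^bsub>free_alg\<^esub>) linear_relations \<in> alg_hom free_alg sym_alg"
  unfolding sym_alg_def by (rule univ.alg.quot_alg_hom[OF linear_relations_ideal])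

lemma sym_alg_carrier: "carrier sym_alg = range ((+>\<^bsub>free_alg\<^esub>) linear_relations)"
  unfolding sym_alg_def univ.alg.quot_alg_carrier by simp

lemma sym_vec_prod:
  "finite Y \<Longrightarrow> (\<Otimes>\<^bsub>sym_alg\<^esub>i\<in>Y. sym_vec (Z ! i)) = linear_relations +>\<^bsub>free_alg\<^esub> zprod Z Y"
proof (induction Y rule: finite_induct)
  case empty
  interpret sym: complex_algebra sym_alg by (rule sym_alg_complex_algebra)
  show ?case
    using ring_hom_one[OF alg_hom_ring_hom[OF sym_cls_hom], symmetric] by (simp add: zprod_def)
next
  case (insert i Y)
  interpret sym: complex_algebra sym_alg by (rule sym_alg_complex_algebra)
  have "(\<Otimes>\<^bsub>sym_alg\<^esub>i\<in>insert i Y. sym_vec (Z ! i)) = sym_vec (Z ! i) \<otimes>\<^bsub>sym_alg\<^esub> (\<Otimes>\<^bsub>sym_alg\<^esub>i\<in>Y. sym_vec (Z ! i))"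
    using insert by (intro sym.finprod_insert) (auto simp: sym_vec_def sym_alg_carrier)
  also have "\<dots> = linear_relations +>\<^bsub>free_alg\<^esub> (gen_var (Z ! i) * zprod Z Y)"
    unfolding insert.IH unfolding sym_vec_def
    using ring_hom_mult[OF alg_hom_ring_hom[OF sym_cls_hom], of "gen_var (Z ! i)" "zprod Z Y"] by simp
  finally show ?case using insert by (simp add: zprod_def)
qed

lemma bases_finite: "finite (bases Z)"
  by (rule finite_subset[of _ "Pow {..<length Z}"]) (auto simp: bases_def)

lemma cocircuit_finite: "Y \<in> cocircuits Z \<Longrightarrow> finite Y"
  by (auto simp: cocircuits_def intro: finite_subset)

lemma I_ideal_eq:
  "I_ideal Z = genideal sym_alg {linear_relations +>\<^bsub>free_alg\<^esub> zprod Z Y | Y. Y \<in> cocircuits Z}"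
proof -
  have "{\<Otimes>\<^bsub>sym_alg\<^esub>i\<in>Y. sym_vec (Z ! i) | Y. Y \<in> cocircuits Z} =
      {linear_relations +>\<^bsub>free_alg\<^esub> zprod Z Y | Y. Y \<in> cocircuits Z}"
    using sym_vec_prod[OF cocircuit_finite, of _ Z Z] by auto
  then show ?thesis by (simp add: I_ideal_def)
qed

lemma I_ideal_ideal: "ideal (I_ideal Z) sym_alg"
proof -
  interpret sym: complex_algebra sym_alg by (rule sym_alg_complex_algebra)
  show ?thesis
    unfolding I_ideal_eq by (rule sym.genideal_ideal) (auto simp: sym_alg_carrier)
qed

lemma A_alg_complex_algebra: "complex_algebra (A_alg Z)"
  unfolding A_alg_def
  by (rule complex_algebra.quot_alg_complex_algebra[OF sym_alg_complex_algebra I_ideal_ideal])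

lemma A_cls_hom: "A_cls Z \<in> alg_hom free_alg (A_alg Z)"
proof -
  have "A_cls Z = (+>\<^bsub>sym_alg\<^esub>) (I_ideal Z) \<circ> (+>\<^bsub>free_alg\<^esub>) linear_relations"
    by (auto simp: A_cls_def)
  then show ?thesis
    using alg_hom_compose[OF sym_cls_hom
        complex_algebra.quot_alg_hom[OF sym_alg_complex_algebra I_ideal_ideal]]
    by (simp add: A_alg_def)
qed

lemma A_cls_onto: "A_cls Z ` UNIV = carrier (A_alg Z)"
  unfolding A_alg_def complex_algebra.quot_alg_carrier[OF sym_alg_complex_algebra] sym_alg_carrier
  by (auto simp: A_cls_def)

text \<open>Both inclusions come from minimality of generated ideals: the image of
  \<open>K_ideal Z\<close> is an ideal containing the generators of \<open>I_ideal Z\<close>, and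
  the kernel of \<open>A_cls Z\<close> contains the generators of \<open>K_ideal Z\<close>.\<close>

lemma A_cls_zero_iff: "A_cls Z p = \<zero>\<^bsub>A_alg Z\<^esub> \<longleftrightarrow> p \<in> K_ideal Z"
proof -
  let ?L = "linear_relations :: (('a \<Rightarrow>\<^sub>0 nat) \<Rightarrow>\<^sub>0 complex) set"
  let ?c = "\<lambda>p. ?L +>\<^bsub>free_alg\<^esub> p"
  interpret sym: complex_algebra sym_alg by (rule sym_alg_complex_algebra)
  interpret K: pm_ideal "K_ideal Z" by (rule pm_ideal_K)
  have LK: "?L \<subseteq> K_ideal Z"
    unfolding linear_relations_eq
    by (rule univ.alg.genideal_minimal)
       (use K.zero_mem K.add_mem K.mult_mem K_gens(1)[of Z] in \<open>auto simp: univ.ideal_monoid_alg_iff\<close>)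
  have K_ideal: "ideal (K_ideal Z) free_alg"
    unfolding univ.ideal_monoid_alg_iff using K.zero_mem K.add_mem K.mult_mem by auto
  have gens: "{?c (zprod Z Y) | Y. Y \<in> cocircuits Z} \<subseteq> carrier sym_alg"
    by (auto simp: sym_alg_carrier)
  have iff: "A_cls Z p = \<zero>\<^bsub>A_alg Z\<^esub> \<longleftrightarrow> ?c p \<in> I_ideal Z" for p
    unfolding A_cls_def A_alg_def
    by (rule sym.quot_alg_zero_iff[OF I_ideal_ideal]) (simp add: sym_alg_carrier)
  have "ideal (?c ` K_ideal Z) (free_alg Quot ?L)"
    by (rule univ.alg.ring_ideal_imp_quot_ideal[OF linear_relations_ideal K_ideal])
  then have "ideal (?c ` K_ideal Z) sym_alg"
    by (rule ideal_update) (simp_all add: sym.ring_axioms, simp_all add: sym_alg_def)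
  then have I: "I_ideal Z \<subseteq> ?c ` K_ideal Z"
    unfolding I_ideal_eq by (rule sym.genideal_minimal) (use K_gens(2) in \<open>auto intro!: imageI\<close>)
  show ?thesis
  proof
    assume "A_cls Z p = \<zero>\<^bsub>A_alg Z\<^esub>"
    then obtain p' where p': "p' \<in> K_ideal Z" "?c p = ?c p'"
      using I by (auto simp: iff)
    then have "p \<ominus>\<^bsub>free_alg\<^esub> p' \<in> ?L"
      using univ.alg.quotient_eq_iff_same_a_r_cos[OF linear_relations_ideal, of p p'] by simp
    then have "p - p' \<in> K_ideal Z"
      using LK by (auto simp: univ.alg.minus_eq univ.a_inv_monoid_alg)
    then show "p \<in> K_ideal Z"
      using K.add_mem[of "p - p'" p'] p' by simp
  next
    interpret A: complex_algebra "A_alg Z" by (rule A_alg_complex_algebra)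
    interpret h: ring_hom_cring free_alg "A_alg Z" "A_cls Z"
      by unfold_locales (rule alg_hom_ring_hom[OF A_cls_hom])
    have "A_cls Z (x + y) = A_cls Z x \<oplus>\<^bsub>A_alg Z\<^esub> A_cls Z y"
      "A_cls Z (x * y) = A_cls Z x \<otimes>\<^bsub>A_alg Z\<^esub> A_cls Z y" "A_cls Z x \<in> carrier (A_alg Z)" for x y
      using h.hom_add[of x y] h.hom_mult[of x y] h.hom_closed[of x] by simp_all
    then have "pm_ideal {p. A_cls Z p = \<zero>\<^bsub>A_alg Z\<^esub>}"
      using h.hom_zero by unfold_locales simp_all
    moreover have "linear_gens \<subseteq> {p. A_cls Z p = \<zero>\<^bsub>A_alg Z\<^esub>}"
    proof
      fix p :: "('a \<Rightarrow>\<^sub>0 nat) \<Rightarrow>\<^sub>0 complex" assume "p \<in> linear_gens"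
      then have "p \<in> ?L"
        unfolding linear_relations_eq using univ.alg.genideal_self[of linear_gens] by auto
      then have "?c p = \<zero>\<^bsub>sym_alg\<^esub>"
        unfolding sym_alg_def using univ.alg.quot_alg_zero_iff[OF linear_relations_ideal] by auto
      then show "p \<in> {p. A_cls Z p = \<zero>\<^bsub>A_alg Z\<^esub>}"
        using additive_subgroup.zero_closed[OF ideal.axioms(1)[OF I_ideal_ideal]] by (simp add: iff)
    qed
    moreover have "zprod Z Y \<in> {p. A_cls Z p = \<zero>\<^bsub>A_alg Z\<^esub>}" if "Y \<in> cocircuits Z" for Y
      using that sym.genideal_self[OF gens] by (auto simp: iff I_ideal_eq)
    ultimately have "K_ideal Z \<subseteq> {p. A_cls Z p = \<zero>\<^bsub>A_alg Z\<^esub>}"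
      by (rule K_minimal)
    then show "p \<in> K_ideal Z \<Longrightarrow> A_cls Z p = \<zero>\<^bsub>A_alg Z\<^esub>" by auto
  qed
qed

section \<open>Spanning sets and nilpotency in \<open>A\<^sub>Z\<close>\<close>

text \<open>Coefficients are indexed by positions, so repeated vectors in a list cause no
  collision.\<close>

lemma span_image_sum:
  fixes x :: "'i \<Rightarrow> 'v::real_vector"
  assumes "finite I" "w \<in> span (x ` I)"
  shows "\<exists>c. w = (\<Sum>i\<in>I. c i *\<^sub>R x i)"
proof -
  have "subspace {w. \<exists>c. w = (\<Sum>i\<in>I. c i *\<^sub>R x i)}" (is "subspace ?S")
  proof (rule subspaceI)
    show "0 \<in> ?S" by (auto intro!: exI[of _ "\<lambda>_. 0"])
    fix u v assume "u \<in> ?S" "v \<in> ?S"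
    then obtain c d where "u = (\<Sum>i\<in>I. c i *\<^sub>R x i)" "v = (\<Sum>i\<in>I. d i *\<^sub>R x i)" by auto
    then show "u + v \<in> ?S"
      by (auto intro!: exI[of _ "\<lambda>i. c i + d i"] simp: scaleR_add_left sum.distrib)
  next
    fix a u assume "u \<in> ?S"
    then obtain c where "u = (\<Sum>i\<in>I. c i *\<^sub>R x i)" by auto
    then show "a *\<^sub>R u \<in> ?S"
      by (auto intro!: exI[of _ "\<lambda>i. a * c i"] simp: scaleR_sum_right)
  qed
  moreover have "x ` I \<subseteq> ?S"
  proof
    fix v assume "v \<in> x ` I"
    then obtain j where j: "j \<in> I" "v = x j" by auto
    have "(\<Sum>i\<in>I. (if i = j then 1 else 0) *\<^sub>R x i) = (\<Sum>i\<in>I. if i = j then x i else 0)"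
      by (intro sum.cong) auto
    then have "v = (\<Sum>i\<in>I. (if i = j then 1 else 0) *\<^sub>R x i)"
      using j assms(1) by simp
    then show "v \<in> ?S" by (intro CollectI exI[of _ "\<lambda>i. if i = j then 1 else 0"])
  qed
  ultimately have "span (x ` I) \<subseteq> ?S" by (intro span_minimal)
  then show ?thesis using assms by auto
qed

sublocale pm_ideal \<subseteq> sub: pm_subspace K
  by unfold_locales (use zero_mem add_mem mult_mem in auto)

context
  fixes Z :: "'v::real_vector list"
begin

interpretation K: pm_ideal "K_ideal Z"
  by (rule pm_ideal_K)

lemma gen_var_add_equiv: "K.equiv_mod (gen_var (u + v)) (gen_var u + gen_var v)"
proof -
  have "gen_var (u + v) - gen_var u - gen_var v \<in> linear_gens"
    unfolding linear_gens_def by blast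
  then show ?thesis
    using K_gens(1)[of Z] by (auto simp: K.equiv_mod_def diff_diff_eq)
qed

lemma gen_var_scale_equiv: "K.equiv_mod (gen_var (r *\<^sub>R v)) (const (of_real r) * gen_var v)"
proof -
  have "gen_var (r *\<^sub>R v) - const (of_real r) * gen_var v \<in> linear_gens"
    unfolding linear_gens_def by blast
  then show ?thesis
    using K_gens(1)[of Z] by (auto simp: K.equiv_mod_def)
qed

lemma gen_var_0_equiv: "K.equiv_mod (gen_var 0) 0"
  using gen_var_scale_equiv[of 0 0] by simp

lemma gen_var_uminus_equiv: "K.equiv_mod (gen_var (- v)) (- gen_var v)"
  using gen_var_scale_equiv[of "-1" v] by (simp add: const_uminus)

lemma gen_var_sum_equiv:
  "K.equiv_mod (gen_var (\<Sum>i\<in>I. c i *\<^sub>R x i)) (\<Sum>i\<in>I. const (of_real (c i)) * gen_var (x i))"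
proof (induction I rule: infinite_finite_induct)
  case (insert i I)
  have "K.equiv_mod (gen_var (c i *\<^sub>R x i + (\<Sum>i\<in>I. c i *\<^sub>R x i)))
      (gen_var (c i *\<^sub>R x i) + gen_var (\<Sum>i\<in>I. c i *\<^sub>R x i))"
    by (rule gen_var_add_equiv)
  also have "K.equiv_mod (gen_var (c i *\<^sub>R x i) + gen_var (\<Sum>i\<in>I. c i *\<^sub>R x i))
      (const (of_real (c i)) * gen_var (x i) + (\<Sum>i\<in>I. const (of_real (c i)) * gen_var (x i)))"
    by (intro K.equiv_add gen_var_scale_equiv insert.IH)
  finally show ?case using insert.hyps by simp
qed (use gen_var_0_equiv in simp_all)

text \<open>The \<open>n\<close>-th layer of the straightening: if \<open>Z - Y\<close> still spans, then \<open>w\<close> is a combination of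
  the \<open>z\<^sub>i\<close> with \<open>i \<notin> Y\<close>, so that \<open>w z\<^sub>Y\<close> is a combination of the \<open>z\<^bsub>Y \<union> {i}\<^esub>\<close>.\<close>

abbreviation "layer n \<equiv> span_mod (K_ideal Z) (zprod Z) {Y. Y \<subseteq> {..<length Z} \<and> card Y = n}"

lemma finite_layer_index: "finite {Y. Y \<subseteq> {..<length Z} \<and> card Y = n}"
  by (rule finite_subset[of _ "Pow {..<length Z}"]) auto

lemma layer_equiv:
  assumes "K.equiv_mod p q" "q \<in> layer n"
  shows "p \<in> layer n"
proof -
  have "p - q \<in> layer n"
    using assms(1) by (intro K.sub.span_mod_K) (simp add: K.equiv_mod_def)
  from K.sub.span_mod_add[OF this assms(2)] show ?thesis by simp
qed

lemma layer_zprod: "Y \<subseteq> {..<length Z} \<Longrightarrow> zprod Z Y \<in> layer (card Y)"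
  by (rule K.sub.span_mod_base[OF finite_layer_index]) simp

lemma layer_gen_var_zprod:
  assumes Y: "Y \<subseteq> {..<length Z}"
  shows "gen_var w * zprod Z Y \<in> layer (Suc (card Y))"
proof (cases "Y \<in> cocircuits Z")
  case True
  then show ?thesis by (intro K.sub.span_mod_K K.mult_mem K_gens)
next
  case False
  then have "w \<in> span ((!) Z ` ({..<length Z} - Y))"
    using Y by (auto simp: cocircuits_def)
  then obtain c where c: "w = (\<Sum>i\<in>{..<length Z} - Y. c i *\<^sub>R Z ! i)"
    using span_image_sum[of "{..<length Z} - Y"] by auto
  have "K.equiv_mod (gen_var w * zprod Z Y)
      ((\<Sum>i\<in>{..<length Z} - Y. const (of_real (c i)) * gen_var (Z ! i)) * zprod Z Y)"
    unfolding c by (intro K.equiv_mult gen_var_sum_equiv K.equiv_refl)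
  moreover have "(\<Sum>i\<in>{..<length Z} - Y. const (of_real (c i)) * gen_var (Z ! i)) * zprod Z Y \<in> layer (Suc (card Y))"
    unfolding sum_distrib_right
  proof (rule K.sub.span_mod_sum)
    fix i assume i: "i \<in> {..<length Z} - Y"
    have fin: "finite Y" using Y finite_subset by blast
    then have "gen_var (Z ! i) * zprod Z Y = zprod Z (insert i Y)"
      using i by (simp add: zprod_def)
    moreover have "zprod Z (insert i Y) \<in> layer (Suc (card Y))"
      using layer_zprod[of "insert i Y"] i Y fin by simp
    ultimately show "const (of_real (c i)) * gen_var (Z ! i) * zprod Z Y \<in> layer (Suc (card Y))"
      using K.sub.span_mod_const by (simp add: mult.assoc)
  qed
  ultimately show ?thesis by (rule layer_equiv)
qed

lemma layer_gen_var:
  assumes "p \<in> layer n"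
  shows "gen_var w * p \<in> layer (Suc n)"
proof -
  let ?F = "{Y. Y \<subseteq> {..<length Z} \<and> card Y = n}"
  obtain c where c: "p - comb c (zprod Z) ?F \<in> K_ideal Z"
    using assms by (auto simp: span_mod_def)
  have "gen_var w * comb c (zprod Z) ?F = (\<Sum>Y\<in>?F. const (c Y) * (gen_var w * zprod Z Y))"
    by (simp add: comb_def sum_distrib_left mult_ac)
  also have "\<dots> \<in> layer (Suc n)"
    by (intro K.sub.span_mod_sum K.sub.span_mod_const) (use layer_gen_var_zprod in auto)
  finally have "gen_var w * comb c (zprod Z) ?F \<in> layer (Suc n)" .
  moreover have "K.equiv_mod (gen_var w * p) (gen_var w * comb c (zprod Z) ?F)"
    by (intro K.equiv_mult) (use c in \<open>auto simp: K.equiv_mod_def K.zero_mem\<close>)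
  ultimately show ?thesis using layer_equiv by blast
qed

text \<open>Variables are split off one at a time, and multiplication by each raises the layer by
  one.\<close>

lemma single_in_layer: "single m c \<in> layer (tdeg m)"
proof (induction "tdeg m" arbitrary: m)
  case 0
  then have "\<forall>v. lookup m v = 0"
    by (auto simp: tdeg_def in_keys_iff)
  then have "m = 0"
    by (simp add: poly_mapping_eq_iff fun_eq_iff)
  moreover have "const c * zprod Z {} \<in> layer 0"
    using K.sub.span_mod_const[OF layer_zprod[of "{}"]] by simp
  moreover have "zprod Z {} = 1"
    by (simp add: zprod_def)
  ultimately show ?case by (simp add: const_def)
next
  case (Suc n)
  then have "keys m \<noteq> {}" by (auto simp: tdeg_def)
  then obtain v where v: "v \<in> keys m" by blast
  define m' where "m' = m - single v 1"
  have m: "m = single v 1 + m'"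
    using v by (intro poly_mapping_eqI) (auto simp: m'_def lookup_add lookup_minus lookup_single when_def in_keys_iff)
  then have "tdeg m' = n" using Suc.hyps(2) by (simp add: tdeg_add)
  then have "gen_var v * single m' c \<in> layer (Suc n)"
    using Suc.hyps(1)[of m'] layer_gen_var by simp
  then show ?case
    using Suc.hyps(2) m by (simp add: gen_var_def mult_single)
qed

text \<open>No set of positions has more than \<open>length Z\<close> elements, so the layer in that
  degree is \<open>K_ideal Z\<close> itself. The nilpotency bounds in the local algebras rest on
  this.\<close>

lemma K_high_degree:
  assumes "tdeg m > length Z"
  shows "single m c \<in> K_ideal Z"
proof -
  have F: "{Y. Y \<subseteq> {..<length Z} \<and> card Y = tdeg m} = {}"
  proof -
    have "\<not> (Y \<subseteq> {..<length Z} \<and> card Y = tdeg m)" for Y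
      using card_mono[of "{..<length Z}" Y] assms by auto
    then show ?thesis by blast
  qed
  then show ?thesis
    using single_in_layer[of m c] unfolding span_mod_def F by (simp add: comb_def)
qed

lemma zprod_spans: "K.sub.spans UNIV (zprod Z) (Pow {..<length Z})"
  unfolding K.sub.spans_def
proof (intro allI impI)
  fix p :: "('v \<Rightarrow>\<^sub>0 nat) \<Rightarrow>\<^sub>0 complex"
  show "p \<in> span_mod (K_ideal Z) (zprod Z) (Pow {..<length Z})"
  proof (induction p rule: poly_mapping_additive_induct[where M = UNIV])
    case (4 m a)
    have "layer (tdeg m) \<subseteq> span_mod (K_ideal Z) (zprod Z) (Pow {..<length Z})"
      by (rule K.sub.span_mod_mono) auto
    then show ?case using single_in_layer by blast
  qed (auto intro: K.sub.span_mod_add K.sub.span_mod_K K.zero_mem)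
qed

section \<open>A lower bound for the dimension of \<open>A\<^sub>Z\<close>\<close>

text \<open>Moving the hyperplanes to \<open>z\<^sub>i = x\<^sup>i\<close> with \<open>x\<close> generic, the bases of \<open>Z\<close> cut out distinct
  points.\<close>

lemma generic_points:
  "\<exists>(pt :: nat set \<Rightarrow> 'v \<Rightarrow> real) \<mu>. (\<forall>b\<in>bases Z. linear (pt b) \<and> (\<forall>i\<in>b. pt b (Z ! i) = \<mu> i)) \<and> inj_on pt (bases Z)"
proof -
  have fin: "finite b" if "b \<in> bases Z" for b
    using that by (auto simp: bases_def intro: finite_subset)
  have "\<exists>c. w = (\<Sum>i\<in>b. c i *\<^sub>R Z ! i)" if "b \<in> bases Z" for b and w
    using span_image_sum[OF fin[OF that], of w "(!) Z"] that by (auto simp: bases_def)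
  then obtain a where a: "\<And>b w. b \<in> bases Z \<Longrightarrow> w = (\<Sum>i\<in>b. a b w i *\<^sub>R Z ! i)"
    by metis
  \<comment> \<open>The vanishing of this polynomial at \<open>x\<close> means that the point of
    \<open>b\<close> also lies on the moved hyperplane of \<open>j\<close>. As
    \<open>j \<notin> b\<close>, its coefficient in degree \<open>j\<close> is 1, so only finitely
    many \<open>x\<close> are bad.\<close>
  define P where "P = (\<lambda>(b, j). monom 1 j - (\<Sum>i\<in>b. monom (a b (Z ! j) i) i))"
  define D where "D = {(b, j). b \<in> bases Z \<and> j < length Z \<and> j \<notin> b}"
  have "coeff (P (b, j)) j = 1" if "(b, j) \<in> D" for b j
  proof -
    have "(\<Sum>i\<in>b. coeff (monom (a b (Z ! j) i) i) j) = 0"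
      using that by (intro sum.neutral) (auto simp: D_def)
    then show ?thesis by (simp add: P_def coeff_sum)
  qed
  then have "P bj \<noteq> 0" if "bj \<in> D" for bj
    using that by (cases bj) force
  moreover have "finite D"
    by (rule finite_subset[of _ "bases Z \<times> {..<length Z}"]) (auto simp: D_def bases_finite)
  ultimately have "finite (\<Union>bj\<in>D. {x. poly (P bj) x = 0})"
    using poly_roots_finite by blast
  then obtain x where "x \<notin> (\<Union>bj\<in>D. {x. poly (P bj) x = 0})"
    using ex_new_if_finite infinite_UNIV_char_0 by blast
  then have x: "poly (P (b, j)) x \<noteq> 0" if "b \<in> bases Z" "j < length Z" "j \<notin> b" for b j
    using that by (auto simp: D_def)
  define \<mu> where "\<mu> i = x ^ i" for i
  have "\<exists>g. linear g \<and> (\<forall>i\<in>b. g (Z ! i) = \<mu> i)" if b: "b \<in> bases Z" for b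
  proof -
    have inj: "inj_on ((!) Z) b" and ind: "independent ((!) Z ` b)"
      using b by (auto simp: bases_def)
    obtain g where "linear g" "\<forall>v\<in>(!) Z ` b. g v = \<mu> (the_inv_into b ((!) Z) v)"
      using linear_independent_extend[OF ind, of "\<lambda>v. \<mu> (the_inv_into b ((!) Z) v)"] by auto
    then show ?thesis
      using the_inv_into_f_f[OF inj] by auto
  qed
  then obtain pt where pt: "\<And>b. b \<in> bases Z \<Longrightarrow> linear (pt b :: 'v \<Rightarrow> real)"
    "\<And>b i. b \<in> bases Z \<Longrightarrow> i \<in> b \<Longrightarrow> pt b (Z ! i) = \<mu> i"
    by metis
  \<comment> \<open>If \<open>b\<close> and \<open>b'\<close> had the same point, an index in
    \<open>b' - b\<close> would make the polynomial \<open>P (b, j)\<close> vanish at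
    \<open>x\<close>. Exchanging the two bases gives equality.\<close>
  have sub: "b' \<subseteq> b" if b: "b \<in> bases Z" "b' \<in> bases Z" "pt b = pt b'" for b b'
  proof
    fix j assume j: "j \<in> b'"
    show "j \<in> b"
    proof (rule ccontr)
      assume nj: "j \<notin> b"
      have jn: "j < length Z" using j b by (auto simp: bases_def)
      have "pt b (Z ! j) = pt b (\<Sum>i\<in>b. a b (Z ! j) i *\<^sub>R Z ! i)"
        using a[OF b(1), of "Z ! j"] by simp
      also have "\<dots> = (\<Sum>i\<in>b. a b (Z ! j) i * \<mu> i)"
        using pt b(1) by (simp add: linear_sum linear_scale)
      finally have "\<mu> j = (\<Sum>i\<in>b. a b (Z ! j) i * \<mu> i)"
        using pt(2)[OF b(2) j] b(3) by simp
      then have "poly (P (b, j)) x = 0"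
        by (simp add: P_def \<mu>_def poly_sum poly_monom)
      then show False using x[OF b(1) jn nj] by simp
    qed
  qed
  have "inj_on pt (bases Z)"
    by (rule inj_onI) (use sub in \<open>metis subset_antisym\<close>)
  then show ?thesis using pt by blast
qed

text \<open>A spanning family of products \<open>zprod Z Y\<close> also spans the functions on the
  points attached to the bases, and these form a space of dimension \<open>card (bases Z)\<close>.
  The transfer works because products of vectors are homogeneous and the cocircuit relations hold on
  the points up to lower degree.\<close>

lemma card_bases_le:
  assumes G: "G \<subseteq> Pow {..<length Z}" and spans: "K.sub.spans UNIV (zprod Z) G"
  shows "card (bases Z) \<le> card G"
proof (rule ccontr)
  assume "\<not> card (bases Z) \<le> card G"
  have finG: "finite G" using G by (rule finite_subset) simp
  obtain pt :: "nat set \<Rightarrow> 'v \<Rightarrow> real" and \<mu>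
    where lin: "\<And>b. b \<in> bases Z \<Longrightarrow> linear (pt b)"
      and pt: "\<And>b i. b \<in> bases Z \<Longrightarrow> i \<in> b \<Longrightarrow> pt b (Z ! i) = \<mu> i"
      and inj: "inj_on pt (bases Z)"
    using generic_points by metis
  define ev where "ev b = poly_eval (\<lambda>v. of_real (pt b v))" for b
  define K' where "K' = {p. \<forall>b\<in>bases Z. ev b p = 0}"
  have ev_simps: "ev b (p + q) = ev b p + ev b q" "ev b (p - q) = ev b p - ev b q"
    "ev b (p * q) = ev b p * ev b q" "ev b 0 = 0" for b p q
    by (simp_all add: ev_def poly_eval_simps)
  interpret K': pm_ideal K'
    by unfold_locales (auto simp: K'_def ev_simps)
  \<comment> \<open>Polynomials each of whose homogeneous parts can be replaced by terms of lower
    degree modulo \<open>K'\<close>. They form an ideal, so it contains \<open>K_ideal Z\<close> as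
    soon as it contains the generators.\<close>
  let ?R = "{p. \<forall>n. \<exists>q. low n q \<and> hp n p - q \<in> K'}"
  have single_R: "single m c * p \<in> ?R" if p: "p \<in> ?R" for m c p
  proof safe
    fix n
    show "\<exists>q. low n q \<and> hp n (single m c * p) - q \<in> K'"
    proof (cases "tdeg m \<le> n")
      case True
      obtain q where q: "low (n - tdeg m) q" "hp (n - tdeg m) p - q \<in> K'"
        using spec[OF p[unfolded mem_Collect_eq], of "n - tdeg m"] by blast
      have "low n (single m c * q)"
        using low_single_mult[OF q(1), of m c] True by simp
      moreover have "hp n (single m c * p) - single m c * q \<in> K'"
        using K'.mult_mem[OF q(2), of "single m c"] True by (simp add: hp_single_mult right_diff_distrib)
      ultimately show ?thesis by blast
    next
      case False
      then show ?thesis using K'.zero_mem by (auto simp: hp_single_mult intro!: exI[of _ 0])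
    qed
  qed
  have R_add: "p + q \<in> ?R" if p: "p \<in> ?R" and q: "q \<in> ?R" for p q
  proof safe
    fix n
    obtain p' q' where "low n p'" "hp n p - p' \<in> K'" "low n q'" "hp n q - q' \<in> K'"
      using spec[OF p[unfolded mem_Collect_eq], of n] spec[OF q[unfolded mem_Collect_eq], of n]
      by blast
    then show "\<exists>r. low n r \<and> hp n (p + q) - r \<in> K'"
      using K'.add_mem[of "hp n p - p'" "hp n q - q'"] low_add[of n p' q']
      by (intro exI[of _ "p' + q'"]) (simp add: hp_add algebra_simps)
  qed
  have R_0: "0 \<in> ?R"
    using K'.zero_mem by (auto intro!: exI[of _ 0])
  have R_mult: "f * p \<in> ?R" if "p \<in> ?R" for f p
  proof (induction f rule: poly_mapping_additive_induct[where M = UNIV])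
    case (3 f g)
    then show ?case unfolding distrib_right by (rule R_add)
  qed (use R_0 single_R[OF that] in simp_all)
  have R: "pm_ideal ?R"
    by unfold_locales (use R_0 R_add R_mult in blast)+
  have homog_R: "p \<in> ?R" if "\<And>n. hp n p = (if n = k then p else 0)" "low k q" "p - q \<in> K'" for p q k
  proof safe
    fix n
    show "\<exists>q. low n q \<and> hp n p - q \<in> K'"
      using that K'.zero_mem by (cases "n = k") (auto intro: exI[of _ q] exI[of _ 0])
  qed
  have "linear_gens \<subseteq> ?R"
  proof
    fix p :: "('v \<Rightarrow>\<^sub>0 nat) \<Rightarrow>\<^sub>0 complex" assume p: "p \<in> linear_gens"
    then have "p \<in> K'"
      using lin by (auto simp: linear_gens_def K'_def ev_def poly_eval_simps linear_add linear_scale)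
    moreover have "hp n p = (if n = 1 then p else 0)" for n
      using p by (auto simp: linear_gens_def gen_var_def hp_diff hp_const_mult hp_single)
    ultimately show "p \<in> ?R"
      by (intro homog_R[of p 1 0]) auto
  qed
  moreover have "zprod Z Y \<in> ?R" if Y: "Y \<in> cocircuits Z" for Y
  proof -
    \<comment> \<open>The deformed product vanishes at every point, since \<open>Y\<close> meets
      every basis, and it differs from \<open>zprod Z Y\<close> only in lower degree.\<close>
    let ?z = "\<Prod>i\<in>Y. gen_var (Z ! i) - const (of_real (\<mu> i))"
    have finY: "finite Y" using Y cocircuit_finite by blast
    have "low (card Y) (zprod Z Y - ?z)"
      using finY
    proof (induction Y rule: finite_induct)
      case empty
      show ?case by (simp add: zprod_def)
    next
      case (insert i Y)
      let ?z = "\<Prod>i\<in>Y. gen_var (Z ! i) - const (of_real (\<mu> i))"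
      have "zprod Z (insert i Y) - (gen_var (Z ! i) - const (of_real (\<mu> i))) * ?z
          = single (single (Z ! i) 1) 1 * (zprod Z Y - ?z) + single 0 (- of_real (\<mu> i)) * (zprod Z Y - ?z)
            + single 0 (of_real (\<mu> i)) * zprod Z Y"
        using insert by (simp add: zprod_def gen_var_def const_def single_uminus algebra_simps)
      moreover have "low (Suc (card Y)) (single (single (Z ! i) 1) 1 * (zprod Z Y - ?z))"
        using low_single_mult[OF insert.IH, of "single (Z ! i) 1" 1] by simp
      moreover have "low (Suc (card Y)) (single 0 (- of_real (\<mu> i)) * (zprod Z Y - ?z))"
        using low_single_mult[OF insert.IH, of 0 "- of_real (\<mu> i)"] by (auto intro: low_mono)
      moreover have "low (Suc (card Y)) (zprod Z Y)"
        by (auto simp: low_def zprod_eq_single tdeg_sum)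
      then have "low (Suc (card Y)) (single 0 (of_real (\<mu> i)) * zprod Z Y)"
        using low_single_mult[of "Suc (card Y)" "zprod Z Y" 0 "of_real (\<mu> i)"] by simp
      ultimately show ?case
        using insert by (simp add: low_add)
    qed
    moreover have "?z \<in> K'"
    proof -
      have "ev b ?z = 0" if b: "b \<in> bases Z" for b
      proof -
        have "Y \<inter> b \<noteq> {}"
        proof
          assume "Y \<inter> b = {}"
          then have "(!) Z ` b \<subseteq> (!) Z ` ({..<length Z} - Y)"
            using b by (auto simp: bases_def)
          then have "span ((!) Z ` ({..<length Z} - Y)) = UNIV"
            using b span_mono[of "(!) Z ` b"] by (auto simp: bases_def)
          then show False using Y by (simp add: cocircuits_def)
        qed
        then obtain i where i: "i \<in> Y" "i \<in> b" by auto
        have "ev b ?z = (\<Prod>i\<in>Y. of_real (pt b (Z ! i)) - of_real (\<mu> i))"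
          by (simp add: ev_def poly_eval_simps)
        also have "\<dots> = 0"
          using finY i pt[OF b] by (intro prod_zero) auto
        finally show ?thesis .
      qed
      then show ?thesis by (simp add: K'_def)
    qed
    ultimately show ?thesis
      by (intro homog_R[of _ "card Y" "zprod Z Y - ?z"]) (simp_all add: hp_zprod)
  qed
  ultimately have KR: "K_ideal Z \<subseteq> ?R"
    by (rule K_minimal[OF R])
  \<comment> \<open>Induction on the degree: the top part is expressed through \<open>G\<close> at
    the cost of an error of lower degree, which is absorbed into the remainder.\<close>
  have spans': "\<exists>c. p - comb c (zprod Z) G \<in> K'" if "low n p" for n p
    using that
  proof (induction n arbitrary: p)
    case 0
    then show ?case
      using K'.zero_mem by (auto simp: low_0_iff comb_def intro!: exI[of _ "\<lambda>_. 0"])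
  next
    case (Suc n)
    obtain c where c: "hp n p - comb c (zprod Z) G \<in> K_ideal Z"
      using spans by (auto simp: K.sub.spans_def span_mod_def)
    then obtain q where q: "low n q" "hp n (hp n p - comb c (zprod Z) G) - q \<in> K'"
      using KR by blast
    \<comment> \<open>\<open>zprod Z Y\<close> is homogeneous of degree \<open>card Y\<close>, so
      taking the part of degree \<open>n\<close> retains exactly the index sets of that
      size.\<close>
    define c' where "c' Y = (if card Y = n then c Y else 0)" for Y
    have c': "hp n (comb c (zprod Z) G) = comb c' (zprod Z) G"
      unfolding comb_def hp_sum hp_const_mult hp_zprod by (intro sum.cong) (auto simp: c'_def)
    have "low n (p - hp n p + q)"
      using low_add[OF low_diff_hp[OF Suc.prems] q(1)] .
    then obtain d where d: "p - hp n p + q - comb d (zprod Z) G \<in> K'"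
      using Suc.IH by blast
    have "p - comb (\<lambda>Y. c' Y + d Y) (zprod Z) G \<in> K'"
      using K'.add_mem[OF q(2) d]
      by (simp add: hp_diff hp_hp c', simp add: comb_def const_add distrib_right sum.distrib algebra_simps)
    then show ?case by (rule exI[of _ "\<lambda>Y. c' Y + d Y"])
  qed
  \<comment> \<open>If \<open>G\<close> has fewer than \<open>card (bases Z)\<close> elements, some
    nontrivial combination of the point evaluations vanishes on \<open>G\<close>, and by
    \<open>spans'\<close> it then vanishes on all polynomials.\<close>
  obtain e where e: "\<exists>b\<in>bases Z. e b \<noteq> 0" "\<And>Y. Y \<in> G \<Longrightarrow> (\<Sum>b\<in>bases Z. e b * ev b (zprod Z Y)) = 0"
    using homogeneous_system[OF finG bases_finite[of Z], where A = "\<lambda>b Y. ev b (zprod Z Y)"]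
      \<open>\<not> card (bases Z) \<le> card G\<close> by auto
  have all0: "(\<Sum>b\<in>bases Z. e b * ev b p) = 0" for p
  proof -
    obtain n where "low n p" using low_exists by blast
    then obtain c where c: "p - comb c (zprod Z) G \<in> K'" using spans' by blast
    have "(\<Sum>b\<in>bases Z. e b * ev b p) = (\<Sum>b\<in>bases Z. e b * ev b (comb c (zprod Z) G))"
      using c by (intro sum.cong) (auto simp: K'_def ev_simps)
    also have "\<dots> = (\<Sum>b\<in>bases Z. \<Sum>Y\<in>G. c Y * (e b * ev b (zprod Z Y)))"
      by (simp add: comb_def ev_def poly_eval_simps sum_distrib_left mult_ac)
    also have "\<dots> = (\<Sum>Y\<in>G. c Y * (\<Sum>b\<in>bases Z. e b * ev b (zprod Z Y)))"
      by (subst sum.swap) (simp add: sum_distrib_left)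
    also have "\<dots> = 0"
      using e(2) by simp
    finally show ?thesis .
  qed
  obtain b where b: "b \<in> bases Z" "e b \<noteq> 0" using e(1) by auto
  have "\<exists>v. pt b' v \<noteq> pt b v" if "b' \<in> bases Z - {b}" for b'
    using that inj b(1) by (auto dest: inj_onD)
  then obtain v where v: "\<And>b'. b' \<in> bases Z - {b} \<Longrightarrow> pt b' (v b') \<noteq> pt b (v b')"
    by metis
  \<comment> \<open>An interpolation polynomial: for each basis other than \<open>b\<close> one
    factor vanishes at its point but not at the point of \<open>b\<close>.\<close>
  define p where "p = (\<Prod>b'\<in>bases Z - {b}. gen_var (v b') - const (of_real (pt b' (v b'))))"
  have ev_p: "ev b'' p = (\<Prod>b'\<in>bases Z - {b}. of_real (pt b'' (v b')) - of_real (pt b' (v b')))" for b''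
    by (simp add: p_def ev_def poly_eval_simps)
  have "ev b' p = 0" if "b' \<in> bases Z - {b}" for b'
    unfolding ev_p using bases_finite[of Z] that by (intro prod_zero) auto
  then have "(\<Sum>b\<in>bases Z. e b * ev b p) = e b * ev b p"
    using bases_finite[of Z] b(1) by (subst sum.remove) auto
  moreover have "ev b p \<noteq> 0"
  proof
    assume "ev b p = 0"
    then obtain b' where "b' \<in> bases Z - {b}" "pt b (v b') = pt b' (v b')"
      using bases_finite[of Z] unfolding ev_p by (auto simp: prod_zero_iff)
    then show False using v[of b'] by simp
  qed
  ultimately show False
    using all0[of p] b(2) by simp
qed

text \<open>A minimal spanning subfamily is independent, and the lower bound applies to it.\<close>

lemma A_basis:
  "\<exists>G\<subseteq>Pow {..<length Z}. card (bases Z) \<le> card G \<and> K.sub.indep (zprod Z) G"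
  using K.sub.spans_minimal[OF _ zprod_spans] card_bases_le by auto

end

section \<open>Characters of finite quotients of a lattice\<close>

locale add_subgroup =
  fixes G :: "'v::real_vector set"
  assumes zero_G: "0 \<in> G" and diff_G: "a \<in> G \<Longrightarrow> b \<in> G \<Longrightarrow> a - b \<in> G"
begin

lemma uminus_G: "a \<in> G \<Longrightarrow> - a \<in> G"
  using diff_G[of 0 a] zero_G by simp

lemma add_G: "a \<in> G \<Longrightarrow> b \<in> G \<Longrightarrow> a + b \<in> G"
  using diff_G[of a "- b"] uminus_G by simp

lemma nat_scale_G: "a \<in> G \<Longrightarrow> real n *\<^sub>R a \<in> G"
  by (induction n) (auto simp: zero_G add_G scaleR_add_left)

lemma int_scale_G: "a \<in> G \<Longrightarrow> of_int k *\<^sub>R a \<in> G"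
  using nat_scale_G[of a "nat \<bar>k\<bar>"] uminus_G[of "real (nat \<bar>k\<bar>) *\<^sub>R a"]
  by (cases "k \<ge> 0") auto

lemma sum_G: "(\<And>i. i \<in> I \<Longrightarrow> f i \<in> G) \<Longrightarrow> sum f I \<in> G"
  by (induction I rule: infinite_finite_induct) (auto simp: zero_G add_G)

lemma closure_subset: "S \<subseteq> G \<Longrightarrow> group_closure S \<subseteq> G"
proof
  fix x assume "S \<subseteq> G" "x \<in> group_closure S"
  then show "x \<in> G"
    by (induction rule: group_closure.induct[OF \<open>x \<in> group_closure S\<close>]) (auto simp: zero_G diff_G)
qed

lemma coset_eq_iff: "(+) a ` G = (+) b ` G \<longleftrightarrow> a - b \<in> G"
proof
  assume "(+) a ` G = (+) b ` G"
  then have "a \<in> (+) b ` G" using zero_G by force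
  then show "a - b \<in> G" by auto
next
  assume ab: "a - b \<in> G"
  show "(+) a ` G = (+) b ` G"
  proof (intro equalityI subsetI)
    fix x assume "x \<in> (+) a ` G"
    then obtain g where "g \<in> G" "x = b + ((a - b) + g)" by (auto simp: algebra_simps)
    then show "x \<in> (+) b ` G" using add_G[OF ab] by blast
  next
    fix x assume "x \<in> (+) b ` G"
    then obtain g where "g \<in> G" "x = a + (g - (a - b))" by (auto simp: algebra_simps)
    then show "x \<in> (+) a ` G" using diff_G[OF _ ab] by blast
  qed
qed

end

lemma add_subgroup_closure: "add_subgroup (group_closure S)"
  by unfold_locales (auto intro: group_closure.diff)

lemma group_closure_superset: "S \<subseteq> group_closure S"
  by (auto intro: group_closure.base)

definition cosets :: "'v::real_vector set \<Rightarrow> 'v set \<Rightarrow> 'v set set" where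
  "cosets G M = (\<lambda>a. (+) a ` M) ` G"

text \<open>These are the characters of the quotient \<open>G / M\<close>, pulled back to
  \<open>G\<close>.\<close>

definition characters :: "'v::real_vector set \<Rightarrow> 'v set \<Rightarrow> ('v \<Rightarrow> complex) set" where
  "characters G M = {t \<in> torus G. \<forall>m\<in>M. t m = 1}"

context add_subgroup
begin

lemma torus_simps:
  assumes "t \<in> torus G"
  shows "a \<in> G \<Longrightarrow> t a \<noteq> 0" "a \<in> G \<Longrightarrow> b \<in> G \<Longrightarrow> t (a + b) = t a * t b" "t 0 = 1"
    "a \<in> G \<Longrightarrow> t (- a) = inverse (t a)" "a \<in> G \<Longrightarrow> b \<in> G \<Longrightarrow> t (a - b) = t a / t b"
proof -
  show nz: "t a \<noteq> 0" if "a \<in> G" for a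
    using assms that by (auto simp: torus_def PiE_iff)
  show add: "t (a + b) = t a * t b" if "a \<in> G" "b \<in> G" for a b
    using assms that by (auto simp: torus_def)
  show one: "t 0 = 1"
    using add[OF zero_G zero_G] nz[OF zero_G] by simp
  show neg: "t (- a) = inverse (t a)" if "a \<in> G" for a
    using add[OF that uminus_G[OF that]] one nz[OF that] by (simp add: field_simps)
  show "t (a - b) = t a / t b" if "a \<in> G" "b \<in> G" for a b
    using add[OF that(1) uminus_G[OF that(2)]] neg[OF that(2)] by (simp add: divide_inverse)
qed

lemma torus_nat_scale:
  assumes "t \<in> torus G" "a \<in> G"
  shows "t (real n *\<^sub>R a) = t a ^ n"
  by (induction n)
     (use assms in \<open>simp_all add: torus_simps scaleR_add_left nat_scale_G\<close>)

lemma torus_int_scale: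
  assumes "t \<in> torus G" "a \<in> G"
  shows "t (of_int k *\<^sub>R a) = t a powi k"
proof (cases "k \<ge> 0")
  case True
  then show ?thesis
    using torus_nat_scale[OF assms, of "nat k"] by (simp add: power_int_def)
next
  case False
  then have eq: "of_int k *\<^sub>R a = - (real (nat (- k)) *\<^sub>R a)" by simp
  have "t (of_int k *\<^sub>R a) = inverse (t a ^ nat (- k))"
    by (simp only: eq torus_simps(4)[OF assms(1) nat_scale_G[OF assms(2)]] torus_nat_scale[OF assms])
  then show ?thesis
    using False by (simp add: power_int_def power_inverse)
qed

end

text \<open>Adjoining one element \<open>v\<close> to a group \<open>N \<supseteq> M\<close> multiplies both the index of \<open>M\<close> and the number of
  characters trivial on \<open>M\<close> by the order \<open>k\<close> of \<open>v\<close> modulo \<open>N\<close>.\<close>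

locale cyclic_extension =
  M: add_subgroup M + N: add_subgroup N + N': add_subgroup N'
  for M N N' :: "'v::real_vector set" +
  fixes v :: 'v and k :: nat
  assumes MN: "M \<subseteq> N" and N'_def: "N' = {n + of_int j *\<^sub>R v | n j. n \<in> N}"
    and k_pos: "k > 0" and kv: "real k *\<^sub>R v \<in> N"
    and k_min: "\<And>j. 0 < j \<Longrightarrow> j < k \<Longrightarrow> real j *\<^sub>R v \<notin> N"
begin

lemma NN': "N \<subseteq> N'"
proof
  fix n assume "n \<in> N"
  then have "n + of_int 0 *\<^sub>R v \<in> N'" unfolding N'_def by blast
  then show "n \<in> N'" by simp
qed

lemma v_N': "v \<in> N'"
proof -
  have "0 + of_int 1 *\<^sub>R v \<in> N'" unfolding N'_def using N.zero_G by blast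
  then show ?thesis by simp
qed

text \<open>Division of \<open>j\<close> by \<open>k\<close>: the remainder gives a multiple of
  \<open>v\<close> in \<open>N\<close> below the \<open>k\<close>-th one, so minimality of
  \<open>k\<close> makes it zero.\<close>

lemma multiple_in_N_iff: "of_int j *\<^sub>R v \<in> N \<longleftrightarrow> int k dvd j"
proof
  assume j: "of_int j *\<^sub>R v \<in> N"
  define r where "r = nat (j mod int k)"
  have r: "r < k" "int r = j mod int k"
    using k_pos by (simp_all add: r_def nat_less_iff)
  have "real r = of_int (j mod int k)"
    using r(2) by (metis of_int_of_nat_eq)
  also have "j mod int k = j - (j div int k) * int k"
    by (simp add: minus_div_mult_eq_mod)
  finally have "real r *\<^sub>R v = of_int j *\<^sub>R v - of_int (j div int k) *\<^sub>R (real k *\<^sub>R v)"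
    by (simp add: scaleR_left_diff_distrib)
  also have "\<dots> \<in> N"
    by (intro N.diff_G N.int_scale_G j kv)
  finally have "r = 0" using k_min[of r] r by auto
  then show "int k dvd j" using r by (simp add: dvd_eq_mod_eq_0)
next
  assume "int k dvd j"
  then obtain q where "j = int k * q" by auto
  then have eq: "of_int j *\<^sub>R v = of_int q *\<^sub>R (real k *\<^sub>R v)" by (simp add: mult.commute)
  show "of_int j *\<^sub>R v \<in> N" unfolding eq by (rule N.int_scale_G[OF kv])
qed

text \<open>Modulo \<open>N\<close>, the elements of \<open>N'\<close> are the multiples
  \<open>j v\<close> with a unique \<open>0 \<le> j < k\<close>; the uniqueness comes from
  \<open>multiple_in_N_iff\<close>.\<close>

lemma bij_cosets:
  "bij_betw (\<lambda>(j, C). (+) (real j *\<^sub>R v) ` C) ({..<k} \<times> cosets N M) (cosets N' M)"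
proof -
  have img: "(+) (real j *\<^sub>R v) ` (+) n ` M = (+) (n + real j *\<^sub>R v) ` M" for j n
    by (auto simp: image_image ac_simps)
  show ?thesis
  proof (rule bij_betwI')
    fix x y assume "x \<in> {..<k} \<times> cosets N M" "y \<in> {..<k} \<times> cosets N M"
    then obtain j n j' n' where x: "x = (j, (+) n ` M)" "j < k" "n \<in> N"
      and y: "y = (j', (+) n' ` M)" "j' < k" "n' \<in> N"
      by (auto simp: cosets_def)
    show "(case x of (j, C) \<Rightarrow> (+) (real j *\<^sub>R v) ` C) = (case y of (j, C) \<Rightarrow> (+) (real j *\<^sub>R v) ` C) \<longleftrightarrow> x = y"
    proof
      assume "(case x of (j, C) \<Rightarrow> (+) (real j *\<^sub>R v) ` C) = (case y of (j, C) \<Rightarrow> (+) (real j *\<^sub>R v) ` C)"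
      then have d: "(n + real j *\<^sub>R v) - (n' + real j' *\<^sub>R v) \<in> M"
        unfolding x y by (simp add: img M.coset_eq_iff)
      then have "((n + real j *\<^sub>R v) - (n' + real j' *\<^sub>R v)) - (n - n') \<in> N"
        by (rule N.diff_G[OF subsetD[OF MN] N.diff_G[OF x(3) y(3)]])
      also have "((n + real j *\<^sub>R v) - (n' + real j' *\<^sub>R v)) - (n - n') = of_int (int j - int j') *\<^sub>R v"
        by (simp add: scaleR_left_diff_distrib)
      finally have "int k dvd int j - int j'"
        by (simp only: multiple_in_N_iff)
      then have "int j - int j' = 0"
        using x(2) y(2) dvd_imp_le_int[of "int j - int j'" "int k"] by linarith
      then have "j = j'" by simp
      then show "x = y" using d by (simp add: x y M.coset_eq_iff)
    qed auto
  next
    fix x assume "x \<in> {..<k} \<times> cosets N M"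
    then obtain j n where x: "x = (j, (+) n ` M)" "n \<in> N" by (auto simp: cosets_def)
    then have "n + of_int (int j) *\<^sub>R v \<in> N'" unfolding N'_def by blast
    then show "(case x of (j, C) \<Rightarrow> (+) (real j *\<^sub>R v) ` C) \<in> cosets N' M"
      by (auto simp: x img cosets_def)
  next
    fix D assume "D \<in> cosets N' M"
    then obtain n j where D: "n \<in> N" "D = (+) (n + of_int j *\<^sub>R v) ` M"
      by (auto simp: cosets_def N'_def)
    define r where "r = nat (j mod int k)"
    have r: "r < k" "int r = j mod int k"
      using k_pos by (simp_all add: r_def nat_less_iff)
    define n' where "n' = n + of_int (j - int r) *\<^sub>R v"
    have "n' \<in> N"
      unfolding n'_def using D(1) r by (intro N.add_G) (simp_all add: multiple_in_N_iff del: of_int_diff)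
    moreover have "n + of_int j *\<^sub>R v = n' + real r *\<^sub>R v"
      by (simp add: n'_def scaleR_left_diff_distrib)
    ultimately show "\<exists>x\<in>{..<k} \<times> cosets N M. D = (case x of (j, C) \<Rightarrow> (+) (real j *\<^sub>R v) ` C)"
      using r by (intro bexI[of _ "(r, (+) n' ` M)"]) (auto simp: D img cosets_def)
  qed
qed

text \<open>The value at \<open>n + j v\<close> must be \<open>t n * z powi j\<close>. This is well
  defined because \<open>n + j v = 0\<close> forces \<open>k\<close> to divide \<open>j\<close>, and
  then the condition on \<open>z ^ k\<close> applies.\<close>

lemma extend_character:
  assumes t: "t \<in> torus N" and z: "z ^ k = t (real k *\<^sub>R v)"
  shows "\<exists>t'\<in>torus N'. restrict t' N = t \<and> t' v = z"
proof -
  have z0: "z \<noteq> 0"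
    using z N.torus_simps(1)[OF t kv] k_pos by (auto simp: power_0_left)
  have ker: "t n * z powi j = 1" if n: "n \<in> N" and 0: "n + of_int j *\<^sub>R v = 0" for n j
  proof -
    have nj: "n = - (of_int j *\<^sub>R v)" using 0 by (simp add: eq_neg_iff_add_eq_0)
    then have "of_int j *\<^sub>R v \<in> N" using N.uminus_G[OF n] by simp
    then obtain q where q: "j = int k * q" by (auto simp: multiple_in_N_iff)
    have "n = of_int (- q) *\<^sub>R (real k *\<^sub>R v)" by (simp add: nj q mult.commute)
    then have "t n = (z ^ k) powi (- q)"
      using N.torus_int_scale[OF t kv] z by metis
    then show ?thesis
      using z0 by (simp add: q power_int_mult power_int_minus)
  qed
  have wd: "t n * z powi j = t n' * z powi j'"
    if "n \<in> N" "n' \<in> N" "n + of_int j *\<^sub>R v = n' + of_int j' *\<^sub>R v" for n n' j j'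
  proof -
    have "t (n - n') * z powi (j - j') = 1"
      using that by (intro ker N.diff_G) (simp_all add: algebra_simps)
    then show ?thesis
      using that z0 N.torus_simps[OF t] by (simp add: power_int_diff field_simps)
  qed
  have "\<exists>c. \<forall>n\<in>N. \<forall>j. w = n + of_int j *\<^sub>R v \<longrightarrow> c = t n * z powi j" for w
  proof (cases "\<exists>n\<in>N. \<exists>j. w = n + of_int j *\<^sub>R v")
    case True
    then obtain n j where "n \<in> N" "w = n + of_int j *\<^sub>R v" by auto
    then show ?thesis using wd by (intro exI[of _ "t n * z powi j"]) auto
  qed auto
  then obtain f where f: "\<And>n j. n \<in> N \<Longrightarrow> f (n + of_int j *\<^sub>R v) = t n * z powi j"
    by metis
  define t' where "t' = restrict f N'"
  have t': "t' (n + of_int j *\<^sub>R v) = t n * z powi j" if "n \<in> N" for n j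
    using f[OF that] that unfolding t'_def N'_def by auto
  have "t' \<in> torus N'"
    unfolding torus_def
  proof (intro CollectI conjI ballI)
    show "t' \<in> N' \<rightarrow>\<^sub>E UNIV - {0}"
    proof (rule PiE_I)
      fix w assume "w \<in> N'"
      then show "t' w \<in> UNIV - {0}"
        using t' z0 N.torus_simps(1)[OF t] by (auto simp: N'_def)
    qed (simp add: t'_def)
    fix a b assume "a \<in> N'" "b \<in> N'"
    then obtain n i m j where a: "n \<in> N" "a = n + of_int i *\<^sub>R v" and b: "m \<in> N" "b = m + of_int j *\<^sub>R v"
      unfolding N'_def by auto
    have ab: "a + b = (n + m) + of_int (i + j) *\<^sub>R v" by (simp add: a b scaleR_add_left)
    have "t' (a + b) = t (n + m) * z powi (i + j)"
      unfolding ab by (rule t'[OF N.add_G[OF a(1) b(1)]])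
    then show "t' (a + b) = t' a * t' b"
      using a b t' z0 N.torus_simps(2)[OF t] by (simp add: power_int_add)
  qed
  moreover have "restrict t' N = t"
  proof (rule ext)
    fix n
    show "restrict t' N n = t n"
      using t'[of n 0] t by (cases "n \<in> N") (auto simp: torus_def PiE_def extensional_def)
  qed
  moreover have "t' v = z"
    using t'[OF N.zero_G, of 1] N.torus_simps(3)[OF t] by simp
  ultimately show ?thesis by blast
qed

lemma torus_N'_eqI:
  assumes "t \<in> torus N'" "u \<in> torus N'" "restrict t N = restrict u N" "t v = u v"
  shows "t = u"
proof (rule ext)
  fix w
  show "t w = u w"
  proof (cases "w \<in> N'")
    case True
    then obtain n j where w: "n \<in> N" "w = n + of_int j *\<^sub>R v" unfolding N'_def by auto
    have "n \<in> N'" using w NN' by auto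
    then have *: "x w = x n * x v powi j" if "x \<in> torus N'" for x
      using N'.torus_simps(2)[OF that _ N'.int_scale_G[OF v_N']] N'.torus_int_scale[OF that v_N']
      by (simp add: w)
    have "t n = u n" using assms(3) w by (metis restrict_apply')
    then show ?thesis using *[OF assms(1)] *[OF assms(2)] assms(4) by simp
  qed (use assms in \<open>auto simp: torus_def PiE_def extensional_def\<close>)
qed

text \<open>The value at \<open>v\<close> is free except that its \<open>k\<close>-th power is
  prescribed by the restriction to \<open>N\<close>.\<close>

lemma bij_characters:
  "bij_betw (\<lambda>t. (restrict t N, t v)) (characters N' M)
     (SIGMA t:characters N M. {z. z ^ k = t (real k *\<^sub>R v)})"
proof (rule bij_betwI')
  fix t u assume tu: "t \<in> characters N' M" "u \<in> characters N' M"
  show "(restrict t N, t v) = (restrict u N, u v) \<longleftrightarrow> t = u"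
    using tu torus_N'_eqI[of t u] by (auto simp: characters_def)
next
  fix t assume t: "t \<in> characters N' M"
  then have tt: "t \<in> torus N'" by (simp add: characters_def)
  have "restrict t N \<in> torus N"
    unfolding torus_def
  proof (intro CollectI conjI ballI)
    show "restrict t N \<in> N \<rightarrow>\<^sub>E UNIV - {0}"
      using N'.torus_simps(1)[OF tt] NN' by auto
    fix a b assume "a \<in> N" "b \<in> N"
    then show "restrict t N (a + b) = restrict t N a * restrict t N b"
      using N.add_G N'.torus_simps(2)[OF tt subsetD[OF NN'] subsetD[OF NN']] by auto
  qed
  then show "(restrict t N, t v) \<in> (SIGMA t:characters N M. {z. z ^ k = t (real k *\<^sub>R v)})"
    using t MN kv N'.torus_nat_scale[OF tt v_N'] by (auto simp: characters_def)
next
  fix p assume "p \<in> (SIGMA t:characters N M. {z. z ^ k = t (real k *\<^sub>R v)})"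
  then obtain t z where p: "p = (t, z)" "t \<in> characters N M" "z ^ k = t (real k *\<^sub>R v)" by auto
  then obtain t' where t': "t' \<in> torus N'" "restrict t' N = t" "t' v = z"
    using extend_character[of t z] by (auto simp: characters_def)
  then have "t' m = 1" if "m \<in> M" for m
  proof -
    have "t' m = restrict t' N m" using that MN by auto
    then show ?thesis using t'(2) p(2) that by (simp add: characters_def)
  qed
  then show "\<exists>t\<in>characters N' M. p = (restrict t N, t v)"
    using t' p by (intro bexI[of _ t']) (auto simp: characters_def)
qed

text \<open>A nonzero complex number has exactly \<open>k\<close> roots of order \<open>k\<close>,
  so the number of characters and the number of cosets are both multiplied by
  \<open>k\<close>.\<close>

lemma card_extension:
  assumes "finite (characters N M)" "card (characters N M) = card (cosets N M)"
  shows "finite (characters N' M)" "card (characters N' M) = card (cosets N' M)"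
proof -
  have roots: "finite {z. z ^ k = t (real k *\<^sub>R v)}" "card {z. z ^ k = t (real k *\<^sub>R v)} = k"
    if "t \<in> characters N M" for t
  proof -
    have "t (real k *\<^sub>R v) \<noteq> 0"
      using that kv N.torus_simps(1) by (auto simp: characters_def)
    then show "card {z. z ^ k = t (real k *\<^sub>R v)} = k"
      using k_pos by (intro card_nth_roots) auto
    then show "finite {z. z ^ k = t (real k *\<^sub>R v)}"
      using k_pos card_ge_0_finite by fastforce
  qed
  let ?S = "SIGMA t:characters N M. {z. z ^ k = t (real k *\<^sub>R v)}"
  have "finite ?S" using assms roots by (intro finite_SigmaI) auto
  then show "finite (characters N' M)" using bij_betw_finite[OF bij_characters] by simp
  have "card (characters N' M) = card ?S" by (rule bij_betw_same_card[OF bij_characters])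
  also have "\<dots> = (\<Sum>t\<in>characters N M. card {z. z ^ k = t (real k *\<^sub>R v)})"
    using assms roots by (intro card_SigmaI) auto
  also have "\<dots> = card (characters N M) * k" using roots by simp
  also have "\<dots> = card ({..<k} \<times> cosets N M)" using assms by (simp add: card_cartesian_product)
  also have "\<dots> = card (cosets N' M)" by (rule bij_betw_same_card[OF bij_cosets])
  finally show "card (characters N' M) = card (cosets N' M)" .
qed

end

lemma group_closure_mono: "S \<subseteq> T \<Longrightarrow> group_closure S \<subseteq> group_closure T"
  for S T :: "'v::real_vector set"
  using add_subgroup.closure_subset[OF add_subgroup_closure, of S T] group_closure_superset[of T] by blast

lemma group_closure_insert:
  fixes S :: "'v::real_vector set"
  shows "group_closure (insert v S) = {n + of_int j *\<^sub>R v | n j. n \<in> group_closure S}" (is "?L = ?R")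
proof
  interpret L: add_subgroup ?L by (rule add_subgroup_closure)
  interpret S: add_subgroup "group_closure S" by (rule add_subgroup_closure)
  have "v \<in> ?L" using group_closure_superset[of "insert v S"] by auto
  moreover have "group_closure S \<subseteq> ?L" by (rule group_closure_mono) auto
  ultimately show "?R \<subseteq> ?L" by (auto intro!: L.add_G L.int_scale_G)
  interpret R: add_subgroup ?R
  proof
    show "0 \<in> ?R" using S.zero_G by (auto intro!: exI[of _ 0])
    fix a b assume "a \<in> ?R" "b \<in> ?R"
    then obtain n i m j where ab: "n \<in> group_closure S" "a = n + of_int i *\<^sub>R v"
      "m \<in> group_closure S" "b = m + of_int j *\<^sub>R v" by auto
    then have "a - b = (n - m) + of_int (i - j) *\<^sub>R v" by (simp add: scaleR_left_diff_distrib)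
    then show "a - b \<in> ?R" using ab S.diff_G by blast
  qed
  have "v = 0 + of_int 1 *\<^sub>R v" by simp
  then have "v \<in> ?R" using S.zero_G by blast
  moreover have "s \<in> ?R" if "s \<in> S" for s
  proof -
    have "s = s + of_int 0 *\<^sub>R v" by simp
    then show ?thesis using that group_closure_superset[of S] by blast
  qed
  ultimately show "?L \<subseteq> ?R" by (intro R.closure_subset) auto
qed

text \<open>The generators in \<open>B\<close> are adjoined to \<open>M\<close> one at a time.
  Finite index guarantees that each has finite order modulo the group reached so far, as
  \<open>cyclic_extension\<close> demands.\<close>

lemma card_characters:
  assumes G: "add_subgroup G" and M: "add_subgroup M" and fin: "finite (cosets G M)"
    and MG: "M \<subseteq> G" and B: "finite B" "B \<subseteq> G" "G \<subseteq> group_closure (M \<union> B)"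
  shows "finite (characters G M)" "card (characters G M) = card (cosets G M)"
proof -
  interpret G: add_subgroup G by fact
  interpret M: add_subgroup M by fact
  have "finite (characters (group_closure (M \<union> B)) M) \<and>
      card (characters (group_closure (M \<union> B)) M) = card (cosets (group_closure (M \<union> B)) M)"
    using B(1,2)
  proof (induction B rule: finite_induct)
    case empty
    have eq: "group_closure (M \<union> {}) = M"
      using M.closure_subset[of M] group_closure_superset[of M] by auto
    have "characters M M = {\<lambda>m\<in>M. 1}"
    proof (intro equalityI subsetI)
      fix t assume t: "t \<in> characters M M"
      have "t = (\<lambda>m\<in>M. 1)"
      proof (rule ext)
        fix m show "t m = (\<lambda>m\<in>M. 1) m"
          using t by (cases "m \<in> M") (auto simp: characters_def torus_def PiE_def extensional_def)
      qed
      then show "t \<in> {\<lambda>m\<in>M. 1}" by simp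
    qed (auto simp: characters_def torus_def M.add_G)
    moreover have "cosets M M = {M}"
    proof -
      have "(+) m ` M = (+) 0 ` M" if "m \<in> M" for m
        unfolding M.coset_eq_iff using that by simp
      then show ?thesis using M.zero_G by (auto simp: cosets_def)
    qed
    ultimately show ?case unfolding eq by simp
  next
    case (insert v B)
    let ?N = "group_closure (M \<union> B)" and ?N' = "group_closure (M \<union> insert v B)"
    interpret N: add_subgroup ?N by (rule add_subgroup_closure)
    interpret N': add_subgroup ?N' by (rule add_subgroup_closure)
    have v: "v \<in> G" using insert.prems by simp
    \<comment> \<open>By the pigeonhole principle two multiples of \<open>v\<close> share a coset of
      \<open>M\<close>; their difference is a positive multiple of \<open>v\<close> in
      \<open>M\<close>, up to sign.\<close>
    have "range (\<lambda>j::nat. (+) (real j *\<^sub>R v) ` M) \<subseteq> cosets G M"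
      using G.nat_scale_G[OF v] by (auto simp: cosets_def)
    then have "finite (range (\<lambda>j::nat. (+) (real j *\<^sub>R v) ` M))"
      using fin finite_subset by blast
    then have "\<not> inj (\<lambda>j::nat. (+) (real j *\<^sub>R v) ` M)"
      using finite_imageD infinite_UNIV_nat by blast
    then obtain i j where ij: "i \<noteq> j" "(+) (real i *\<^sub>R v) ` M = (+) (real j *\<^sub>R v) ` M"
      by (auto simp: inj_def)
    have "\<exists>k>0. real k *\<^sub>R v \<in> ?N"
    proof -
      have *: "real (max i j - min i j) *\<^sub>R v \<in> M"
        using ij(2) M.coset_eq_iff[of "real i *\<^sub>R v" "real j *\<^sub>R v"] M.coset_eq_iff[of "real j *\<^sub>R v" "real i *\<^sub>R v"]
        by (cases "i < j") (auto simp: max_def min_def of_nat_diff scaleR_left_diff_distrib)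
      moreover have "M \<subseteq> ?N" using group_closure_superset[of "M \<union> B"] by auto
      ultimately show ?thesis using ij(1) by (intro exI[of _ "max i j - min i j"]) (auto simp: max_def min_def)
    qed
    then have k: "\<exists>k. 0 < k \<and> real k *\<^sub>R v \<in> ?N" by auto
    define k where "k = (LEAST k. 0 < k \<and> real k *\<^sub>R v \<in> ?N)"
    have kk: "0 < k \<and> real k *\<^sub>R v \<in> ?N" unfolding k_def using LeastI_ex[OF k] by simp
    interpret cyclic_extension M ?N ?N' v k
    proof
      show "M \<subseteq> ?N" using group_closure_superset[of "M \<union> B"] by auto
      show "?N' = {n + of_int j *\<^sub>R v | n j. n \<in> ?N}"
        using group_closure_insert[of v "M \<union> B"] by simp
      show "real j *\<^sub>R v \<notin> ?N" if "0 < j" "j < k" for j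
        using not_less_Least[of j "\<lambda>k. 0 < k \<and> real k *\<^sub>R v \<in> ?N"] that unfolding k_def by auto
    qed (use kk in auto)
    show ?case using insert card_extension by simp
  qed
  moreover have "group_closure (M \<union> B) = G"
    using B MG G.closure_subset[of "M \<union> B"] by auto
  ultimately show "finite (characters G M)" "card (characters G M) = card (cosets G M)" by simp_all
qed

text \<open>Every coset has a representative among the combinations of \<open>S\<close> with
  coefficients in the unit interval. Lattice points of this bounded set have bounded integer
  coordinates with respect to a lattice basis, so there are finitely many.\<close>

lemma finite_index:
  assumes lat: "spanning_lattice \<Lambda>" and S: "finite S" "S \<subseteq> \<Lambda>" "span S = UNIV"
  shows "finite (cosets \<Lambda> (group_closure S))"
proof -
  obtain B where B: "finite B" "independent B" "span B = UNIV" and L: "\<Lambda> = group_closure B"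
    using lat by (auto simp: spanning_lattice_def)
  interpret L: add_subgroup \<Lambda> unfolding L by (rule add_subgroup_closure)
  interpret M: add_subgroup "group_closure S" by (rule add_subgroup_closure)
  let ?r = "representation B"
  have rep_int: "\<exists>k. ?r v x = of_int k" if "v \<in> \<Lambda>" for v x
    using that unfolding L
  proof (induction rule: group_closure.induct)
    case (base s)
    then show ?case
      using B representation_basis[OF B(2), of s] representation_zero[of B]
      by (cases "s = 0") (auto intro: exI[of _ 0] exI[of _ 1])
  next
    case (diff s t)
    then obtain k l where "?r s x = of_int k" "?r t x = of_int l" by auto
    then have "?r (s - t) x = of_int (k - l)"
      using representation_diff[OF B(2), of t s] B(3) by simp
    then show ?case by blast
  qed
  define D where "D = {w \<in> \<Lambda>. \<exists>c. w = (\<Sum>s\<in>S. c s *\<^sub>R s) \<and> (\<forall>s. 0 \<le> c s \<and> c s \<le> 1)}"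
  define C where "C = (\<Sum>s\<in>S. \<Sum>x\<in>B. \<bar>?r s x\<bar>)"
  have bound: "\<bar>?r w x\<bar> \<le> C" if "w \<in> D" "x \<in> B" for w x
  proof -
    obtain c where c: "w = (\<Sum>s\<in>S. c s *\<^sub>R s)" "\<And>s. 0 \<le> c s \<and> c s \<le> 1"
      using \<open>w \<in> D\<close> by (auto simp: D_def)
    have "?r w x = (\<Sum>s\<in>S. c s * ?r s x)"
      unfolding c(1) using B by (subst representation_sum) (auto simp: representation_scale)
    also have "\<bar>\<dots>\<bar> \<le> (\<Sum>s\<in>S. \<bar>c s * ?r s x\<bar>)" by (rule sum_abs)
    also have "\<dots> \<le> (\<Sum>s\<in>S. \<bar>?r s x\<bar>)"
      using c(2) by (intro sum_mono) (auto simp: abs_mult intro: mult_left_le_one_le)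
    also have "\<dots> \<le> C"
      unfolding C_def using that B(1) by (intro sum_mono member_le_sum) auto
    finally show ?thesis .
  qed
  have "inj_on (\<lambda>w. restrict (?r w) B) D"
  proof (rule inj_onI)
    fix w w' assume eq: "restrict (?r w) B = restrict (?r w') B"
    have "w = (\<Sum>x\<in>B. ?r w x *\<^sub>R x)" for w
      using sum_representation_eq[OF B(2), of w B] B by simp
    then show "w = w'" using eq by (metis (no_types, lifting) restrict_apply' sum.cong)
  qed
  moreover have "(\<lambda>w. restrict (?r w) B) ` D \<subseteq> (\<Pi>\<^sub>E x\<in>B. of_int ` {- \<lceil>C\<rceil>..\<lceil>C\<rceil>})"
  proof (rule image_subsetI, rule PiE_I)
    fix w x assume w: "w \<in> D" and x: "x \<in> B"
    have "w \<in> \<Lambda>" using w by (simp add: D_def)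
    then obtain k where k: "?r w x = of_int k" using rep_int by blast
    then have "\<bar>of_int k\<bar> \<le> C" using bound[OF w x] by simp
    then have "k \<in> {- \<lceil>C\<rceil>..\<lceil>C\<rceil>}" by (simp add: abs_le_iff) linarith
    then show "restrict (?r w) B x \<in> of_int ` {- \<lceil>C\<rceil>..\<lceil>C\<rceil>}" using x k by auto
  qed auto
  ultimately have "finite D"
    using B(1) finite_PiE[of B "\<lambda>x. of_int ` {- \<lceil>C\<rceil>..\<lceil>C\<rceil>} :: real set"]
    by (meson finite_imageD finite_imageI finite_subset finite_atLeastAtMost_int)
  moreover have "cosets \<Lambda> (group_closure S) \<subseteq> (\<lambda>a. (+) a ` group_closure S) ` D"
  proof
    fix P assume "P \<in> cosets \<Lambda> (group_closure S)"
    then obtain a where a: "a \<in> \<Lambda>" "P = (+) a ` group_closure S" by (auto simp: cosets_def)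
    obtain c where c: "a = (\<Sum>s\<in>S. c s *\<^sub>R s)"
      using span_image_sum[OF S(1), of a "\<lambda>s. s"] S(3) by auto
    \<comment> \<open>Removing the integer parts of the coefficients does not change the
      coset.\<close>
    define m where "m = (\<Sum>s\<in>S. of_int \<lfloor>c s\<rfloor> *\<^sub>R s)"
    have m: "m \<in> group_closure S"
      unfolding m_def using group_closure_superset[of S] by (intro M.sum_G M.int_scale_G) auto
    have "a - m = (\<Sum>s\<in>S. frac (c s) *\<^sub>R s)"
      by (simp add: c m_def frac_def scaleR_left_diff_distrib sum_subtractf)
    moreover have "a - m \<in> \<Lambda>" using m L.closure_subset[OF S(2)] L.diff_G[OF a(1)] by blast
    ultimately have "a - m \<in> D"
      unfolding D_def by (intro CollectI conjI exI[of _ "\<lambda>s. frac (c s)"]) (simp_all add: less_imp_le[OF frac_lt_1])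
    moreover have "P = (+) (a - m) ` group_closure S"
      unfolding a M.coset_eq_iff using m by simp
    ultimately show "P \<in> (\<lambda>a. (+) a ` group_closure S) ` D" by blast
  qed
  ultimately show ?thesis using finite_subset by blast
qed

section \<open>Lattice, vector list and torus points\<close>

locale arrangement =
  fixes \<Lambda> :: "'v::real_vector set" and X :: "'v list"
  assumes lattice: "spanning_lattice \<Lambda>" and X_sub: "set X \<subseteq> \<Lambda>" and X_span: "span (set X) = UNIV"
begin

sublocale L: add_subgroup \<Lambda>
  using lattice add_subgroup_closure by (auto simp: spanning_lattice_def)

sublocale add_submonoid \<Lambda>
  by unfold_locales (auto simp: L.zero_G L.add_G)

lemma X_nth: "i < length X \<Longrightarrow> X ! i \<in> \<Lambda>"
  using X_sub by auto

lemma basis_sub: "b \<in> bases X \<Longrightarrow> (!) X ` b \<subseteq> \<Lambda>"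
  using X_nth by (auto simp: bases_def)

lemma basis_finite: "b \<in> bases X \<Longrightarrow> finite b"
  by (auto simp: bases_def intro: finite_subset)

lemma finite_cosets: "b \<in> bases X \<Longrightarrow> finite (cosets \<Lambda> (group_closure ((!) X ` b)))"
  using basis_finite basis_sub by (intro finite_index lattice) (auto simp: bases_def)

lemma abs_det_eq: "abs_det \<Lambda> X b = card (cosets \<Lambda> (group_closure ((!) X ` b)))"
  by (simp add: abs_det_def cosets_def)

text \<open>The elements where \<open>t\<close> is 1 form a subgroup, so being 1 on the basis
  vectors extends to the lattice they generate.\<close>

lemma torus_points_eq:
  assumes "b \<in> bases X"
  shows "torus_points \<Lambda> X b = characters \<Lambda> (group_closure ((!) X ` b))"
proof -
  have "t m = 1" if t: "t \<in> torus \<Lambda>" "\<forall>i\<in>b. t (X ! i) = 1" and m: "m \<in> group_closure ((!) X ` b)" for t m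
  proof -
    interpret ker: add_subgroup "{m \<in> \<Lambda>. t m = 1}"
      by unfold_locales (use t in \<open>auto simp: L.torus_simps L.zero_G L.diff_G\<close>)
    show ?thesis
      using ker.closure_subset[of "(!) X ` b"] t(2) basis_sub[OF assms] m by auto
  qed
  then show ?thesis
    using group_closure_superset[of "(!) X ` b"] by (auto simp: torus_points_def characters_def)
qed

lemma card_torus_points:
  assumes "b \<in> bases X"
  shows "finite (torus_points \<Lambda> X b)" "card (torus_points \<Lambda> X b) = abs_det \<Lambda> X b"
proof -
  obtain B where B: "finite B" "\<Lambda> = group_closure B"
    using lattice by (auto simp: spanning_lattice_def)
  have "B \<subseteq> \<Lambda>" unfolding B by (rule group_closure_superset)
  moreover have "\<Lambda> \<subseteq> group_closure (group_closure ((!) X ` b) \<union> B)"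
    unfolding B(2) by (rule group_closure_mono) auto
  ultimately show "finite (torus_points \<Lambda> X b)" "card (torus_points \<Lambda> X b) = abs_det \<Lambda> X b"
    unfolding torus_points_eq[OF assms] abs_det_eq
    using card_characters[OF L.add_subgroup_axioms add_subgroup_closure finite_cosets[OF assms] _ B(1)]
      L.closure_subset[OF basis_sub[OF assms]] by auto
qed

lemma finite_P_points: "finite (P_points \<Lambda> X)"
  unfolding P_points_def using bases_finite[of X] card_torus_points(1) by blast

end

section \<open>Ideals of a monoid algebra\<close>

context add_submonoid
begin

lemma ideal_memD: "ideal J (monoid_alg M) \<Longrightarrow> f \<in> J \<Longrightarrow> keys f \<subseteq> M"
  and ideal_zero: "ideal J (monoid_alg M) \<Longrightarrow> 0 \<in> J"
  and ideal_add: "ideal J (monoid_alg M) \<Longrightarrow> f \<in> J \<Longrightarrow> g \<in> J \<Longrightarrow> f + g \<in> J"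
  and ideal_mult: "ideal J (monoid_alg M) \<Longrightarrow> keys f \<subseteq> M \<Longrightarrow> g \<in> J \<Longrightarrow> f * g \<in> J"
  unfolding ideal_monoid_alg_iff by blast+

lemma ideal_pm_subspace: "ideal J (monoid_alg M) \<Longrightarrow> pm_subspace J"
  by unfold_locales (auto simp: ideal_zero ideal_add ideal_mult keys_const_closed)

lemma genideal_subset:
  assumes "\<forall>f\<in>S. keys f \<subseteq> M"
  shows "S \<subseteq> genideal (monoid_alg M) S"
  using alg.genideal_self[of S] assms by auto

lemma genideal_is_ideal:
  assumes "\<forall>f\<in>S. keys f \<subseteq> M"
  shows "ideal (genideal (monoid_alg M) S) (monoid_alg M)"
  using assms by (intro alg.genideal_ideal) auto

lemma genideal_least:
  assumes "ideal J (monoid_alg M)" "S \<subseteq> J"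
  shows "genideal (monoid_alg M) S \<subseteq> J"
  by (rule alg.genideal_minimal) (use assms in auto)

end

section \<open>An upper bound for the dimension of \<open>\<complex>[\<Lambda>] / J\<^sub>X\<close>\<close>

context arrangement
begin

lemma keys_expo: "a \<in> \<Lambda> \<Longrightarrow> keys (expo a) \<subseteq> \<Lambda>"
  by (simp add: expo_def)

lemma expo_mult: "expo a * expo b = expo (a + b)"
  by (simp add: expo_def mult_single)

lemma expo_0: "expo 0 = 1"
  by (simp add: expo_def)

definition hyper :: "nat set \<Rightarrow> ('v \<Rightarrow>\<^sub>0 complex)" where
  "hyper Y = (\<Prod>i\<in>Y. 1 - expo (- (X ! i)))"

lemma keys_factor: "i < length X \<Longrightarrow> keys (1 - expo (- (X ! i))) \<subseteq> \<Lambda>"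
  by (intro keys_diff_closed keys_1_closed keys_expo L.uminus_G X_nth)

lemma keys_hyper: "Y \<subseteq> {..<length X} \<Longrightarrow> keys (hyper Y) \<subseteq> \<Lambda>"
  unfolding hyper_def by (rule keys_prod_closed) (auto intro!: subsetD[OF keys_factor])

text \<open>The vectors \<open>X\<^sub>i\<close>, \<open>i \<in> b\<close>, have been contracted and only those with \<open>i \<in> I\<close> are left.\<close>

definition minor_gens :: "nat set \<Rightarrow> nat set \<Rightarrow> ('v \<Rightarrow>\<^sub>0 complex) set" where
  "minor_gens I b = {expo (X ! i) - 1 | i. i \<in> b} \<union>
     {hyper Y | Y. Y \<subseteq> I \<and> span ((!) X ` (b \<union> (I - Y))) \<noteq> UNIV}"

definition minor_ideal :: "nat set \<Rightarrow> nat set \<Rightarrow> ('v \<Rightarrow>\<^sub>0 complex) set" where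
  "minor_ideal I b = genideal (group_alg \<Lambda>) (minor_gens I b)"

lemma keys_minor_gens:
  assumes "I \<subseteq> {..<length X}" "b \<subseteq> {..<length X}"
  shows "\<forall>f\<in>minor_gens I b. keys f \<subseteq> \<Lambda>"
proof
  fix f assume "f \<in> minor_gens I b"
  then consider i where "i \<in> b" "f = expo (X ! i) - 1" | Y where "Y \<subseteq> I" "f = hyper Y"
    by (auto simp: minor_gens_def)
  then show "keys f \<subseteq> \<Lambda>"
  proof cases
    case 1
    then show ?thesis
      using assms by (auto intro!: subsetD[OF keys_diff_closed[OF keys_expo[OF X_nth] keys_1_closed]])
  next
    case 2
    then have "keys (hyper Y) \<subseteq> \<Lambda>" using assms by (intro keys_hyper) auto
    then show ?thesis using 2 by simp
  qed
qed

lemma J_ideal_eq: "J_ideal \<Lambda> X = minor_ideal {..<length X} {}"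
proof -
  have "{\<Prod>i\<in>Y. 1 - expo (- (X ! i)) | Y. Y \<in> cocircuits X} = minor_gens {..<length X} {}"
    by (simp add: minor_gens_def cocircuits_def hyper_def)
  then show ?thesis by (simp add: J_ideal_def minor_ideal_def)
qed

lemma J_ideal_ideal: "ideal (J_ideal \<Lambda> X) (group_alg \<Lambda>)"
  unfolding J_ideal_eq minor_ideal_def by (intro genideal_is_ideal keys_minor_gens) auto

text \<open>These inclusions combine spanning sets: that of the deletion of \<open>v\<close>,
  multiplied by \<open>e\<close>, and that of the contraction of \<open>v\<close> together span the
  quotient for the larger index set.\<close>

lemma minor_step:
  assumes I: "insert v I \<subseteq> {..<length X}" "v \<notin> I" and b: "b \<subseteq> {..<length X}"
  defines "e \<equiv> 1 - expo (- (X ! v))"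
  shows "j \<in> minor_ideal I b \<Longrightarrow> e * j \<in> minor_ideal (insert v I) b"
    and "j \<in> minor_ideal I (insert v b) \<Longrightarrow>
      \<exists>r j'. keys r \<subseteq> \<Lambda> \<and> j' \<in> minor_ideal (insert v I) b \<and> j = e * r + j'"
proof -
  let ?J = "minor_ideal (insert v I) b"
  have gens: "minor_gens (insert v I) b \<subseteq> ?J"
    unfolding minor_ideal_def by (intro genideal_subset keys_minor_gens I b)
  have J: "ideal ?J (group_alg \<Lambda>)"
    unfolding minor_ideal_def by (intro genideal_is_ideal keys_minor_gens I b)
  have finI: "finite I" using I by (auto intro: finite_subset)
  have ke: "keys e \<subseteq> \<Lambda>" unfolding e_def using I by (intro keys_factor) auto
  have kv: "keys (expo (X ! v)) \<subseteq> \<Lambda>" using I by (intro keys_expo X_nth) auto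
  have expo_J: "expo (X ! i) - 1 \<in> ?J" if "i \<in> b" for i
    using gens that by (auto simp: minor_gens_def)
  show "e * j \<in> ?J" if j: "j \<in> minor_ideal I b" for j
  proof -
    \<comment> \<open>The colon ideal of \<open>?J\<close> by \<open>e\<close>; it suffices to place
      the generators of the deletion in it.\<close>
    let ?S = "{j. keys j \<subseteq> \<Lambda> \<and> e * j \<in> ?J}"
    have "ideal ?S (group_alg \<Lambda>)"
      unfolding ideal_monoid_alg_iff
    proof (intro conjI ballI allI impI)
      show "0 \<in> ?S" using ideal_zero[OF J] by simp
      fix f g assume "f \<in> ?S" "g \<in> ?S"
      then show "f + g \<in> ?S" using ideal_add[OF J] keys_add_closed[of f g] by (simp add: distrib_left)
    next
      fix f g :: "'v \<Rightarrow>\<^sub>0 complex" assume "keys f \<subseteq> \<Lambda>" "g \<in> ?S"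
      then show "f * g \<in> ?S"
        using ideal_mult[OF J, of f "e * g"] keys_mult_closed[of f g] by (simp add: mult.left_commute)
    qed auto
    moreover have "minor_gens I b \<subseteq> ?S"
    proof
      fix f assume f: "f \<in> minor_gens I b"
      have kf: "keys f \<subseteq> \<Lambda>" using keys_minor_gens[of I b] I b f by auto
      consider i where "i \<in> b" "f = expo (X ! i) - 1"
        | Y where "Y \<subseteq> I" "span ((!) X ` (b \<union> (I - Y))) \<noteq> UNIV" "f = hyper Y"
        using f by (auto simp: minor_gens_def)
      then have "e * f \<in> ?J"
      proof cases
        case 1
        then show ?thesis using ideal_mult[OF J ke] expo_J by simp
      next
        case 2
        \<comment> \<open>Multiplication by \<open>e\<close> moves \<open>v\<close> into
          \<open>Y\<close>, leaving the complement and hence the spanning condition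
          unchanged.\<close>
        have "e * f = hyper (insert v Y)"
          using 2 I finite_subset[OF _ finI, of Y] unfolding hyper_def e_def 2(3)
          by (subst prod.insert) auto
        moreover have "insert v I - insert v Y = I - Y" using I by auto
        then have "hyper (insert v Y) \<in> minor_gens (insert v I) b"
          using 2 by (auto simp: minor_gens_def intro!: exI[of _ "insert v Y"])
        ultimately show ?thesis using gens by auto
      qed
      then show "f \<in> ?S" using kf by simp
    qed
    ultimately have "minor_ideal I b \<subseteq> ?S"
      unfolding minor_ideal_def[of I b] by (rule genideal_least)
    then show ?thesis using j by auto
  qed
  show "\<exists>r j'. keys r \<subseteq> \<Lambda> \<and> j' \<in> ?J \<and> j = e * r + j'" if j: "j \<in> minor_ideal I (insert v b)" for j
  proof -
    let ?S = "{j. \<exists>r j'. keys r \<subseteq> \<Lambda> \<and> j' \<in> ?J \<and> j = e * r + j'}"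
    have "ideal ?S (group_alg \<Lambda>)"
      unfolding ideal_monoid_alg_iff
    proof (intro conjI ballI allI impI)
      fix f assume "f \<in> ?S"
      then obtain r j' where *: "keys r \<subseteq> \<Lambda>" "j' \<in> ?J" "f = e * r + j'" by blast
      show "keys f \<subseteq> \<Lambda>"
        unfolding *(3) by (intro keys_add_closed keys_mult_closed ke * ideal_memD[OF J])
    next
      have "0 = e * 0 + (0 :: 'v \<Rightarrow>\<^sub>0 complex)" by simp
      then show "0 \<in> ?S" using ideal_zero[OF J] by (intro CollectI exI[of _ 0]) auto
    next
      fix f g assume "f \<in> ?S" "g \<in> ?S"
      then obtain r j' s k' where *: "keys r \<subseteq> \<Lambda>" "j' \<in> ?J" "f = e * r + j'"
        "keys s \<subseteq> \<Lambda>" "k' \<in> ?J" "g = e * s + k'" by blast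
      then have "f + g = e * (r + s) + (j' + k')" by (simp add: algebra_simps)
      then show "f + g \<in> ?S"
        using ideal_add[OF J *(2,5)] keys_add_closed[OF *(1,4)] by blast
    next
      fix f g :: "'v \<Rightarrow>\<^sub>0 complex" assume f: "keys f \<subseteq> \<Lambda>" and "g \<in> ?S"
      then obtain r j' where *: "keys r \<subseteq> \<Lambda>" "j' \<in> ?J" "g = e * r + j'" by blast
      then have "f * g = e * (f * r) + f * j'" by (simp add: algebra_simps)
      then show "f * g \<in> ?S"
        using ideal_mult[OF J f *(2)] keys_mult_closed[OF f *(1)] by blast
    qed
    moreover have "minor_gens I (insert v b) \<subseteq> ?S"
    proof
      fix f assume "f \<in> minor_gens I (insert v b)"
      then consider "f = expo (X ! v) - 1" | i where "i \<in> b" "f = expo (X ! i) - 1"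
        | Y where "Y \<subseteq> I" "span ((!) X ` (insert v b \<union> (I - Y))) \<noteq> UNIV" "f = hyper Y"
        by (auto simp: minor_gens_def)
      then consider "f = e * expo (X ! v) + 0" | "f \<in> ?J"
      proof cases
        case 1
        \<comment> \<open>The relation that contracts \<open>v\<close> is a multiple of
          \<open>e\<close>, so it contributes to the cofactor \<open>r\<close> only.\<close>
        then have "f = e * expo (X ! v) + 0"
          by (simp add: e_def left_diff_distrib expo_mult expo_0)
        then show ?thesis using that by blast
      next
        case 2
        then show ?thesis using that expo_J by blast
      next
        case 3
        have "insert v b \<union> (I - Y) = b \<union> (insert v I - Y)" using 3 I by auto
        then have "f \<in> minor_gens (insert v I) b"
          using 3 by (auto simp: minor_gens_def)
        then show ?thesis using gens that by blast
      qed
      then show "f \<in> ?S"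
      proof cases
        case 1
        then show ?thesis using kv ideal_zero[OF J] by blast
      next
        case 2
        moreover have "f = e * 0 + f" by simp
        moreover have "keys (0 :: 'v \<Rightarrow>\<^sub>0 complex) \<subseteq> \<Lambda>" by simp
        ultimately show ?thesis by blast
      qed
    qed
    ultimately have "minor_ideal I (insert v b) \<subseteq> ?S"
      unfolding minor_ideal_def[of I "insert v b"] by (rule genideal_least)
    then show ?thesis using j by blast
  qed
qed

text \<open>Contracting a whole basis identifies exponents modulo the lattice
  \<open>\<Lambda>\<^sub>b\<close>, so one exponential per coset suffices.\<close>

lemma minor_base:
  assumes "b \<in> bases X"
  shows "\<exists>F. finite F \<and> card F \<le> abs_det \<Lambda> X b \<and> (\<forall>f\<in>F. keys f \<subseteq> \<Lambda>) \<and>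
    (\<forall>f. keys f \<subseteq> \<Lambda> \<longrightarrow> f \<in> span_mod (minor_ideal {} b) (\<lambda>f. f) F)"
proof -
  let ?J = "minor_ideal {} b" and ?M = "group_closure ((!) X ` b)"
  interpret M: add_subgroup ?M by (rule add_subgroup_closure)
  have b: "b \<subseteq> {..<length X}" using assms by (auto simp: bases_def)
  have J: "ideal ?J (group_alg \<Lambda>)"
    unfolding minor_ideal_def by (intro genideal_is_ideal keys_minor_gens b) auto
  interpret J: pm_subspace ?J by (rule ideal_pm_subspace[OF J])
  have gens: "minor_gens {} b \<subseteq> ?J"
    unfolding minor_ideal_def by (intro genideal_subset keys_minor_gens b) auto
  have "expo m - 1 \<in> ?J" if "m \<in> ?M" for m
    using that
  proof (induction rule: group_closure.induct)
    case (base s)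
    then show ?case
      using gens ideal_zero[OF J] by (auto simp: minor_gens_def expo_0)
  next
    case (diff s t)
    have "t \<in> \<Lambda>" using diff(2) L.closure_subset[OF basis_sub[OF assms]] by auto
    then have "keys (expo (- t)) \<subseteq> \<Lambda>" by (intro keys_expo L.uminus_G)
    moreover have "(expo s - 1) - (expo t - 1) \<in> ?J" by (rule J.diff_in[OF diff.IH])
    ultimately have "expo (- t) * ((expo s - 1) - (expo t - 1)) \<in> ?J" by (rule ideal_mult[OF J])
    moreover have "expo (- t) * ((expo s - 1) - (expo t - 1)) = expo (s - t) - 1"
      by (simp add: right_diff_distrib expo_mult expo_0)
    ultimately show ?case by simp
  qed
  then have expo_J: "expo a - expo c \<in> ?J" if "a - c \<in> ?M" "c \<in> \<Lambda>" for a c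
    using ideal_mult[OF J keys_expo[OF that(2)], of "expo (a - c) - 1"] that(1)
    by (simp add: right_diff_distrib expo_mult)
  let ?Q = "cosets \<Lambda> ?M"
  have "\<exists>a\<in>\<Lambda>. C = (+) a ` ?M" if "C \<in> ?Q" for C using that by (auto simp: cosets_def)
  then obtain rep where rep: "\<And>C. C \<in> ?Q \<Longrightarrow> rep C \<in> \<Lambda> \<and> C = (+) (rep C) ` ?M" by metis
  define F where "F = (\<lambda>C. expo (rep C)) ` ?Q"
  have F: "finite F" "card F \<le> abs_det \<Lambda> X b"
    unfolding F_def abs_det_eq using finite_cosets[OF assms] by (auto intro: card_image_le)
  have "f \<in> span_mod ?J (\<lambda>f. f) F" if kf: "keys f \<subseteq> \<Lambda>" for f
  proof (induction rule: poly_mapping_additive_induct[OF kf])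
    case (3 a c)
    define C where "C = (+) a ` ?M"
    have C: "C \<in> ?Q" using 3 by (auto simp: C_def cosets_def)
    then have "a - rep C \<in> ?M" "rep C \<in> \<Lambda>"
      using rep[OF C] M.coset_eq_iff by (simp_all add: C_def)
    then have "expo a - expo (rep C) \<in> ?J" by (rule expo_J)
    moreover have "expo (rep C) \<in> span_mod ?J (\<lambda>f. f) F"
      using J.span_mod_base[OF F(1), of "expo (rep C)" "\<lambda>f. f"] C by (auto simp: F_def)
    ultimately have "(expo a - expo (rep C)) + expo (rep C) \<in> span_mod ?J (\<lambda>f. f) F"
      by (intro J.span_mod_add[OF J.span_mod_K])
    then have "const c * expo a \<in> span_mod ?J (\<lambda>f. f) F"
      by (intro J.span_mod_const) simp
    then show ?case by (simp add: expo_def const_mult_single)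
  qed (auto intro: J.span_mod_add J.span_mod_K J.zero_in)
  moreover have "\<forall>f\<in>F. keys f \<subseteq> \<Lambda>"
    using rep keys_expo by (auto simp: F_def dest!: subsetD[OF keys_expo])
  ultimately show ?thesis using F by blast
qed

text \<open>The sum runs over the bases between \<open>b\<close> and \<open>b \<union> I\<close>.
  They split according to whether they contain a chosen \<open>v\<close>, matching contraction and
  deletion.\<close>

lemma minor_upper_bound:
  assumes "finite I" "I \<subseteq> {..<length X}" "b \<subseteq> {..<length X}" "b \<inter> I = {}"
    "inj_on ((!) X) b" "independent ((!) X ` b)"
  shows "\<exists>F. finite F \<and> card F \<le> (\<Sum>b'\<in>{b'. b' \<subseteq> I \<and> b \<union> b' \<in> bases X}. abs_det \<Lambda> X (b \<union> b')) \<and>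
    (\<forall>f\<in>F. keys f \<subseteq> \<Lambda>) \<and> (\<forall>f. keys f \<subseteq> \<Lambda> \<longrightarrow> f \<in> span_mod (minor_ideal I b) (\<lambda>f. f) F)"
  using assms
proof (induction I arbitrary: b rule: finite_induct)
  case empty
  show ?case
  proof (cases "b \<in> bases X")
    case True
    then have "{b'. b' \<subseteq> {} \<and> b \<union> b' \<in> bases X} = {{}}" by auto
    then show ?thesis using minor_base[OF True] by simp
  next
    case False
    let ?J = "minor_ideal {} b"
    have J: "ideal ?J (group_alg \<Lambda>)"
      unfolding minor_ideal_def by (intro genideal_is_ideal keys_minor_gens empty)
    interpret J: pm_subspace ?J by (rule ideal_pm_subspace[OF J])
    \<comment> \<open>As \<open>b\<close> is independent but not a basis, it fails to span; then
      \<open>Y = {}\<close> contributes the empty product and the ideal is everything.\<close>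
    have "span ((!) X ` b) \<noteq> UNIV" using False empty by (auto simp: bases_def)
    then have "hyper {} \<in> minor_gens {} b" unfolding minor_gens_def by auto
    then have "1 \<in> ?J"
      unfolding minor_ideal_def using genideal_subset[OF keys_minor_gens[of "{}" b]] empty
      by (auto simp: hyper_def)
    then have "f \<in> ?J" if "keys f \<subseteq> \<Lambda>" for f
      using ideal_mult[OF J that, of 1] by simp
    then show ?thesis by (intro exI[of _ "{}"]) (auto intro: J.span_mod_K)
  qed
next
  case (insert v I)
  let ?J = "minor_ideal (insert v I) b"
  let ?e = "1 - expo (- (X ! v))"
  have v: "v < length X" "v \<notin> b" using insert.prems by auto
  have J: "ideal ?J (group_alg \<Lambda>)"
    unfolding minor_ideal_def by (intro genideal_is_ideal keys_minor_gens insert.prems)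
  interpret J: pm_subspace ?J by (rule ideal_pm_subspace[OF J])
  have fin: "finite {b'. b' \<subseteq> insert v I \<and> b \<union> b' \<in> bases X}"
    by (rule finite_subset[of _ "Pow (insert v I)"]) (use insert.hyps in auto)
  obtain F1 where F1: "finite F1" "\<forall>f\<in>F1. keys f \<subseteq> \<Lambda>"
    "card F1 \<le> (\<Sum>b'\<in>{b'. b' \<subseteq> I \<and> b \<union> b' \<in> bases X}. abs_det \<Lambda> X (b \<union> b'))"
    "\<And>f. keys f \<subseteq> \<Lambda> \<Longrightarrow> f \<in> span_mod (minor_ideal I b) (\<lambda>f. f) F1"
    using insert.IH[of b] insert.prems by auto
  show ?case
  proof (cases "X ! v \<in> span ((!) X ` b)")
    case True
    \<comment> \<open>A vector already in the span of \<open>b\<close> does not affect the spanning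
      conditions, so the ideal of the deletion is contained in \<open>?J\<close> and its spanning
      set can be reused.\<close>
    have "minor_gens I b \<subseteq> minor_gens (insert v I) b"
    proof
      fix f assume "f \<in> minor_gens I b"
      then consider "\<exists>i\<in>b. f = expo (X ! i) - 1"
        | Y where "Y \<subseteq> I" "span ((!) X ` (b \<union> (I - Y))) \<noteq> UNIV" "f = hyper Y"
        by (auto simp: minor_gens_def)
      then show "f \<in> minor_gens (insert v I) b"
      proof cases
        case 2
        have "insert v I - Y = insert v (I - Y)" using 2 insert.hyps by auto
        moreover have "span ((!) X ` (b \<union> insert v (I - Y))) = span ((!) X ` (b \<union> (I - Y)))"
          using True span_mono[of "(!) X ` b" "(!) X ` (b \<union> (I - Y))"] by (simp add: span_redundant image_Un subset_iff)
        ultimately show ?thesis using 2 by (auto simp: minor_gens_def)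
      qed (auto simp: minor_gens_def)
    qed
    also have "minor_gens (insert v I) b \<subseteq> ?J"
      unfolding minor_ideal_def by (intro genideal_subset keys_minor_gens insert.prems)
    finally have "minor_ideal I b \<subseteq> ?J"
      unfolding minor_ideal_def[of I b] by (rule genideal_least[OF J])
    then have "\<And>f. keys f \<subseteq> \<Lambda> \<Longrightarrow> f \<in> span_mod ?J (\<lambda>f. f) F1"
      using F1(4) unfolding span_mod_def by blast
    moreover have "(\<Sum>b'\<in>{b'. b' \<subseteq> I \<and> b \<union> b' \<in> bases X}. abs_det \<Lambda> X (b \<union> b')) \<le>
        (\<Sum>b'\<in>{b'. b' \<subseteq> insert v I \<and> b \<union> b' \<in> bases X}. abs_det \<Lambda> X (b \<union> b'))"
      by (rule sum_mono2[OF fin]) auto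
    ultimately show ?thesis using F1 by (intro exI[of _ F1]) auto
  next
    case False
    then have "inj_on ((!) X) (insert v b)" "independent ((!) X ` insert v b)"
      using insert.prems v by (auto simp: independent_insert inj_on_insert span_base)
    then obtain F2 where F2: "finite F2" "\<forall>f\<in>F2. keys f \<subseteq> \<Lambda>"
      "card F2 \<le> (\<Sum>b'\<in>{b'. b' \<subseteq> I \<and> insert v b \<union> b' \<in> bases X}. abs_det \<Lambda> X (insert v b \<union> b'))"
      "\<And>f. keys f \<subseteq> \<Lambda> \<Longrightarrow> f \<in> span_mod (minor_ideal I (insert v b)) (\<lambda>f. f) F2"
      using insert.IH[of "insert v b"] insert.prems insert.hyps v by auto
    define F where "F = (\<lambda>f. ?e * f) ` F1 \<union> F2"
    have finF: "finite F" using F1 F2 by (simp add: F_def)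
    have ke: "keys ?e \<subseteq> \<Lambda>" using v by (intro keys_factor)
    have "keys f \<subseteq> \<Lambda>" if "f \<in> F" for f
    proof -
      consider g where "g \<in> F1" "f = ?e * g" | "f \<in> F2" using \<open>f \<in> F\<close> by (auto simp: F_def)
      then show ?thesis
        by cases (use F1(2) F2(2) keys_mult_closed[OF ke] in blast)+
    qed
    moreover have "card F \<le> (\<Sum>b'\<in>{b'. b' \<subseteq> insert v I \<and> b \<union> b' \<in> bases X}. abs_det \<Lambda> X (b \<union> b'))"
    proof -
      let ?B1 = "{b'. b' \<subseteq> I \<and> b \<union> b' \<in> bases X}" and ?B2 = "{b'. b' \<subseteq> I \<and> insert v b \<union> b' \<in> bases X}"
      have "card F \<le> card F1 + card F2"
        unfolding F_def using card_Un_le[of "(\<lambda>f. ?e * f) ` F1" F2] card_image_le[OF F1(1), of "\<lambda>f. ?e * f"] by linarith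
      also have "\<dots> \<le> (\<Sum>b'\<in>?B1. abs_det \<Lambda> X (b \<union> b')) + (\<Sum>b'\<in>?B2. abs_det \<Lambda> X (b \<union> insert v b'))"
        using F1(3) F2(3) by simp
      also have "(\<Sum>b'\<in>?B2. abs_det \<Lambda> X (b \<union> insert v b')) = (\<Sum>b'\<in>insert v ` ?B2. abs_det \<Lambda> X (b \<union> b'))"
        using insert.hyps by (subst sum.reindex) (auto intro!: inj_onI)
      also have "(\<Sum>b'\<in>?B1. abs_det \<Lambda> X (b \<union> b')) + (\<Sum>b'\<in>insert v ` ?B2. abs_det \<Lambda> X (b \<union> b')) =
          (\<Sum>b'\<in>?B1 \<union> insert v ` ?B2. abs_det \<Lambda> X (b \<union> b'))"
        using insert.hyps by (intro sum.union_disjoint[symmetric]) auto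
      also have "\<dots> \<le> (\<Sum>b'\<in>{b'. b' \<subseteq> insert v I \<and> b \<union> b' \<in> bases X}. abs_det \<Lambda> X (b \<union> b'))"
        by (rule sum_mono2[OF fin]) auto
      finally show ?thesis .
    qed
    moreover have "f \<in> span_mod ?J (\<lambda>f. f) F" if f: "keys f \<subseteq> \<Lambda>" for f
    proof -
      have step: "e' * comb c (\<lambda>f. f) F' \<in> span_mod ?J (\<lambda>f. f) F"
        if "\<And>f. f \<in> F' \<Longrightarrow> e' * f \<in> F" for e' c F'
      proof -
        have "e' * comb c (\<lambda>f. f) F' = (\<Sum>f\<in>F'. const (c f) * (e' * f))"
          by (simp add: comb_def sum_distrib_left mult.left_commute)
        also have "\<dots> \<in> span_mod ?J (\<lambda>f. f) F"
          by (intro J.span_mod_sum J.span_mod_const J.span_mod_base[where u = "\<lambda>f. f"] finF that)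
        finally show ?thesis .
      qed
      \<comment> \<open>First \<open>f\<close> is expanded modulo the ideal of the contraction; the
        error has the form \<open>?e * r + j\<close>, and \<open>r\<close> is then expanded modulo
        the ideal of the deletion.\<close>
      obtain c where c: "f - comb c (\<lambda>f. f) F2 \<in> minor_ideal I (insert v b)"
        using F2(4)[OF f] by (auto simp: span_mod_def)
      then obtain r j where r: "keys r \<subseteq> \<Lambda>" "j \<in> ?J" "f - comb c (\<lambda>f. f) F2 = ?e * r + j"
        using minor_step(2)[OF insert.prems(1) insert.hyps(2) insert.prems(2)] by blast
      obtain d where d: "r - comb d (\<lambda>f. f) F1 \<in> minor_ideal I b"
        using F1(4)[OF r(1)] by (auto simp: span_mod_def)
      have "f = 1 * comb c (\<lambda>f. f) F2 + (?e * comb d (\<lambda>f. f) F1 + (?e * (r - comb d (\<lambda>f. f) F1) + j))"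
        using r(3) by (simp add: algebra_simps)
      also have "\<dots> \<in> span_mod ?J (\<lambda>f. f) F"
        by (intro J.span_mod_add step J.span_mod_K J.add_in r(2)
            minor_step(1)[OF insert.prems(1) insert.hyps(2) insert.prems(2) d])
           (auto simp: F_def)
      finally show ?thesis .
    qed
    ultimately show ?thesis using finF by blast
  qed
qed

lemma upper_bound:
  "\<exists>F. finite F \<and> card F \<le> delta \<Lambda> X \<and> (\<forall>f\<in>F. keys f \<subseteq> \<Lambda>) \<and>
    (\<forall>f. keys f \<subseteq> \<Lambda> \<longrightarrow> f \<in> span_mod (J_ideal \<Lambda> X) (\<lambda>f. f) F)"
proof -
  have "{b'. b' \<subseteq> {..<length X} \<and> {} \<union> b' \<in> bases X} = bases X"
    by (auto simp: bases_def)
  then show ?thesis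
    using minor_upper_bound[of "{..<length X}" "{}"] by (simp add: J_ideal_eq delta_def independent_empty)
qed

end

section \<open>Positive degree and generation by vectors\<close>

definition positive_degree :: "(('v \<Rightarrow>\<^sub>0 nat) \<Rightarrow>\<^sub>0 complex) \<Rightarrow> bool" where
  "positive_degree p \<longleftrightarrow> (\<forall>m\<in>keys p. tdeg m > 0)"

lemma positive_degree_0: "positive_degree 0"
  by (simp add: positive_degree_def)

lemma positive_degree_add: "positive_degree p \<Longrightarrow> positive_degree q \<Longrightarrow> positive_degree (p + q)"
  using keys_add[of p q] by (auto simp: positive_degree_def)

lemma positive_degree_sum: "(\<And>i. i \<in> A \<Longrightarrow> positive_degree (f i)) \<Longrightarrow> positive_degree (sum f A)"
  by (induction A rule: infinite_finite_induct) (auto simp: positive_degree_0 positive_degree_add)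

lemma positive_degree_mult: "positive_degree p \<Longrightarrow> positive_degree (q * p)"
  using keys_mult[of q p] by (fastforce simp: positive_degree_def tdeg_add)

lemma positive_degree_gen_var: "positive_degree (gen_var v)"
  by (simp add: positive_degree_def gen_var_def)

lemma positive_degree_power:
  assumes "positive_degree p" "m \<in> keys (p ^ n)"
  shows "tdeg m \<ge> n"
  using assms(2)
proof (induction n arbitrary: m)
  case (Suc n)
  then obtain a b where "a \<in> keys p" "b \<in> keys (p ^ n)" "m = a + b"
    using keys_mult[of p "p ^ n"] by auto
  then show ?case
    using Suc.IH[of b] assms(1) by (auto simp: tdeg_add positive_degree_def)
qed simp

text \<open>All monomials of \<open>p ^ N\<close> have degree at least \<open>N\<close>, beyond the
  top degree of the algebra.\<close>

lemma positive_degree_nilpotent: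
  assumes "positive_degree p" "N > length Z"
  shows "p ^ N \<in> K_ideal Z"
proof -
  interpret K: pm_ideal "K_ideal Z" by (rule pm_ideal_K)
  have "(\<Sum>m\<in>keys (p ^ N). single m (lookup (p ^ N) m)) \<in> K_ideal Z"
    by (intro K.sum_mem K_high_degree)
       (use positive_degree_power[OF assms(1)] assms(2) in fastforce)
  then show ?thesis by (simp flip: sum_single_keys)
qed

lemma gen_var_power: "gen_var v ^ i = single (single v i) 1"
  by (induction i) (simp_all add: gen_var_def mult_single flip: single_add)

lemma single_eq_prod: "single m c = const c * (\<Prod>v\<in>keys m. gen_var v ^ lookup m v)"
proof -
  have "(\<Prod>v\<in>A. gen_var v ^ lookup m v) = single (\<Sum>v\<in>A. single v (lookup m v)) 1" for A
    by (induction A rule: infinite_finite_induct) (simp_all add: gen_var_power mult_single)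
  then show ?thesis
    by (simp add: const_mult_single flip: sum_single_keys)
qed

lemma poly_generated:
  assumes "\<And>c. const c \<in> C" "\<And>v. gen_var v \<in> C"
    "\<And>p q. p \<in> C \<Longrightarrow> q \<in> C \<Longrightarrow> p + q \<in> C" "\<And>p q. p \<in> C \<Longrightarrow> q \<in> C \<Longrightarrow> p * q \<in> C"
  shows "p \<in> C"
proof (induction p rule: poly_mapping_additive_induct[where M = UNIV])
  case 2
  show ?case using assms(1)[of 0] by simp
next
  case (4 m c)
  have pow: "q ^ n \<in> C" if "q \<in> C" for q n
    by (induction n) (use that assms assms(1)[of 1] in auto)
  have "(\<Prod>v\<in>A. gen_var v ^ lookup m v) \<in> C" for A
    by (induction A rule: infinite_finite_induct) (use assms assms(1)[of 1] pow in auto)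
  then show ?case unfolding single_eq_prod by (intro assms)
qed (use assms in auto)

section \<open>The logarithm isomorphism on representatives\<close>

text \<open>Sublists are sets of positions, so passing between \<open>X\<close> and its sublist at a
  point needs an explicit matching of positions; it transports cocircuits and bases.\<close>

lemma filter_reindex:
  "\<exists>\<sigma>. bij_betw \<sigma> {..<length (filter P xs)} {i. i < length xs \<and> P (xs ! i)} \<and>
    (\<forall>k<length (filter P xs). filter P xs ! k = xs ! \<sigma> k)"
proof -
  let ?l = "filter (\<lambda>i. P (xs ! i)) [0..<length xs]"
  have eq: "filter P xs = map ((!) xs) ?l"
  proof -
    have "filter P (map ((!) xs) [0..<length xs]) = map ((!) xs) ?l"
      by (simp add: filter_map o_def)
    then show ?thesis by (simp add: map_nth)
  qed
  have "bij_betw ((!) ?l) {..<length ?l} {i. i < length xs \<and> P (xs ! i)}"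
    by (rule bij_betw_nth) auto
  then show ?thesis
    by (intro exI[of _ "(!) ?l"]) (simp add: eq)
qed

definition gexp :: "nat \<Rightarrow> 'v::real_vector \<Rightarrow> (('v \<Rightarrow>\<^sub>0 nat) \<Rightarrow>\<^sub>0 complex)" where
  "gexp N a = fps_at N (fps_exp 1) (gen_var a)"

lemma gexp_minus_1: "N > 0 \<Longrightarrow> positive_degree (gexp N a - 1)"
proof -
  assume N: "N > 0"
  obtain u where "fps_at N (fps_exp 1 - 1) (gen_var a) = gen_var a * u"
    using fps_at_multiple[of "fps_exp 1 - 1"] by auto
  then have "gexp N a - 1 = u * gen_var a"
    using N by (simp add: gexp_def fps_at_diff fps_at_1 mult.commute)
  then show ?thesis
    using positive_degree_mult[OF positive_degree_gen_var] by simp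
qed

context arrangement
begin

text \<open>This bound on nilpotency works for all sublists of \<open>X\<close>.\<close>

definition N :: nat where "N = length X + 1"

text \<open>Only a representative of the local map: it is a homomorphism modulo
  \<open>K_ideal (sublist_at X t)\<close>, with one truncation order for all
  \<open>t\<close>.\<close>

definition phi :: "('v \<Rightarrow> complex) \<Rightarrow> ('v \<Rightarrow>\<^sub>0 complex) \<Rightarrow> (('v \<Rightarrow>\<^sub>0 nat) \<Rightarrow>\<^sub>0 complex)" where
  "phi t = lift const (\<lambda>a. const (t a) * gexp N a)"

abbreviation "P \<equiv> P_points \<Lambda> X"
abbreviation "R \<equiv> {f :: 'v \<Rightarrow>\<^sub>0 complex. keys f \<subseteq> \<Lambda>}"

lemma N_pos: "N > 0"
  by (simp add: N_def)

lemma phi_add: "phi t (f + g) = phi t f + phi t g"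
  and phi_diff: "phi t (f - g) = phi t f - phi t g"
  and phi_sum: "phi t (sum u A) = (\<Sum>i\<in>A. phi t (u i))"
  and phi_0: "phi t 0 = 0"
  by (simp_all add: phi_def const.lift_add const.lift_diff const.lift_sum const.lift_0)

lemma phi_expo: "phi t (expo a) = const (t a) * gexp N a"
  by (simp add: phi_def expo_def const.lift_single)

lemma eval_at_eq: "eval_at t = lift (\<lambda>c. c) t"
  by (rule ext) (simp add: eval_at_def lift_def)

end

section \<open>The map to the local algebra at one torus point\<close>

locale arrangement_point = arrangement \<Lambda> X
  for \<Lambda> :: "'v::real_vector set" and X :: "'v list" +
  fixes t :: "'v \<Rightarrow> complex"
  assumes t_torus: "t \<in> torus \<Lambda>"
begin

abbreviation "Z \<equiv> sublist_at X t"

lemma length_Z: "length Z < N"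
  by (simp add: N_def sublist_at_def less_Suc_eq_le)

sublocale K: pm_ideal "K_ideal Z"
  by (rule pm_ideal_K)

notation K.equiv_mod (infix "\<approx>" 50)

lemma nilpotent: "positive_degree p \<Longrightarrow> p ^ N \<in> K_ideal Z"
  using positive_degree_nilpotent[OF _ length_Z] .

lemma gexp_add: "gexp N (a + b) \<approx> gexp N a * gexp N b"
proof -
  have "gexp N (a + b) \<approx> fps_at N (fps_exp 1) (gen_var a + gen_var b)"
    unfolding gexp_def by (intro K.fps_at_cong gen_var_add_equiv)
  also have "\<dots> \<approx> gexp N a * gexp N b"
    unfolding gexp_def
  proof (rule K.exp_add)
    fix i j assume "N \<le> i + j"
    then show "gen_var a ^ i * gen_var b ^ j \<in> K_ideal Z"
      unfolding gen_var_power mult_single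
      by (intro K_high_degree) (use length_Z in \<open>simp add: tdeg_add\<close>)
  qed
  finally show ?thesis .
qed

lemma gexp_0: "gexp N 0 \<approx> 1"
proof -
  have "gexp N 0 \<approx> fps_at N (fps_exp 1) 0"
    unfolding gexp_def by (intro K.fps_at_cong gen_var_0_equiv)
  also have "fps_at N (fps_exp 1) 0 = 1"
    unfolding fps_at_def using N_pos by (subst sum.remove[of _ 0]) (auto intro!: sum.neutral simp: power_0_left)
  finally show ?thesis .
qed

lemma phi_mult: "f \<in> R \<Longrightarrow> g \<in> R \<Longrightarrow> phi t (f * g) \<approx> phi t f * phi t g"
  unfolding phi_def
proof (rule const.lift_mult_mod[OF K.ideal_congruence_axioms, where M = \<Lambda>])
  fix a b assume ab: "a \<in> \<Lambda>" "b \<in> \<Lambda>"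
  have "const (t (a + b)) * gexp N (a + b) \<approx> const (t (a + b)) * (gexp N a * gexp N b)"
    by (intro K.equiv_mult K.equiv_refl gexp_add)
  then show "const (t (a + b)) * gexp N (a + b) \<approx> const (t a) * gexp N a * (const (t b) * gexp N b)"
    using L.torus_simps(2)[OF t_torus ab] by (simp add: const_mult mult_ac)
qed auto

lemma phi_const: "phi t (const c) \<approx> const c"
proof -
  have "phi t (const c) = const c * (const (t 0) * gexp N 0)"
    by (simp add: phi_def const_def const.lift_single)
  also have "\<dots> \<approx> const c * (const (t 0) * 1)"
    by (intro K.equiv_mult K.equiv_refl gexp_0)
  finally show ?thesis by (simp add: L.torus_simps(3)[OF t_torus])
qed

lemma phi_1: "phi t 1 \<approx> 1"
  using phi_const[of 1] by simp

lemma phi_const_mult: "f \<in> R \<Longrightarrow> phi t (const c * f) \<approx> const c * phi t f"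
proof -
  assume "f \<in> R"
  then have "phi t (const c * f) \<approx> phi t (const c) * phi t f"
    using keys_const_closed by (intro phi_mult) auto
  also have "\<dots> \<approx> const c * phi t f"
    by (intro K.equiv_mult phi_const K.equiv_refl)
  finally show ?thesis .
qed

lemma phi_prod: "(\<And>i. i \<in> A \<Longrightarrow> u i \<in> R) \<Longrightarrow> phi t (prod u A) \<approx> (\<Prod>i\<in>A. phi t (u i))"
proof (induction A rule: infinite_finite_induct)
  case (insert i A)
  have "phi t (prod u (insert i A)) = phi t (u i * prod u A)"
    using insert.hyps by simp
  also have "\<dots> \<approx> phi t (u i) * phi t (prod u A)"
    using insert.prems keys_prod_closed[of A u] by (intro phi_mult) auto
  also have "\<dots> \<approx> phi t (u i) * (\<Prod>i\<in>A. phi t (u i))"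
    using insert by (intro K.equiv_mult K.equiv_refl) auto
  finally show ?case using insert.hyps by simp
qed (simp_all add: phi_1)

lemma phi_power: "f \<in> R \<Longrightarrow> phi t (f ^ n) \<approx> phi t f ^ n"
  using phi_prod[of "{..<n}" "\<lambda>_. f"] by simp

text \<open>Each \<open>gexp N a - 1\<close> has positive degree, so the constant term of the image
  is the value at \<open>t\<close>. A function vanishing at \<open>t\<close> therefore becomes
  nilpotent, and any other becomes invertible.\<close>

lemma phi_minus_eval: "positive_degree (phi t f - const (eval_at t f))"
proof -
  have "phi t f - const (eval_at t f) = (\<Sum>a\<in>keys f. const (lookup f a * t a) * (gexp N a - 1))"
    by (simp add: phi_def lift_def eval_at_def const_sum const_mult right_diff_distrib sum_subtractf mult.assoc)
  then show ?thesis
    using gexp_minus_1[OF N_pos] by (auto intro!: positive_degree_sum positive_degree_mult)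
qed

lemma phi_nilpotent:
  assumes "eval_at t f = 0"
  shows "phi t f ^ N \<in> K_ideal Z"
  using phi_minus_eval[of f] assms by (intro nilpotent) simp

lemma phi_unit:
  assumes "eval_at t f \<noteq> 0"
  shows "\<exists>u. u * phi t f \<approx> 1"
proof -
  let ?c = "eval_at t f"
  have "const ?c * const (inverse ?c) = (1 :: ('v \<Rightarrow>\<^sub>0 nat) \<Rightarrow>\<^sub>0 complex)"
    using assms by (simp flip: const_mult)
  from K.unit_plus_nilpotent[OF this nilpotent[OF phi_minus_eval[of f]]] show ?thesis by simp
qed

lemma factor_equiv:
  assumes "i < length X" "t (X ! i) = 1"
  shows "\<exists>u. phi t (1 - expo (- (X ! i))) \<approx> gen_var (X ! i) * u"
proof -
  obtain u where u: "fps_at N (fps_exp 1 - 1) (gen_var (- (X ! i))) = gen_var (- (X ! i)) * u"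
    using fps_at_multiple[of "fps_exp 1 - 1"] by auto
  have "t (- (X ! i)) = 1"
    using L.torus_simps(4)[OF t_torus X_nth[OF assms(1)]] assms(2) by simp
  then have "phi t (1 - expo (- (X ! i))) = phi t 1 - gexp N (- (X ! i))"
    by (simp add: phi_diff phi_expo)
  also have "\<dots> \<approx> 1 - gexp N (- (X ! i))"
    by (intro K.equiv_diff phi_1 K.equiv_refl)
  also have "1 - gexp N (- (X ! i)) = gen_var (- (X ! i)) * (- u)"
    using u N_pos by (simp add: gexp_def fps_at_diff fps_at_1 algebra_simps)
  also have "\<dots> \<approx> - gen_var (X ! i) * (- u)"
    by (intro K.equiv_mult gen_var_uminus_equiv K.equiv_refl)
  finally show ?thesis by auto
qed

text \<open>Restricted to the vectors with value 1 at \<open>t\<close>, a cocircuit stays a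
  cocircuit: what the smaller list retains is among what \<open>X\<close> retains, hence still fails
  to span.\<close>

lemma cocircuit_at:
  assumes Y: "Y \<in> cocircuits X"
  shows "(\<Prod>i\<in>{i \<in> Y. t (X ! i) = 1}. gen_var (X ! i)) \<in> K_ideal Z"
proof -
  let ?S = "{i. i < length X \<and> t (X ! i) = 1}"
  let ?Y = "{i \<in> Y. t (X ! i) = 1}"
  obtain \<sigma> where bij: "bij_betw \<sigma> {..<length Z} ?S" and nth: "\<And>k. k < length Z \<Longrightarrow> Z ! k = X ! \<sigma> k"
    using filter_reindex[of "\<lambda>a. t a = 1" X] by (auto simp: sublist_at_def)
  have YS: "?Y \<subseteq> ?S" using Y by (auto simp: cocircuits_def)
  define Y0 where "Y0 = {k. k < length Z \<and> \<sigma> k \<in> ?Y}"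
  have "bij_betw \<sigma> Y0 ?Y"
    using bij YS unfolding bij_betw_def Y0_def by (auto simp: inj_on_def)
  then have "zprod Z Y0 = (\<Prod>i\<in>?Y. gen_var (X ! i))"
    unfolding zprod_def by (subst prod.reindex_bij_betw[symmetric]) (auto simp: Y0_def nth intro!: prod.cong)
  moreover have "Y0 \<in> cocircuits Z"
  proof -
    have "(!) Z ` ({..<length Z} - Y0) \<subseteq> (!) X ` ({..<length X} - Y)"
    proof
      fix w assume "w \<in> (!) Z ` ({..<length Z} - Y0)"
      then obtain k where k: "k < length Z" "\<sigma> k \<notin> ?Y" "w = X ! \<sigma> k"
        using nth by (auto simp: Y0_def)
      moreover have "\<sigma> k \<in> ?S" using bij k(1) by (auto simp: bij_betw_def)
      ultimately show "w \<in> (!) X ` ({..<length X} - Y)" by auto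
    qed
    then have "span ((!) Z ` ({..<length Z} - Y0)) \<subseteq> span ((!) X ` ({..<length X} - Y))"
      by (rule span_mono)
    then have "span ((!) Z ` ({..<length Z} - Y0)) \<noteq> UNIV"
      using Y by (auto simp: cocircuits_def)
    then show ?thesis by (auto simp: cocircuits_def Y0_def)
  qed
  ultimately show ?thesis using K_gens(2) by metis
qed

text \<open>The factors with \<open>t (X ! i) = 1\<close> supply a product of vectors that already
  lies in the ideal; all remaining factors go into the cofactor.\<close>

lemma phi_hyper:
  assumes Y: "Y \<in> cocircuits X"
  shows "phi t (hyper Y) \<in> K_ideal Z"
proof -
  have YX: "Y \<subseteq> {..<length X}" using Y by (auto simp: cocircuits_def)
  then have finY: "finite Y" by (rule finite_subset) simp
  let ?Y = "{i \<in> Y. t (X ! i) = 1}"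
  let ?f = "\<lambda>i. phi t (1 - expo (- (X ! i)))"
  have "\<exists>u. ?f i \<approx> gen_var (X ! i) * u" if "i \<in> ?Y" for i
    using factor_equiv[of i] that YX by auto
  then obtain u where u: "\<And>i. i \<in> ?Y \<Longrightarrow> ?f i \<approx> gen_var (X ! i) * u i" by metis
  have "phi t (hyper Y) \<approx> (\<Prod>i\<in>Y. ?f i)"
    unfolding hyper_def by (rule phi_prod) (use keys_factor YX in auto)
  also have "(\<Prod>i\<in>Y. ?f i) = (\<Prod>i\<in>?Y. ?f i) * (\<Prod>i\<in>Y - ?Y. ?f i)"
    using finY by (subst prod.subset_diff[of ?Y]) (auto simp: mult.commute)
  also have "\<dots> \<approx> (\<Prod>i\<in>?Y. gen_var (X ! i) * u i) * (\<Prod>i\<in>Y - ?Y. ?f i)"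
    by (intro K.equiv_mult K.equiv_prod u K.equiv_refl)
  also have "\<dots> = (\<Prod>i\<in>?Y. gen_var (X ! i)) * ((\<Prod>i\<in>?Y. u i) * (\<Prod>i\<in>Y - ?Y. ?f i))"
    by (simp add: prod.distrib mult.assoc)
  also have "\<dots> \<approx> 0"
    unfolding K.equiv_zero_iff by (intro K.mult_mem_right cocircuit_at Y)
  finally show ?thesis by (simp add: K.equiv_zero_iff)
qed

lemma vanishing_ideal: "ideal {f \<in> R. phi t f \<in> K_ideal Z} (group_alg \<Lambda>)"
  unfolding ideal_monoid_alg_iff
proof (intro conjI ballI allI impI)
  fix f g assume "f \<in> {f \<in> R. phi t f \<in> K_ideal Z}" "g \<in> {f \<in> R. phi t f \<in> K_ideal Z}"
  then show "f + g \<in> {f \<in> R. phi t f \<in> K_ideal Z}"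
    using keys_add_closed[of f g] by (simp add: phi_add K.add_mem)
next
  fix f g :: "'v \<Rightarrow>\<^sub>0 complex" assume *: "keys f \<subseteq> \<Lambda>" "g \<in> {f \<in> R. phi t f \<in> K_ideal Z}"
  then have "phi t (f * g) \<in> K_ideal Z"
    using K.equiv_mem_iff[OF phi_mult[of f g]] K.mult_mem by auto
  then show "f * g \<in> {f \<in> R. phi t f \<in> K_ideal Z}"
    using * keys_mult_closed[of f g] by simp
qed (auto simp: phi_0 K.zero_mem)

lemma phi_J: "J_ideal \<Lambda> X \<subseteq> {f \<in> R. phi t f \<in> K_ideal Z}"
proof -
  have "hyper Y \<in> R" if "Y \<in> cocircuits X" for Y
    using keys_hyper[of Y] that by (auto simp: cocircuits_def)
  then show ?thesis
    unfolding J_ideal_def hyper_def[symmetric]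
    by (intro genideal_least vanishing_ideal) (use phi_hyper in auto)
qed

text \<open>The image is a subalgebra modulo \<open>K_ideal Z\<close>, so reaching the generators
  suffices. The truncated logarithm reaches the vectors of \<open>\<Lambda>\<close>; all other
  vectors are real combinations of \<open>X\<close>.\<close>

lemma phi_onto: "\<exists>f\<in>R. phi t f \<approx> p"
proof -
  let ?C = "{p. \<exists>f\<in>R. phi t f \<approx> p}"
  have const_C: "const c \<in> ?C" for c
    using keys_const_closed phi_const by (intro CollectI bexI[of _ "const c"]) auto
  have add_C: "p + q \<in> ?C" if "p \<in> ?C" "q \<in> ?C" for p q
  proof -
    obtain f g where "f \<in> R" "phi t f \<approx> p" "g \<in> R" "phi t g \<approx> q" using \<open>p \<in> ?C\<close> \<open>q \<in> ?C\<close> by blast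
    then show ?thesis
      using keys_add_closed[of f g] K.equiv_add[of "phi t f" p "phi t g" q]
      by (intro CollectI bexI[of _ "f + g"]) (auto simp: phi_add)
  qed
  have mult_C: "p * q \<in> ?C" if "p \<in> ?C" "q \<in> ?C" for p q
  proof -
    obtain f g where fg: "f \<in> R" "phi t f \<approx> p" "g \<in> R" "phi t g \<approx> q" using \<open>p \<in> ?C\<close> \<open>q \<in> ?C\<close> by blast
    then have "phi t (f * g) \<approx> p * q"
      using K.equiv_trans[OF phi_mult K.equiv_mult] by blast
    then show ?thesis
      using fg keys_mult_closed[of f g] by (intro CollectI bexI[of _ "f * g"]) auto
  qed
  have pow_C: "p ^ n \<in> ?C" if "p \<in> ?C" for p n
    by (induction n) (use const_C[of 1] mult_C that in \<open>auto simp del: mem_Collect_eq\<close>)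
  have sum_C: "sum f A \<in> ?C" if "\<And>i. i \<in> A \<Longrightarrow> f i \<in> ?C" for f :: "nat \<Rightarrow> _" and A
    using that
  proof (induction A rule: infinite_finite_induct)
    case (insert i A)
    then show ?case using add_C[of "f i" "sum f A"] by simp
  qed (use const_C[of 0] in simp_all)
  have equiv_C: "q \<in> ?C" if "p \<in> ?C" "p \<approx> q" for p q
    using that K.equiv_trans by blast
  have gv: "gen_var a \<in> ?C" if a: "a \<in> \<Lambda>" for a
  proof -
    have "phi t (const (inverse (t a)) * expo a) \<approx> const (inverse (t a)) * (const (t a) * gexp N a)"
      using phi_const_mult[of "expo a"] keys_expo[OF a] by (simp add: phi_expo)
    moreover have "const (inverse (t a)) * (const (t a) * gexp N a) = gexp N a"
      using L.torus_simps(1)[OF t_torus a] by (simp flip: mult.assoc const_mult)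
    moreover have "const (inverse (t a)) * expo a \<in> R"
      using keys_mult_closed[OF keys_const_closed keys_expo[OF a]] by simp
    ultimately have "gexp N a \<in> ?C" by auto
    then have e: "gexp N a - 1 \<in> ?C"
      using add_C[OF _ const_C[of "-1"]] by (simp add: const_uminus)
    have "fps_at N (fps_ln 1) (gexp N a - 1) \<in> ?C"
      unfolding fps_at_def by (intro sum_C mult_C const_C pow_C e)
    moreover have "fps_at N (fps_ln 1) (gexp N a - 1) \<approx> gen_var a"
      unfolding gexp_def by (intro K.log_exp nilpotent positive_degree_gen_var N_pos)
    ultimately show ?thesis by (rule equiv_C)
  qed
  have gen: "gen_var v \<in> ?C" for v
  proof -
    have "(!) X ` {..<length X} = set X" by (auto simp: set_conv_nth)
    then obtain c where c: "v = (\<Sum>i<length X. c i *\<^sub>R X ! i)"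
      using span_image_sum[of "{..<length X}" v "(!) X"] X_span by auto
    have "(\<Sum>i<length X. const (of_real (c i)) * gen_var (X ! i)) \<in> ?C"
      by (intro sum_C mult_C const_C gv X_nth) simp
    then show ?thesis
      unfolding c by (rule equiv_C[OF _ K.equiv_sym[OF gen_var_sum_equiv]])
  qed
  have "p \<in> ?C"
    by (rule poly_generated[OF const_C gen add_C mult_C])
  then show ?thesis by simp
qed

text \<open>If \<open>t\<close> lies in \<open>T(b)\<close>, all vectors of \<open>b\<close> survive
  in the sublist at \<open>t\<close>, and matching the positions turns \<open>b\<close> into a basis
  there.\<close>

lemma card_bases_at: "card {b \<in> bases X. t \<in> torus_points \<Lambda> X b} \<le> card (bases Z)"
proof -
  let ?S = "{i. i < length X \<and> t (X ! i) = 1}"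
  obtain \<sigma> where bij: "bij_betw \<sigma> {..<length Z} ?S" and nth: "\<And>k. k < length Z \<Longrightarrow> Z ! k = X ! \<sigma> k"
    using filter_reindex[of "\<lambda>a. t a = 1" X] by (auto simp: sublist_at_def)
  define g where "g b = {k. k < length Z \<and> \<sigma> k \<in> b}" for b
  have \<sigma>g: "\<sigma> ` g b = b" if "b \<in> bases X" "t \<in> torus_points \<Lambda> X b" for b
  proof -
    have "b \<subseteq> ?S" using that by (auto simp: bases_def torus_points_def)
    then show ?thesis using bij by (auto simp: g_def bij_betw_def)
  qed
  have "g b \<in> bases Z" if b: "b \<in> bases X" "t \<in> torus_points \<Lambda> X b" for b
  proof -
    have "(!) Z ` g b = (!) X ` \<sigma> ` g b"
      unfolding image_image by (rule image_cong) (auto simp: g_def nth)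
    then have img: "(!) Z ` g b = (!) X ` b" using \<sigma>g[OF b] by simp
    have "inj_on ((!) Z) (g b)"
    proof (rule inj_onI)
      fix k l assume kl: "k \<in> g b" "l \<in> g b" "Z ! k = Z ! l"
      then have "\<sigma> k = \<sigma> l"
        using b(1) by (auto simp: g_def nth bases_def dest: inj_onD)
      then show "k = l" using bij kl by (auto simp: g_def bij_betw_def dest: inj_onD)
    qed
    then show ?thesis using b(1) img by (auto simp: bases_def g_def)
  qed
  moreover have "inj_on g {b \<in> bases X. t \<in> torus_points \<Lambda> X b}"
    by (rule inj_onI) (use \<sigma>g in \<open>metis (no_types, lifting) mem_Collect_eq\<close>)
  ultimately show ?thesis by (intro card_inj_on_le[of g] bases_finite) auto
qed

end

section \<open>The Chinese remainder theorem and the dimension count\<close>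

context arrangement
begin

lemma P_torus: "t \<in> P \<Longrightarrow> t \<in> torus \<Lambda>"
  by (auto simp: P_points_def torus_points_def)

lemma point: "t \<in> P \<Longrightarrow> arrangement_point \<Lambda> X t"
  by unfold_locales (rule P_torus)

lemma eval_at_mult:
  assumes "t \<in> P" "f \<in> R" "g \<in> R"
  shows "eval_at t (f * g) = eval_at t f * eval_at t g"
  unfolding eval_at_eq
  by (rule id.lift_mult[where M = \<Lambda>])
     (use assms L.torus_simps(2)[OF P_torus[OF assms(1)]] in auto)

lemma eval_at_1: "t \<in> P \<Longrightarrow> eval_at t 1 = 1"
  unfolding eval_at_eq by (rule id.lift_1) (rule L.torus_simps(3)[OF P_torus])

lemma eval_at_power:
  assumes "t \<in> P" "f \<in> R"
  shows "eval_at t (f ^ n) = eval_at t f ^ n"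
  by (induction n) (use assms keys_power_closed[of f] in \<open>auto simp: eval_at_1 eval_at_mult\<close>)

lemma eval_at_prod:
  assumes "t \<in> P" "\<And>i. i \<in> A \<Longrightarrow> u i \<in> R"
  shows "eval_at t (prod u A) = (\<Prod>i\<in>A. eval_at t (u i))"
  using assms(2)
proof (induction A rule: infinite_finite_induct)
  case (insert i A)
  then show ?case
    using keys_prod_closed[of A u] eval_at_mult[OF assms(1), of "u i" "prod u A"] by auto
qed (use assms(1) in \<open>simp_all add: eval_at_1\<close>)

text \<open>Distinct characters differ at some \<open>a \<in> \<Lambda>\<close>. The factor
  \<open>expo a - const (t' a)\<close> vanishes at \<open>t'\<close> but not at \<open>t\<close>,
  and its \<open>N\<close>-th power dies in the local algebra at \<open>t'\<close>.\<close>

lemma separating_element: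
  assumes t: "t \<in> P"
  shows "\<exists>g\<in>R. eval_at t g \<noteq> 0 \<and> (\<forall>t'\<in>P - {t}. phi t' g \<in> K_ideal (sublist_at X t'))"
proof -
  have "\<exists>a\<in>\<Lambda>. t a \<noteq> t' a" if t': "t' \<in> P - {t}" for t'
  proof (rule ccontr)
    assume "\<not> ?thesis"
    moreover have "t \<in> extensional \<Lambda>" "t' \<in> extensional \<Lambda>"
      using P_torus[of t] P_torus[of t'] t t' by (auto simp: torus_def PiE_def)
    ultimately have "t = t'" by (intro extensionalityI[of t \<Lambda> t']) auto
    then show False using t' by simp
  qed
  then obtain a where a: "\<And>t'. t' \<in> P - {t} \<Longrightarrow> a t' \<in> \<Lambda> \<and> t (a t') \<noteq> t' (a t')" by metis
  define h where "h t' = expo (a t') - const (t' (a t'))" for t'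
  have hR: "h t' \<in> R" if "t' \<in> P - {t}" for t'
    using keys_diff_closed[OF keys_expo keys_const_closed] a[OF that] by (simp add: h_def)
  have ev_h: "eval_at s (h t') = s (a t') - t' (a t')" if "s \<in> P" "t' \<in> P - {t}" for s t'
    using L.torus_simps(3)[OF P_torus[OF that(1)]]
    by (simp add: eval_at_eq h_def expo_def const_def id.lift_diff id.lift_single)
  define g where "g = (\<Prod>t'\<in>P - {t}. h t' ^ N)"
  have hNR: "h t' ^ N \<in> R" if "t' \<in> P - {t}" for t'
    using hR[OF that] keys_power_closed by simp
  have "g \<in> R"
    unfolding g_def using keys_prod_closed[of "P - {t}" "\<lambda>t'. h t' ^ N"] hNR by simp
  moreover have "eval_at t g \<noteq> 0"
  proof -
    have "eval_at t g = (\<Prod>t'\<in>P - {t}. eval_at t (h t' ^ N))"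
      unfolding g_def by (rule eval_at_prod[OF t hNR])
    also have "\<dots> = (\<Prod>t'\<in>P - {t}. eval_at t (h t') ^ N)"
      by (intro prod.cong refl eval_at_power t hR)
    finally have "eval_at t g = (\<Prod>t'\<in>P - {t}. eval_at t (h t') ^ N)" .
    then show ?thesis
      using finite_P_points ev_h[OF t] a by (auto simp: prod_zero_iff)
  qed
  moreover have "phi t' g \<in> K_ideal (sublist_at X t')" if t': "t' \<in> P - {t}" for t'
  proof -
    interpret arrangement_point \<Lambda> X t' using point t' by simp
    have "phi t' g \<approx> (\<Prod>s\<in>P - {t}. phi t' (h s ^ N))"
      unfolding g_def by (rule phi_prod) (rule hNR)
    also have "\<dots> = phi t' (h t' ^ N) * (\<Prod>s\<in>P - {t} - {t'}. phi t' (h s ^ N))"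
      using finite_P_points t' by (intro prod.remove) auto
    also have "\<dots> \<approx> 0"
    proof -
      have "phi t' (h t') ^ N \<in> K_ideal Z"
        using ev_h[of t' t'] t' by (intro phi_nilpotent) simp
      then have "phi t' (h t' ^ N) \<in> K_ideal Z"
        using K.equiv_mem_iff[OF phi_power[OF hR[OF t']]] by simp
      then show ?thesis unfolding K.equiv_zero_iff by (rule K.mult_mem_right)
    qed
    finally show ?thesis by (simp add: K.equiv_zero_iff)
  qed
  ultimately show ?thesis by blast
qed

text \<open>The separating element \<open>g\<close> is invertible at \<open>t\<close>, with inverse
  \<open>u\<close>, and dies at the other points; multiplying it by a preimage of
  \<open>u * p\<close> adjusts the value at \<open>t\<close> to \<open>p\<close>.\<close>

lemma chinese_remainder_single:
  assumes t: "t \<in> P"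
  shows "\<exists>f\<in>R. phi t f - p \<in> K_ideal (sublist_at X t) \<and>
    (\<forall>t'\<in>P - {t}. phi t' f \<in> K_ideal (sublist_at X t'))"
proof -
  interpret T: arrangement_point \<Lambda> X t using point t .
  obtain g where g: "g \<in> R" "eval_at t g \<noteq> 0"
    "\<And>t'. t' \<in> P - {t} \<Longrightarrow> phi t' g \<in> K_ideal (sublist_at X t')"
    using separating_element[OF t] by blast
  obtain u where u: "T.K.equiv_mod (u * phi t g) 1"
    using T.phi_unit[OF g(2)] by blast
  obtain f where f: "f \<in> R" "T.K.equiv_mod (phi t f) (u * p)"
    using T.phi_onto by blast
  have "T.K.equiv_mod (phi t (f * g)) (phi t f * phi t g)"
    by (rule T.phi_mult[OF f(1) g(1)])
  also have "T.K.equiv_mod (phi t f * phi t g) (u * p * phi t g)"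
    by (intro T.K.equiv_mult f(2) T.K.equiv_refl)
  also have "u * p * phi t g = u * phi t g * p" by (simp add: mult_ac)
  also have "T.K.equiv_mod (u * phi t g * p) (1 * p)"
    by (intro T.K.equiv_mult u T.K.equiv_refl)
  finally have "phi t (f * g) - p \<in> K_ideal (sublist_at X t)"
    by (simp add: T.K.equiv_mod_def)
  moreover have "phi t' (f * g) \<in> K_ideal (sublist_at X t')" if t': "t' \<in> P - {t}" for t'
  proof -
    interpret T': arrangement_point \<Lambda> X t' using point t' by simp
    show ?thesis
      using ideal_mult[OF T'.vanishing_ideal, of f g] f(1) g(1) g(3)[OF t'] by auto
  qed
  moreover have "f * g \<in> R" using f g keys_mult_closed[of f g] by simp
  ultimately show ?thesis by blast
qed

lemma chinese_remainder:
  "\<exists>f\<in>R. \<forall>t\<in>P. phi t f - p t \<in> K_ideal (sublist_at X t)"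
proof -
  let ?Q = "\<lambda>t f. f \<in> R \<and> phi t f - p t \<in> K_ideal (sublist_at X t) \<and>
    (\<forall>t'\<in>P - {t}. phi t' f \<in> K_ideal (sublist_at X t'))"
  define f where "f t = (SOME f. ?Q t f)" for t
  have "?Q t (f t)" if "t \<in> P" for t
    unfolding f_def by (rule someI_ex) (use chinese_remainder_single[OF that, of "p t"] in blast)
  then have f: "\<And>t. t \<in> P \<Longrightarrow> f t \<in> R" "\<And>t. t \<in> P \<Longrightarrow> phi t (f t) - p t \<in> K_ideal (sublist_at X t)"
    "\<And>t t'. t \<in> P \<Longrightarrow> t' \<in> P - {t} \<Longrightarrow> phi t' (f t) \<in> K_ideal (sublist_at X t')"
    by blast+
  have "sum f P \<in> R" using keys_sum_closed[of P f] f(1) by simp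
  moreover have "phi t (sum f P) - p t \<in> K_ideal (sublist_at X t)" if t: "t \<in> P" for t
  proof -
    interpret pm_ideal "K_ideal (sublist_at X t)" by (rule pm_ideal_K)
    have "phi t (sum f P) - p t = (phi t (f t) - p t) + (\<Sum>t'\<in>P - {t}. phi t (f t'))"
      unfolding phi_sum using finite_P_points t by (subst sum.remove[of _ t]) auto
    also have "\<dots> \<in> K_ideal (sublist_at X t)"
      using t f by (intro add_mem sum_mem) auto
    finally show ?thesis .
  qed
  ultimately show ?thesis by blast
qed

text \<open>The kernel of the map to the direct sum of the local algebras, to be identified with
  \<open>J_ideal \<Lambda> X\<close>.\<close>

definition J' :: "('v \<Rightarrow>\<^sub>0 complex) set" where
  "J' = {f \<in> R. \<forall>t\<in>P. phi t f \<in> K_ideal (sublist_at X t)}"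

lemma K_ideal_zero: "0 \<in> K_ideal Z"
  and K_ideal_add: "p \<in> K_ideal Z \<Longrightarrow> q \<in> K_ideal Z \<Longrightarrow> p + q \<in> K_ideal Z"
  using pm_ideal_K[of Z] by (simp_all add: pm_ideal_def ideal_congruence_def)

lemma J'_subspace: "pm_subspace J'"
proof
  show "0 \<in> J'"
    by (simp add: J'_def phi_0 K_ideal_zero)
next
  fix f g assume fg: "f \<in> J'" "g \<in> J'"
  then have "phi t (f + g) \<in> K_ideal (sublist_at X t)" if "t \<in> P" for t
    using that by (simp add: J'_def phi_add K_ideal_add)
  then show "f + g \<in> J'"
    using fg keys_add_closed[of f g] by (simp add: J'_def)
next
  fix f c assume f: "f \<in> J'"
  have "phi t (const c * f) \<in> K_ideal (sublist_at X t)" if t: "t \<in> P" for t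
  proof -
    interpret arrangement_point \<Lambda> X t using point t .
    show ?thesis
      using f t ideal_mult[OF vanishing_ideal, of "const c" f] keys_const_closed by (auto simp: J'_def)
  qed
  then show "const c * f \<in> J'"
    using f keys_mult_closed[OF keys_const_closed, of f] by (simp add: J'_def)
qed

lemma J_subset_J': "J_ideal \<Lambda> X \<subseteq> J'"
proof
  fix f assume f: "f \<in> J_ideal \<Lambda> X"
  have "phi t f \<in> K_ideal (sublist_at X t)" if "t \<in> P" for t
    using subsetD[OF arrangement_point.phi_J[OF point[OF that]] f] by simp
  then show "f \<in> J'"
    using ideal_memD[OF J_ideal_ideal f] by (simp add: J'_def)
qed

text \<open>Double counting of the pairs of a basis \<open>b\<close> and a point of
  \<open>T(b)\<close>: each \<open>b\<close> has \<open>abs_det \<Lambda> X b\<close> points, and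
  the bases at a given \<open>t\<close> are bounded by \<open>card_bases_at\<close>.\<close>

lemma delta_le:
  "delta \<Lambda> X \<le> (\<Sum>t\<in>P. card (bases (sublist_at X t)))"
proof -
  have "delta \<Lambda> X = (\<Sum>b\<in>bases X. card {t \<in> P. t \<in> torus_points \<Lambda> X b})"
    unfolding delta_def
  proof (intro sum.cong refl)
    fix b assume b: "b \<in> bases X"
    then have "{t \<in> P. t \<in> torus_points \<Lambda> X b} = torus_points \<Lambda> X b" by (auto simp: P_points_def)
    then show "abs_det \<Lambda> X b = card {t \<in> P. t \<in> torus_points \<Lambda> X b}"
      using card_torus_points(2)[OF b] by simp
  qed
  also have "\<dots> = (\<Sum>t\<in>P. card {b \<in> bases X. t \<in> torus_points \<Lambda> X b})"
    by (rule sum_multicount_gen[symmetric]) (auto simp: finite_P_points bases_finite)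
  also have "\<dots> \<le> (\<Sum>t\<in>P. card (bases (sublist_at X t)))"
    by (intro sum_mono arrangement_point.card_bases_at point)
  finally show ?thesis .
qed

text \<open>Bases of the local algebras, lifted by the Chinese remainder theorem, form together an
  independent family modulo \<open>J'\<close>.\<close>

lemma spanning_card:
  assumes F: "finite F" and spans: "\<And>f. f \<in> R \<Longrightarrow> f \<in> span_mod J' (\<lambda>f. f) F"
  shows "delta \<Lambda> X \<le> card F"
proof (rule ccontr)
  assume less: "\<not> delta \<Lambda> X \<le> card F"
  interpret J': pm_subspace J' by (rule J'_subspace)
  let ?Z = "\<lambda>t. sublist_at X t"
  have "\<exists>G\<subseteq>Pow {..<length (?Z t)}. card (bases (?Z t)) \<le> card G \<and>
      pm_subspace.indep (K_ideal (?Z t)) (zprod (?Z t)) G" for t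
    by (rule A_basis)
  then obtain G where G: "\<And>t. G t \<subseteq> Pow {..<length (?Z t)}"
    "\<And>t. card (bases (?Z t)) \<le> card (G t)"
    "\<And>t. pm_subspace.indep (K_ideal (?Z t)) (zprod (?Z t)) (G t)" by metis
  have finG: "finite (G t)" for t using G(1)[of t] by (rule finite_subset) simp
  define D where "D = Sigma P G"
  have finD: "finite D" unfolding D_def using finite_P_points finG by auto
  have "delta \<Lambda> X \<le> (\<Sum>t\<in>P. card (G t))"
    using delta_le sum_mono[of P "\<lambda>t. card (bases (?Z t))" "\<lambda>t. card (G t)"] G(2) by (meson order_trans)
  also have "\<dots> = card D" unfolding D_def using finite_P_points finG by simp
  finally have cardD: "card F < card D" using less by simp
  let ?Q = "\<lambda>d f. f \<in> R \<and> phi (fst d) f - zprod (?Z (fst d)) (snd d) \<in> K_ideal (?Z (fst d)) \<and>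
      (\<forall>t'\<in>P - {fst d}. phi t' f \<in> K_ideal (?Z t'))"
  define f where "f d = (SOME f. ?Q d f)" for d
  have "?Q d (f d)" if "d \<in> D" for d
  proof -
    have "fst d \<in> P" using that by (auto simp: D_def)
    from chinese_remainder_single[OF this, of "zprod (?Z (fst d)) (snd d)"] show ?thesis
      unfolding f_def by (intro someI_ex[of "?Q d"]) blast
  qed
  then have f: "\<And>d. d \<in> D \<Longrightarrow> f d \<in> R"
    "\<And>d. d \<in> D \<Longrightarrow> phi (fst d) (f d) - zprod (?Z (fst d)) (snd d) \<in> K_ideal (?Z (fst d))"
    "\<And>d t'. d \<in> D \<Longrightarrow> t' \<in> P - {fst d} \<Longrightarrow> phi t' (f d) \<in> K_ideal (?Z t')"
    by blast+
  have "\<exists>c. f d - comb c (\<lambda>f. f) F \<in> J'" if "d \<in> D" for d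
    using spans[OF f(1)[OF that]] by (simp add: span_mod_def)
  then obtain c where c: "\<And>d. d \<in> D \<Longrightarrow> f d - comb (c d) (\<lambda>f. f) F \<in> J'" by metis
  \<comment> \<open>There are more lifts than elements of \<open>F\<close>, so the coefficient
    vectors of their expansions are linearly dependent.\<close>
  obtain e where e: "\<exists>d\<in>D. e d \<noteq> 0" "\<And>g. g \<in> F \<Longrightarrow> (\<Sum>d\<in>D. e d * c d g) = 0"
    using homogeneous_system[OF F finD cardD, of c] by blast
  have "(\<Sum>d\<in>D. const (e d) * comb (c d) (\<lambda>f. f) F) = (\<Sum>g\<in>F. const (\<Sum>d\<in>D. e d * c d g) * g)"
    unfolding comb_def const_sum sum_distrib_left sum_distrib_right const_mult mult.assoc
    by (rule sum.swap)
  also have "\<dots> = 0" using e(2) by simp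
  finally have "(\<Sum>d\<in>D. const (e d) * f d) = (\<Sum>d\<in>D. const (e d) * (f d - comb (c d) (\<lambda>f. f) F))"
    by (simp add: right_diff_distrib sum_subtractf)
  also have "\<dots> \<in> J'"
  proof -
    have sum_J': "sum g A \<in> J'" if "\<And>d. d \<in> A \<Longrightarrow> g d \<in> J'" for A :: "(('v \<Rightarrow> complex) \<times> nat set) set" and g
      using that by (induction A rule: infinite_finite_induct) (auto simp: J'.zero_in J'.add_in)
    show ?thesis by (rule sum_J') (rule J'.scale_in[OF c])
  qed
  finally have inJ: "(\<Sum>d\<in>D. const (e d) * f d) \<in> J'" .
  \<comment> \<open>Reduction at \<open>t\<close> kills the lifts belonging to other points and
    leaves a relation among independent products in the local algebra.\<close>
  have "e (t, Y) = 0" if t: "t \<in> P" and Y: "Y \<in> G t" for t Y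
  proof -
    interpret arrangement_point \<Lambda> X t using point t .
    have "phi t (const (e d) * f d) \<approx> (if fst d = t then const (e d) * zprod Z (snd d) else 0)" if d: "d \<in> D" for d
    proof -
      have "phi t (const (e d) * f d) \<approx> const (e d) * phi t (f d)"
        by (rule phi_const_mult[OF f(1)[OF d]])
      also have "\<dots> \<approx> const (e d) * (if fst d = t then zprod Z (snd d) else 0)"
      proof (intro K.equiv_mult K.equiv_refl)
        show "phi t (f d) \<approx> (if fst d = t then zprod Z (snd d) else 0)"
          using f(2)[OF d] f(3)[OF d, of t] t by (auto simp: K.equiv_mod_def)
      qed
      finally show ?thesis by (simp split: if_splits)
    qed
    then have "phi t (\<Sum>d\<in>D. const (e d) * f d) \<approx> (\<Sum>d\<in>D. if fst d = t then const (e d) * zprod Z (snd d) else 0)"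
      unfolding phi_sum by (rule K.equiv_sum)
    also have "(\<Sum>d\<in>D. if fst d = t then const (e d) * zprod Z (snd d) else 0) =
        (\<Sum>d\<in>Pair t ` G t. const (e d) * zprod Z (snd d))"
      using finD t by (intro sum.mono_neutral_cong_right) (auto simp: D_def)
    also have "\<dots> = comb (\<lambda>Y. e (t, Y)) (zprod Z) (G t)"
      by (simp add: comb_def sum.reindex inj_on_def)
    finally have "comb (\<lambda>Y. e (t, Y)) (zprod Z) (G t) \<in> K_ideal Z"
      using K.equiv_mem_iff inJ t by (auto simp: J'_def)
    then show ?thesis
      using G(3)[of t] Y unfolding K.sub.indep_def by blast
  qed
  then show False using e(1) by (auto simp: D_def)
qed

text \<open>Here the bounds meet. A family of at most \<open>delta \<Lambda> X\<close> elements
  spanning modulo \<open>J_ideal\<close> also spans modulo the larger \<open>J'\<close>, and no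
  smaller family does, so none of its elements is redundant.\<close>

lemma basis_mod_J:
  "\<exists>F. finite F \<and> F \<subseteq> R \<and> card F = delta \<Lambda> X \<and> (\<forall>f\<in>R. f \<in> span_mod (J_ideal \<Lambda> X) (\<lambda>f. f) F) \<and>
    pm_subspace.indep J' (\<lambda>f. f) F"
proof -
  interpret J': pm_subspace J' by (rule J'_subspace)
  obtain F where F: "finite F" "card F \<le> delta \<Lambda> X" "\<forall>f\<in>F. keys f \<subseteq> \<Lambda>"
    "\<And>f. keys f \<subseteq> \<Lambda> \<Longrightarrow> f \<in> span_mod (J_ideal \<Lambda> X) (\<lambda>f. f) F"
    using upper_bound by blast
  have spans: "f \<in> span_mod J' (\<lambda>f. f) F" if "keys f \<subseteq> \<Lambda>" for f
    using F(4)[OF that] J_subset_J' unfolding span_mod_def by blast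
  then have card: "card F = delta \<Lambda> X"
    using spanning_card[OF F(1)] F(2) by (auto intro: antisym)
  have "J'.indep (\<lambda>f. f) F"
    unfolding J'.indep_def
  proof (intro allI impI ballI, rule ccontr)
    fix c i assume c: "comb c (\<lambda>f. f) F \<in> J'" "i \<in> F" "c i \<noteq> 0"
    have "J'.spans \<Lambda> (\<lambda>f. f) F"
      unfolding J'.spans_def using spans by blast
    then have "J'.spans \<Lambda> (\<lambda>f. f) (F - {i})"
      by (rule J'.spans_remove) (use F(1) c in auto)
    then have "delta \<Lambda> X \<le> card (F - {i})"
      using F(1) by (intro spanning_card) (auto simp: J'.spans_def)
    then show False using card_Diff1_less[OF F(1) c(2)] card by simp
  qed
  then show ?thesis using F card by (intro exI[of _ F]) auto
qed

text \<open>Modulo \<open>J_ideal\<close> an element of \<open>J'\<close> is a combination of the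
  family; that combination then lies in \<open>J'\<close> and so has zero coefficients.\<close>

lemma J'_eq: "J' = J_ideal \<Lambda> X"
proof (rule antisym[OF subsetI J_subset_J'])
  interpret J': pm_subspace J' by (rule J'_subspace)
  fix f assume f: "f \<in> J'"
  obtain F where F: "F \<subseteq> R" "\<And>f. f \<in> R \<Longrightarrow> f \<in> span_mod (J_ideal \<Lambda> X) (\<lambda>f. f) F" "J'.indep (\<lambda>f. f) F"
    using basis_mod_J by blast
  obtain c where c: "f - comb c (\<lambda>f. f) F \<in> J_ideal \<Lambda> X"
    using F(2)[of f] f by (auto simp: J'_def span_mod_def)
  have "f - (f - comb c (\<lambda>f. f) F) \<in> J'"
    by (rule J'.diff_in[OF f subsetD[OF J_subset_J' c]])
  then have "comb c (\<lambda>f. f) F \<in> J'" by simp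
  then have "\<forall>i\<in>F. c i = 0" using F(3) unfolding J'.indep_def by blast
  then show "f \<in> J_ideal \<Lambda> X" using c by (simp add: comb_def)
qed

end

section \<open>The local and the global isomorphism\<close>

lemma (in complex_algebra) quot_alg_factor:
  assumes I: "ideal I A" and B: "complex_algebra B" and g: "g \<in> alg_hom A B"
    and ker: "\<And>x. x \<in> I \<Longrightarrow> g x = \<zero>\<^bsub>B\<^esub>"
  shows "\<exists>h \<in> alg_hom (quot_alg A I) B. \<forall>x\<in>carrier A. h (I +> x) = g x"
proof -
  interpret I: ideal I A by fact
  interpret B: complex_algebra B by fact
  interpret g: ring_hom_cring A B g by unfold_locales (rule alg_hom_ring_hom[OF g])
  define h where "h C = g (SOME x. x \<in> carrier A \<and> I +> x = C)" for C
  have h: "h (I +> x) = g x" if x: "x \<in> carrier A" for x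
  proof -
    define y where "y = (SOME y. y \<in> carrier A \<and> I +> y = I +> x)"
    have y: "y \<in> carrier A \<and> I +> y = I +> x"
      unfolding y_def by (rule someI_ex) (use x in blast)
    then have "y \<ominus> x \<in> I"
      using quotient_eq_iff_same_a_r_cos[OF I, of y x] x by simp
    then have "g (y \<ominus> x) = \<zero>\<^bsub>B\<^esub>" by (rule ker)
    then have "g y \<ominus>\<^bsub>B\<^esub> g x = \<zero>\<^bsub>B\<^esub>"
      using x y by (simp add: minus_eq B.minus_eq)
    then show ?thesis
      using x y by (simp add: h_def y_def[symmetric])
  qed
  note c = quot_alg_hom[OF I]
  note cr = alg_hom_ring_hom[OF c]
  have "h \<in> alg_hom (quot_alg A I) B"
    unfolding alg_hom_def
  proof (intro CollectI conjI allI ballI ring_hom_memI)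
    fix C assume "C \<in> carrier (quot_alg A I)"
    then obtain x where x: "x \<in> carrier A" "C = I +> x" unfolding quot_alg_carrier by auto
    then show "h C \<in> carrier B" using h by simp
    show "h (a \<odot>\<^bsub>quot_alg A I\<^esub> C) = a \<odot>\<^bsub>B\<^esub> h C" for a
      using x h alg_hom_smult[OF c x(1), of a] alg_hom_smult[OF g x(1), of a] by (metis smult_closed)
  next
    fix C D assume "C \<in> carrier (quot_alg A I)" "D \<in> carrier (quot_alg A I)"
    then obtain x y where x: "x \<in> carrier A" "C = I +> x" and y: "y \<in> carrier A" "D = I +> y"
      unfolding quot_alg_carrier by auto
    have "C \<otimes>\<^bsub>quot_alg A I\<^esub> D = I +> (x \<otimes> y)" "C \<oplus>\<^bsub>quot_alg A I\<^esub> D = I +> (x \<oplus> y)"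
      unfolding x(2) y(2) using ring_hom_mult[OF cr x(1) y(1)] ring_hom_add[OF cr x(1) y(1)] by simp_all
    then show "h (C \<otimes>\<^bsub>quot_alg A I\<^esub> D) = h C \<otimes>\<^bsub>B\<^esub> h D" "h (C \<oplus>\<^bsub>quot_alg A I\<^esub> D) = h C \<oplus>\<^bsub>B\<^esub> h D"
      using x y h by simp_all
  next
    have "\<one>\<^bsub>quot_alg A I\<^esub> = I +> \<one>" using ring_hom_one[OF cr] by simp
    then show "h \<one>\<^bsub>quot_alg A I\<^esub> = \<one>\<^bsub>B\<^esub>" using h by simp
  qed
  then show ?thesis using h by blast
qed

context arrangement
begin

lemma J_quot_algebra: "complex_algebra (J_quot \<Lambda> X)"
  unfolding J_quot_def by (rule alg.quot_alg_complex_algebra[OF J_ideal_ideal])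

lemma J_cls_hom: "J_cls \<Lambda> X \<in> alg_hom (group_alg \<Lambda>) (J_quot \<Lambda> X)"
proof -
  have "J_cls \<Lambda> X = (+>\<^bsub>group_alg \<Lambda>\<^esub>) (J_ideal \<Lambda> X)" by (rule ext) (simp add: J_cls_def)
  then show ?thesis
    unfolding J_quot_def using alg.quot_alg_hom[OF J_ideal_ideal] by simp
qed

lemma J_quot_carrier: "carrier (J_quot \<Lambda> X) = J_cls \<Lambda> X ` R"
  unfolding J_quot_def alg.quot_alg_carrier by (auto simp: J_cls_def)

lemma J_cls_zero_iff: "f \<in> R \<Longrightarrow> J_cls \<Lambda> X f = \<zero>\<^bsub>J_quot \<Lambda> X\<^esub> \<longleftrightarrow> f \<in> J_ideal \<Lambda> X"
  unfolding J_quot_def J_cls_def by (rule alg.quot_alg_zero_iff[OF J_ideal_ideal]) simp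

lemma J_cls_eqI: "f \<in> R \<Longrightarrow> g \<in> R \<Longrightarrow> f - g \<in> J_ideal \<Lambda> X \<Longrightarrow> J_cls \<Lambda> X f = J_cls \<Lambda> X g"
  unfolding J_cls_def
  using alg.quotient_eq_iff_same_a_r_cos[OF J_ideal_ideal, of f g]
  by (simp add: alg.minus_eq a_inv_monoid_alg)

lemma J_cls_simps:
  "f \<in> R \<Longrightarrow> J_cls \<Lambda> X f \<in> carrier (J_quot \<Lambda> X)"
  "f \<in> R \<Longrightarrow> g \<in> R \<Longrightarrow> J_cls \<Lambda> X f \<otimes>\<^bsub>J_quot \<Lambda> X\<^esub> J_cls \<Lambda> X g = J_cls \<Lambda> X (f * g)"
  "\<one>\<^bsub>J_quot \<Lambda> X\<^esub> = J_cls \<Lambda> X 1"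
  using ring_hom_closed[OF alg_hom_ring_hom[OF J_cls_hom], of f]
    ring_hom_mult[OF alg_hom_ring_hom[OF J_cls_hom], of f g]
    ring_hom_one[OF alg_hom_ring_hom[OF J_cls_hom]]
  by simp_all

lemma has_dim: "has_complex_dim (J_quot \<Lambda> X) (delta \<Lambda> X)"
proof -
  obtain F where F: "finite F" "F \<subseteq> R" "card F = delta \<Lambda> X"
    "\<And>f. f \<in> R \<Longrightarrow> f \<in> span_mod (J_ideal \<Lambda> X) (\<lambda>f. f) F" "pm_subspace.indep J' (\<lambda>f. f) F"
    using basis_mod_J by blast
  interpret J': pm_subspace J' by (rule J'_subspace)
  have comb_R: "comb c (\<lambda>f. f) F \<in> R" for c
    unfolding comb_def using keys_sum_closed[of F "\<lambda>f. const (c f) * f"] keys_mult_closed[OF keys_const_closed] F(2)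
    by auto
  have "has_complex_dim (J_quot \<Lambda> X) (card F)"
  proof (rule has_complex_dim_basis[OF add_submonoid_axioms J_cls_hom J_quot_algebra, where u = "\<lambda>f. f"])
    show "J_cls \<Lambda> X ` carrier (group_alg \<Lambda>) = carrier (J_quot \<Lambda> X)"
      by (simp add: J_quot_carrier)
    show "c i = 0" if "J_cls \<Lambda> X (comb c (\<lambda>f. f) F) = \<zero>\<^bsub>J_quot \<Lambda> X\<^esub>" "i \<in> F" for c i
    proof -
      have "comb c (\<lambda>f. f) F \<in> J'"
        using that(1) J_cls_zero_iff[OF comb_R] by (simp add: J'_eq)
      then show ?thesis using that(2) F(5) unfolding J'.indep_def by blast
    qed
    show "\<exists>c. J_cls \<Lambda> X f = J_cls \<Lambda> X (comb c (\<lambda>f. f) F)" if kf: "keys f \<subseteq> \<Lambda>" for f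
    proof -
      obtain c where "f - comb c (\<lambda>f. f) F \<in> J_ideal \<Lambda> X"
        using F(4)[of f] kf by (auto simp: span_mod_def)
      then show ?thesis using J_cls_eqI[of f "comb c (\<lambda>f. f) F"] comb_R kf by blast
    qed
  qed (use F in auto)
  then show ?thesis using F(3) by simp
qed

end

section \<open>The localization at one point\<close>

context arrangement_point
begin

lemma A_cls_equiv: "p \<approx> q \<Longrightarrow> A_cls Z p = A_cls Z q"
proof -
  assume "p \<approx> q"
  interpret A: complex_algebra "A_alg Z" by (rule A_alg_complex_algebra)
  note h = alg_hom_ring_hom[OF A_cls_hom[of Z]]
  have "A_cls Z (p - q) = \<zero>\<^bsub>A_alg Z\<^esub>"
    using \<open>p \<approx> q\<close> by (simp add: A_cls_zero_iff K.equiv_mod_def)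
  moreover have "A_cls Z p = A_cls Z (p - q) \<oplus>\<^bsub>A_alg Z\<^esub> A_cls Z q"
    using ring_hom_add[OF h, of "p - q" q] by simp
  moreover have "A_cls Z q \<in> carrier (A_alg Z)"
    using ring_hom_closed[OF h, of q] by simp
  ultimately show ?thesis by simp
qed

lemma A_cls_simps:
  "A_cls Z p \<in> carrier (A_alg Z)"
  "A_cls Z (p * q) = A_cls Z p \<otimes>\<^bsub>A_alg Z\<^esub> A_cls Z q"
  "A_cls Z (p + q) = A_cls Z p \<oplus>\<^bsub>A_alg Z\<^esub> A_cls Z q"
  "A_cls Z 1 = \<one>\<^bsub>A_alg Z\<^esub>"
  "A_cls Z (const c * p) = c \<odot>\<^bsub>A_alg Z\<^esub> A_cls Z p"
  using ring_hom_closed[OF alg_hom_ring_hom[OF A_cls_hom[of Z]], of p]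
    ring_hom_mult[OF alg_hom_ring_hom[OF A_cls_hom[of Z]], of p q]
    ring_hom_add[OF alg_hom_ring_hom[OF A_cls_hom[of Z]], of p q]
    ring_hom_one[OF alg_hom_ring_hom[OF A_cls_hom[of Z]]]
    alg_hom_smult[OF A_cls_hom[of Z], of p c]
  by simp_all

lemma local_hom: "(\<lambda>f. A_cls Z (phi t f)) \<in> alg_hom (group_alg \<Lambda>) (A_alg Z)"
  unfolding alg_hom_def
proof (intro CollectI conjI allI ballI ring_hom_memI)
  fix f g assume fg: "f \<in> carrier (group_alg \<Lambda>)" "g \<in> carrier (group_alg \<Lambda>)"
  show "A_cls Z (phi t (f \<otimes>\<^bsub>group_alg \<Lambda>\<^esub> g)) = A_cls Z (phi t f) \<otimes>\<^bsub>A_alg Z\<^esub> A_cls Z (phi t g)"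
    using fg A_cls_equiv[OF phi_mult[of f g]] by (simp add: A_cls_simps)
  show "A_cls Z (phi t (f \<oplus>\<^bsub>group_alg \<Lambda>\<^esub> g)) = A_cls Z (phi t f) \<oplus>\<^bsub>A_alg Z\<^esub> A_cls Z (phi t g)"
    by (simp add: phi_add A_cls_simps)
next
  fix f c assume "f \<in> carrier (group_alg \<Lambda>)"
  then show "A_cls Z (phi t (c \<odot>\<^bsub>group_alg \<Lambda>\<^esub> f)) = c \<odot>\<^bsub>A_alg Z\<^esub> A_cls Z (phi t f)"
    using A_cls_equiv[OF phi_const_mult[of f c]] by (simp add: A_cls_simps(5))
next
  show "A_cls Z (phi t \<one>\<^bsub>group_alg \<Lambda>\<^esub>) = \<one>\<^bsub>A_alg Z\<^esub>"
    using A_cls_equiv[OF phi_1] by (simp add: A_cls_simps)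
qed (simp add: A_cls_simps)

definition loc_hom :: "('v \<Rightarrow>\<^sub>0 complex) set \<Rightarrow> (('v \<Rightarrow>\<^sub>0 nat) \<Rightarrow>\<^sub>0 complex) set set" where
  "loc_hom = (SOME h. h \<in> alg_hom (J_quot \<Lambda> X) (A_alg Z) \<and> (\<forall>f\<in>R. h (J_cls \<Lambda> X f) = A_cls Z (phi t f)))"

lemma loc_hom:
  "loc_hom \<in> alg_hom (J_quot \<Lambda> X) (A_alg Z)"
  "f \<in> R \<Longrightarrow> loc_hom (J_cls \<Lambda> X f) = A_cls Z (phi t f)"
proof -
  have "\<exists>h\<in>alg_hom (quot_alg (group_alg \<Lambda>) (J_ideal \<Lambda> X)) (A_alg Z). \<forall>x\<in>carrier (group_alg \<Lambda>).
      h (J_ideal \<Lambda> X +>\<^bsub>group_alg \<Lambda>\<^esub> x) = A_cls Z (phi t x)"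
    by (rule alg.quot_alg_factor[OF J_ideal_ideal A_alg_complex_algebra local_hom])
       (use phi_J in \<open>auto simp: A_cls_zero_iff\<close>)
  then have "\<exists>h. h \<in> alg_hom (J_quot \<Lambda> X) (A_alg Z) \<and> (\<forall>f\<in>R. h (J_cls \<Lambda> X f) = A_cls Z (phi t f))"
    by (simp add: J_quot_def J_cls_def Bex_def)
  from someI_ex[OF this]
  show "loc_hom \<in> alg_hom (J_quot \<Lambda> X) (A_alg Z)"
    "f \<in> R \<Longrightarrow> loc_hom (J_cls \<Lambda> X f) = A_cls Z (phi t f)"
    unfolding loc_hom_def by blast+
qed

lemma localization_at_point:
  assumes t: "t \<in> P"
  shows "localization_hom (J_quot \<Lambda> X) (A_alg Z) loc_hom (denominators \<Lambda> X t)"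
proof (intro localization_hom.intro localization_hom_axioms.intro J_quot_algebra A_alg_complex_algebra)
  interpret A: complex_algebra "A_alg Z" by (rule A_alg_complex_algebra)
  show "loc_hom \<in> alg_hom (J_quot \<Lambda> X) (A_alg Z)" by (rule loc_hom)
  show "loc_hom ` carrier (J_quot \<Lambda> X) = carrier (A_alg Z)"
  proof (intro equalityI subsetI)
    fix b assume "b \<in> carrier (A_alg Z)"
    then obtain p where p: "b = A_cls Z p" unfolding A_cls_onto[symmetric] by auto
    obtain f where f: "f \<in> R" "phi t f \<approx> p" using phi_onto by blast
    then have "b = loc_hom (J_cls \<Lambda> X f)"
      using loc_hom(2)[OF f(1)] A_cls_equiv[OF f(2)] p by simp
    then show "b \<in> loc_hom ` carrier (J_quot \<Lambda> X)"
      using f(1) by (simp add: J_cls_simps)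
  qed (use loc_hom(2) in \<open>auto simp: J_quot_carrier A_cls_simps\<close>)
  have D: "denominators \<Lambda> X t = {J_cls \<Lambda> X g | g. g \<in> R \<and> eval_at t g \<noteq> 0}"
    by (simp add: denominators_def)
  show "denominators \<Lambda> X t \<subseteq> carrier (J_quot \<Lambda> X)"
    unfolding D using J_cls_simps(1) by blast
  show "\<one>\<^bsub>J_quot \<Lambda> X\<^esub> \<in> denominators \<Lambda> X t"
    unfolding D J_cls_simps(3) using eval_at_1[OF t] keys_1_closed by (auto intro!: exI[of _ 1])
  show "m \<otimes>\<^bsub>J_quot \<Lambda> X\<^esub> n \<in> denominators \<Lambda> X t"
    if m: "m \<in> denominators \<Lambda> X t" and n: "n \<in> denominators \<Lambda> X t" for m n
  proof -
    obtain f g where fg: "f \<in> R" "eval_at t f \<noteq> 0" "m = J_cls \<Lambda> X f"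
      "g \<in> R" "eval_at t g \<noteq> 0" "n = J_cls \<Lambda> X g"
      using m n unfolding D by blast
    then have "m \<otimes>\<^bsub>J_quot \<Lambda> X\<^esub> n = J_cls \<Lambda> X (f * g)" by (simp add: J_cls_simps)
    moreover have "f * g \<in> R" using fg keys_mult_closed[of f g] by simp
    moreover have "eval_at t (f * g) \<noteq> 0" using fg eval_at_mult[OF t] by simp
    ultimately show ?thesis unfolding D by blast
  qed
  show "loc_hom m \<in> Units (A_alg Z)" if m: "m \<in> denominators \<Lambda> X t" for m
  proof -
    obtain g where g: "g \<in> R" "eval_at t g \<noteq> 0" "m = J_cls \<Lambda> X g" using m unfolding D by blast
    obtain u where "u * phi t g \<approx> 1" using phi_unit[OF g(2)] by blast
    then have "A_cls Z u \<otimes>\<^bsub>A_alg Z\<^esub> loc_hom m = \<one>\<^bsub>A_alg Z\<^esub>"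
      using A_cls_equiv g by (metis A_cls_simps(2,4) loc_hom(2))
    moreover from this have "loc_hom m \<otimes>\<^bsub>A_alg Z\<^esub> A_cls Z u = \<one>\<^bsub>A_alg Z\<^esub>"
      using g loc_hom(2)[OF g(1)] A_cls_simps(1) by (simp add: A.m_comm)
    ultimately show ?thesis
      unfolding Units_def using g loc_hom(2)[OF g(1)] A_cls_simps(1) by auto
  qed
  show "\<exists>u\<in>denominators \<Lambda> X t. u \<otimes>\<^bsub>J_quot \<Lambda> X\<^esub> x = \<zero>\<^bsub>J_quot \<Lambda> X\<^esub>"
    if x: "x \<in> carrier (J_quot \<Lambda> X)" "loc_hom x = \<zero>\<^bsub>A_alg Z\<^esub>" for x
  proof -
    obtain f where f: "f \<in> R" "x = J_cls \<Lambda> X f" using x(1) unfolding J_quot_carrier by blast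
    then have fK: "phi t f \<in> K_ideal Z"
      using x(2) loc_hom(2)[OF f(1)] by (simp add: A_cls_zero_iff)
    obtain g where g: "g \<in> R" "eval_at t g \<noteq> 0"
      "\<And>t'. t' \<in> P - {t} \<Longrightarrow> phi t' g \<in> K_ideal (sublist_at X t')"
      using separating_element[OF t] by blast
    \<comment> \<open>Multiplying by \<open>g\<close> takes care of the other points:
      \<open>f\<close> dies in the algebra at \<open>t\<close>, and \<open>g\<close> in those at all
      other \<open>t'\<close>, so the product lies in \<open>J'\<close>, which is
      \<open>J_ideal\<close>.\<close>
    have "phi t' (f * g) \<in> K_ideal (sublist_at X t')" if t': "t' \<in> P" for t'
    proof -
      interpret T': arrangement_point \<Lambda> X t' using point t' by simp
      show ?thesis
      proof (cases "t' = t")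
        case True
        then show ?thesis
          using ideal_mult[OF vanishing_ideal, of g f] f(1) g(1) fK by (simp add: mult.commute)
      next
        case False
        then show ?thesis
          using ideal_mult[OF T'.vanishing_ideal, of f g] f(1) g(1) g(3)[of t'] t' by simp
      qed
    qed
    then have "g * f \<in> J_ideal \<Lambda> X"
      using f(1) g(1) keys_mult_closed[of f g] unfolding J'_eq[symmetric] J'_def by (simp add: mult.commute)
    then have "J_cls \<Lambda> X g \<otimes>\<^bsub>J_quot \<Lambda> X\<^esub> x = \<zero>\<^bsub>J_quot \<Lambda> X\<^esub>"
      using f g(1) J_cls_zero_iff[of "g * f"] keys_mult_closed[of g f] by (simp add: J_cls_simps)
    then show ?thesis
      using g unfolding D by blast
  qed
qed

text \<open>The isomorphism runs from the algebra to the localization because fractions are fibres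
  of the map onto \<open>A_alg Z\<close>. Under it \<open>unip \<Lambda> X \<phi> a\<close>
  corresponds to the class of \<open>gexp N a - 1\<close>, whose logarithm is the class of
  \<open>a\<close>.\<close>

lemma local_isomorphism:
  assumes t: "t \<in> P" and \<phi>: "t = exp_point \<Lambda> \<phi>"
  shows "(\<forall>a\<in>\<Lambda>. nilpotent_elem (J_loc \<Lambda> X t) (unip \<Lambda> X \<phi> a)) \<and>
    (\<exists>\<Psi>\<in>alg_iso (A_alg Z) (J_loc \<Lambda> X t).
       \<forall>a\<in>\<Lambda>. \<Psi> (A_vec Z a) = log1p_alg (J_loc \<Lambda> X t) (unip \<Lambda> X \<phi> a))"
proof -
  interpret loc: localization_hom "J_quot \<Lambda> X" "A_alg Z" loc_hom "denominators \<Lambda> X t"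
    by (rule localization_at_point[OF t])
  have iso: "loc.fibre \<in> alg_iso (A_alg Z) (J_loc \<Lambda> X t)"
    unfolding J_loc_def by (rule loc.fibre_iso)
  have zero: "loc.fibre \<zero>\<^bsub>A_alg Z\<^esub> = \<zero>\<^bsub>J_loc \<Lambda> X t\<^esub>"
    unfolding J_loc_def by (rule loc.fibre_zero)
  have unip: "unip \<Lambda> X \<phi> a = loc.fibre (A_cls Z (gexp N a - 1))" if a: "a \<in> \<Lambda>" for a
  proof -
    let ?f = "const (exp (- \<phi> a)) * expo a - 1"
    have fR: "?f \<in> R"
      using keys_diff_closed[OF keys_mult_closed[OF keys_const_closed keys_expo[OF a]] keys_1_closed] by simp
    have "unip \<Lambda> X \<phi> a = frac_cls (J_quot \<Lambda> X) (denominators \<Lambda> X t) (J_cls \<Lambda> X ?f) \<one>\<^bsub>J_quot \<Lambda> X\<^esub>"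
      by (simp add: unip_def J_loc_cls_def \<phi>)
    also have "\<dots> = loc.fibre (loc_hom (J_cls \<Lambda> X ?f))"
      by (rule loc.frac_cls_image) (rule J_cls_simps(1)[OF fR])
    also have "loc_hom (J_cls \<Lambda> X ?f) = A_cls Z (phi t ?f)"
      by (rule loc_hom(2)[OF fR])
    also have "\<dots> = A_cls Z (gexp N a - 1)"
    proof (rule A_cls_equiv)
      have "t a = exp (\<phi> a)" using a by (simp add: \<phi> exp_point_def)
      then have "exp (- \<phi> a) * t a = 1" by (simp add: exp_minus)
      then have eq: "const (exp (- \<phi> a)) * (const (t a) * gexp N a) = gexp N a"
        by (simp flip: mult.assoc const_mult)
      have "phi t (const (exp (- \<phi> a)) * expo a) \<approx> const (exp (- \<phi> a)) * phi t (expo a)"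
        using keys_expo[OF a] by (intro phi_const_mult) simp
      then have "phi t (const (exp (- \<phi> a)) * expo a) \<approx> gexp N a"
        by (simp add: phi_expo eq)
      then show "phi t ?f \<approx> gexp N a - 1"
        unfolding phi_diff by (intro K.equiv_diff phi_1)
    qed
    finally show ?thesis .
  qed
  have zeroN: "A_cls Z ((gexp N a - 1) ^ N) = \<zero>\<^bsub>A_alg Z\<^esub>" for a
    unfolding A_cls_zero_iff by (intro nilpotent gexp_minus_1 N_pos)
  note log = monoid_alg_log1p[OF univ.add_submonoid_axioms A_cls_hom A_alg_complex_algebra subset_UNIV zeroN]
  have log1p: "log1p_alg (A_alg Z) (A_cls Z (gexp N a - 1)) = A_vec Z a" for a
    unfolding log(2) A_vec_eq unfolding gexp_def
    by (intro A_cls_equiv K.log_exp nilpotent positive_degree_gen_var N_pos)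
  have "nilpotent_elem (J_loc \<Lambda> X t) (unip \<Lambda> X \<phi> a)" if "a \<in> \<Lambda>" for a
    unfolding unip[OF that]
    by (rule alg_iso_nilpotent[OF iso A_alg_complex_algebra zero A_cls_simps(1) log(1)])
  moreover have "loc.fibre (A_vec Z a) = log1p_alg (J_loc \<Lambda> X t) (unip \<Lambda> X \<phi> a)" if "a \<in> \<Lambda>" for a
    unfolding unip[OF that] alg_iso_log1p[OF iso A_alg_complex_algebra zero A_cls_simps(1)] log1p ..
  ultimately show ?thesis using iso by blast
qed

end

section \<open>The direct sum decomposition\<close>

context arrangement
begin

text \<open>The local maps are assembled componentwise; injectivity is the identity
  \<open>J' = J_ideal\<close>, and surjectivity is the Chinese remainder theorem.\<close>

lemma direct_sum_isomorphism:
  "alg_iso (J_quot \<Lambda> X) (direct_sum_alg P (\<lambda>t. A_alg (sublist_at X t))) \<noteq> {}"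
proof -
  define H where "H C = (\<lambda>t\<in>P. arrangement_point.loc_hom \<Lambda> X t C)" for C
  let ?S = "direct_sum_alg P (\<lambda>t. A_alg (sublist_at X t))"
  have hom: "arrangement_point.loc_hom \<Lambda> X t \<in> alg_hom (J_quot \<Lambda> X) (A_alg (sublist_at X t))"
    if "t \<in> P" for t
    by (rule arrangement_point.loc_hom(1)[OF point[OF that]])
  have cls: "arrangement_point.loc_hom \<Lambda> X t (J_cls \<Lambda> X f) = A_cls (sublist_at X t) (phi t f)"
    if "t \<in> P" "f \<in> R" for t f
    by (rule arrangement_point.loc_hom(2)[OF point[OF that(1)] that(2)])
  have "H \<in> alg_hom (J_quot \<Lambda> X) ?S"
    unfolding alg_hom_def
  proof (intro CollectI conjI allI ballI ring_hom_memI)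
    fix C assume "C \<in> carrier (J_quot \<Lambda> X)"
    then show "H C \<in> carrier ?S"
      using ring_hom_closed[OF alg_hom_ring_hom[OF hom]] by (simp add: direct_sum_alg_def H_def)
    show "H (c \<odot>\<^bsub>J_quot \<Lambda> X\<^esub> C) = c \<odot>\<^bsub>?S\<^esub> H C" for c
      using alg_hom_smult[OF hom \<open>C \<in> carrier (J_quot \<Lambda> X)\<close>]
      by (auto simp: direct_sum_alg_def H_def intro!: restrict_ext)
  next
    fix C D assume "C \<in> carrier (J_quot \<Lambda> X)" "D \<in> carrier (J_quot \<Lambda> X)"
    then show "H (C \<otimes>\<^bsub>J_quot \<Lambda> X\<^esub> D) = H C \<otimes>\<^bsub>?S\<^esub> H D" "H (C \<oplus>\<^bsub>J_quot \<Lambda> X\<^esub> D) = H C \<oplus>\<^bsub>?S\<^esub> H D"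
      using ring_hom_mult[OF alg_hom_ring_hom[OF hom]] ring_hom_add[OF alg_hom_ring_hom[OF hom]]
      by (auto simp: direct_sum_alg_def H_def intro!: restrict_ext)
  next
    show "H \<one>\<^bsub>J_quot \<Lambda> X\<^esub> = \<one>\<^bsub>?S\<^esub>"
      using ring_hom_one[OF alg_hom_ring_hom[OF hom]]
      by (auto simp: direct_sum_alg_def H_def intro!: restrict_ext)
  qed
  moreover have "bij_betw H (carrier (J_quot \<Lambda> X)) (carrier ?S)"
    unfolding bij_betw_def
  proof (intro conjI)
    show "inj_on H (carrier (J_quot \<Lambda> X))"
    proof (rule inj_onI)
      fix C D assume "C \<in> carrier (J_quot \<Lambda> X)" "D \<in> carrier (J_quot \<Lambda> X)" and eq: "H C = H D"
      then obtain f g where fg: "f \<in> R" "C = J_cls \<Lambda> X f" "g \<in> R" "D = J_cls \<Lambda> X g"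
        unfolding J_quot_carrier by blast
      have "phi t (f - g) \<in> K_ideal (sublist_at X t)" if t: "t \<in> P" for t
      proof -
        interpret arrangement_point \<Lambda> X t using point t .
        interpret A: complex_algebra "A_alg Z" by (rule A_alg_complex_algebra)
        have "A_cls Z (phi t f) = A_cls Z (phi t g)"
          using fun_cong[OF eq, of t] t fg cls by (simp add: H_def)
        moreover have "A_cls Z (phi t f) = A_cls Z (phi t (f - g)) \<oplus>\<^bsub>A_alg Z\<^esub> A_cls Z (phi t g)"
          by (simp add: phi_diff flip: A_cls_simps(3))
        ultimately have "A_cls Z (phi t (f - g)) = \<zero>\<^bsub>A_alg Z\<^esub>"
          using A_cls_simps(1) by (metis A.add.r_cancel_one')
        then show ?thesis by (simp add: A_cls_zero_iff)
      qed
      then have "f - g \<in> J_ideal \<Lambda> X"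
        using fg keys_diff_closed[of f g] unfolding J'_eq[symmetric] J'_def by simp
      then show "C = D" using J_cls_eqI fg by simp
    qed
    show "H ` carrier (J_quot \<Lambda> X) = carrier ?S"
    proof (intro equalityI subsetI)
      fix x assume x: "x \<in> carrier ?S"
      then have xP: "x \<in> (\<Pi>\<^sub>E t\<in>P. carrier (A_alg (sublist_at X t)))" by (simp add: direct_sum_alg_def)
      then have "\<exists>p. x t = A_cls (sublist_at X t) p" if "t \<in> P" for t
        using that PiE_mem[OF xP that] unfolding A_cls_onto[symmetric] by auto
      then obtain p where p: "\<And>t. t \<in> P \<Longrightarrow> x t = A_cls (sublist_at X t) (p t)" by metis
      obtain f where f: "f \<in> R" "\<And>t. t \<in> P \<Longrightarrow> phi t f - p t \<in> K_ideal (sublist_at X t)"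
        using chinese_remainder[of p] by blast
      have "H (J_cls \<Lambda> X f) = x"
      proof (rule extensionalityI[of _ P])
        show "x \<in> extensional P" using xP by (auto simp: PiE_def)
        fix t assume t: "t \<in> P"
        interpret arrangement_point \<Lambda> X t using point t .
        have "A_cls Z (phi t f) = A_cls Z (p t)"
          using f(2)[OF t] by (intro A_cls_equiv) (simp add: K.equiv_mod_def)
        then show "H (J_cls \<Lambda> X f) t = x t"
          using t p[OF t] cls[OF t f(1)] by (simp add: H_def)
      qed (simp add: H_def)
      then show "x \<in> H ` carrier (J_quot \<Lambda> X)"
        using f(1) J_cls_simps(1) by blast
    next
      fix x assume "x \<in> H ` carrier (J_quot \<Lambda> X)"
      then show "x \<in> carrier ?S"
        using ring_hom_closed[OF alg_hom_ring_hom[OF hom]] by (auto simp: direct_sum_alg_def H_def)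
    qed
  qed
  ultimately show ?thesis using alg_isoI by blast
qed

end

theorem theorem9p12:
  fixes \<Lambda> :: "'v::real_vector set" and X :: "'v list" and s :: nat
  assumes "dim (UNIV :: 'v set) = s"
    and "spanning_lattice \<Lambda>"
    and "set X \<subseteq> \<Lambda> - {0}"
    and "span (set X) = UNIV"
  shows "(\<forall>(\<phi> :: 'v \<Rightarrow> complex) t. linear \<phi> \<longrightarrow> t = exp_point \<Lambda> \<phi> \<longrightarrow> t \<in> P_points \<Lambda> X \<longrightarrow>
            (\<forall>a\<in>\<Lambda>. nilpotent_elem (J_loc \<Lambda> X t) (unip \<Lambda> X \<phi> a)) \<and>
            (\<exists>\<Psi> \<in> alg_iso (A_alg (sublist_at X t)) (J_loc \<Lambda> X t).
               \<forall>a\<in>\<Lambda>. \<Psi> (A_vec (sublist_at X t) a) = log1p_alg (J_loc \<Lambda> X t) (unip \<Lambda> X \<phi> a))) \<and>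
         alg_iso (J_quot \<Lambda> X)
           (direct_sum_alg (P_points \<Lambda> X) (\<lambda>t. A_alg (sublist_at X t))) \<noteq> {} \<and>
         has_complex_dim (J_quot \<Lambda> X) (delta \<Lambda> X)"
proof -
  interpret arrangement \<Lambda> X
    by unfold_locales (use assms in auto)
  show ?thesis
  proof (rule conjI[OF _ conjI[OF direct_sum_isomorphism has_dim]], intro allI impI)
    fix \<phi> :: "'v \<Rightarrow> complex" and t
    assume t: "t = exp_point \<Lambda> \<phi>" "t \<in> P_points \<Lambda> X"
    show "(\<forall>a\<in>\<Lambda>. nilpotent_elem (J_loc \<Lambda> X t) (unip \<Lambda> X \<phi> a)) \<and>
        (\<exists>\<Psi> \<in> alg_iso (A_alg (sublist_at X t)) (J_loc \<Lambda> X t).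
           \<forall>a\<in>\<Lambda>. \<Psi> (A_vec (sublist_at X t) a) = log1p_alg (J_loc \<Lambda> X t) (unip \<Lambda> X \<phi> a))"
      by (rule arrangement_point.local_isomorphism[OF point[OF t(2)] t(2,1)])
  qed
qed

end
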